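(* Let the problem data, the algorithm (Algorithm A) and its parameters be as described in the context, and suppose that the standing assumptions (P1)–(P6), (A1)–(A2), (E) and (R) listed there all hold. If Algorithm A terminates (at its "return" step) at some iteration $k$, then its final iterate $(z^{k+1},\mathbf{w}^{k+1})$ belongs to the extended solution set $$\mathcal{S}=\Big\{(z,\mathbf{w})\in\mathcal{H}_0\times\mathcal{H}_1\times\cdots\times\mathcal{H}_{n-1}\ \Big|\ w_i\in T_i(G_iz),\ i=1,\dots,n-1,\ \ -\sum_{i=1}^{n-1}G_i^*w_i\in T_n(z)\Big\}.$$ Otherwise, the sequence $\{(z^k,\mathbf{w}^k)\}$ generated by Algorithm A converges weakly to some point $(\bar z,\overline{\mathbf{w}})\in\mathcal{S}$, and furthermore $x_i^k\rightharpoonup G_i\bar z$ and $y_i^k\rightharpoonup\overline{w}_i$ for all $i=1,\dots,n-1$, $x_n^k\rightharpoonup\bar z$, and $y_n^k\rightharpoonup-\sum_{i=1}^{n-1}G_i^*\overline{w}_i$.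
   Context: **Problem.** Let $n$ be a positive integer, $\mathcal{H}_0,\dots,\mathcal{H}_{n}$ real Hilbert spaces with $\mathcal{H}_n=\mathcal{H}_0$. One seeks $z\in\mathcal{H}_0$ with $0\in\sum_{i=1}^{n-1}G_i^*T_i(G_iz)+T_n(z)$, where $G_i:\mathcal{H}_0\to\mathcal{H}_i$ and $T_i:\mathcal{H}_i\to2^{\mathcal{H}_i}$. Set $G_n=I$ (identity of $\mathcal{H}_0$). Write $\mathbf{w}=(w_1,\dots,w_{n-1})$. For a maximal monotone operator $A$ and $\rho>0$, $\mathrm{prox}_{\rho A}=(I+\rho A)^{-1}$. "$\rightharpoonup$" denotes weak convergence. The index set is partitioned as $\{1,\dots,n\}=\mathcal{I}_F\sqcup\mathcal{I}_B$. The extended solution set is $\mathcal{S}=\{(z,\mathbf{w})\in\mathcal{H}_0\times\cdots\times\mathcal{H}_{n-1}\mid w_i\in T_i(G_iz),\ i=1,\dots,n-1,\ -\sum_{i=1}^{n-1}G_i^*w_i\in T_n(z)\}$. **Assumptions on the problem.** (P1) $\mathcal{H}_0=\mathcal{H}_n$ and $\mathcal{H}_1,\dots,\mathcal{H}_{n-1}$ are real Hilbert spaces. (P2) Every $T_i$ is monotone. (P3) For $i\in\mathcal{I}_F$, $\mathcal{H}_i$ is finite-dimensional and $T_i$ is single-valued, (norm-)continuous, with $\mathrm{dom}(T_i)=\mathcal{H}_i$. (P4) For $i\in\mathcal{I}_B$, $T_i$ is maximal monotone. (P5) Each $G_i$, $i=1,\dots,n-1$, is linear and bounded. (P6) $\mathcal{S}\neq\emptyset$.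 **Parameters.** Constants $0<\underline\beta\le\overline\beta<2$, $\gamma>0$, $\nu\in(0,1)$, $\Delta>0$; for each $k\ge1$ a subset $I_k\subseteq\{1,\dots,n\}$; positive scalars $\rho_i^k$; delayed indices $d(i,k)\in\{1,\dots,k\}$; relaxation parameters $\beta_k\in[\underline\beta,\overline\beta]$; errors $e_i^k\in\mathcal{H}_i$ for $i\in\mathcal{I}_B$. Starting points $z^1\in\mathcal{H}_0$, $\mathbf{w}^1\in\mathcal{H}_1\times\cdots\times\mathcal{H}_{n-1}$ and $(x_i^0,y_i^0)\in\mathcal{H}_i^2$ are arbitrary. For all $k$, $w_n^k=-\sum_{i=1}^{n-1}G_i^*w_i^k$. **Algorithm A.** For $k=1,2,\dots$: 1. For each $i=1,\dots,n$: - If $i\in I_k\cap\mathcal{I}_B$ (backward step): $a=G_iz^{d(i,k)}+\rho_i^{d(i,k)}w_i^{d(i,k)}+e_i^k$, $x_i^k=\mathrm{prox}_{\rho_i^{d(i,k)}T_i}(a)$, $y_i^k=(\rho_i^{d(i,k)})^{-1}(a-x_i^k)$. - If $i\in I_k\cap\mathcal{I}_F$ (forward steps with backtracking linesearch): set $\rho_i^{(1,k)}=\rho_i^{d(i,k)}$, $\theta_i^k=G_iz^{d(i,k)}$, $\zeta_i^k=T_i\theta_i^k$. If $\zeta_i^k=w_i^{d(i,k)}$, set the accepted stepsize to $\rho_i^{(1,k)}$, $x_i^k=\theta_i^k$, $y_i^k=\zeta_i^k$. Otherwise, for $j=1,2,\dots$: compute $\tilde x_i^{(j,k)}=\theta_i^k-\rho_i^{(j,k)}(\zeta_i^k-w_i^{d(i,k)})$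 and $\tilde y_i^{(j,k)}=T_i\tilde x_i^{(j,k)}$; if $\Delta\|\theta_i^k-\tilde x_i^{(j,k)}\|^2-\langle\theta_i^k-\tilde x_i^{(j,k)},\tilde y_i^{(j,k)}-w_i^{d(i,k)}\rangle\le0$, accept the stepsize $\rho_i^{(j,k)}$, set $x_i^k=\tilde x_i^{(j,k)}$, $y_i^k=\tilde y_i^{(j,k)}$ and stop the loop over $j$; else set $\rho_i^{(j+1,k)}=\nu\rho_i^{(j,k)}$ and continue. - If $i\notin I_k$: $(x_i^k,y_i^k)=(x_i^{k-1},y_i^{k-1})$. 2. $u_i^k=x_i^k-G_ix_n^k$ for $i=1,\dots,n-1$; $v^k=\sum_{i=1}^{n-1}G_i^*y_i^k+y_n^k$; $\pi_k=\sum_{i=1}^{n-1}\|u_i^k\|^2+\gamma^{-1}\|v^k\|^2$. 3. If $\pi_k>0$: let $\phi_k=\langle z^k,v^k\rangle+\sum_{i=1}^{n-1}\langle w_i^k,u_i^k\rangle-\sum_{i=1}^n\langle x_i^k,y_i^k\rangle$ and $\alpha_k=\frac{\beta_k}{\pi_k}\max\{0,\phi_k\}$. If $\pi_k=0$ and $\bigcup_{j=1}^kI_j=\{1,\dots,n\}$: set $z^{k+1}=x_n^k$, $w_i^{k+1}=y_i^k$ ($i=1,\dots,n-1$) and return (terminate). If $\pi_k=0$ and $\bigcup_{j=1}^kI_j\ne\{1,\dots,n\}$: $\alpha_k=0$. 4. $z^{k+1}=z^k-\gamma^{-1}\alpha_kv^k$; $w_i^{k+1}=w_i^k-\alpha_ku_i^k$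 for $i=1,\dots,n-1$; $w_n^{k+1}=-\sum_{i=1}^{n-1}G_i^*w_i^{k+1}$. **Index notation.** $s(i,k)$ is the largest $j\le k$ with $i\in I_j$ (and $s(i,k)=0$ if there is none); $l(i,k)=d(i,s(i,k))$, with $d(i,0)=0$. Thus $(x_i^k,y_i^k)$ was computed at iteration $s(i,k)$ from $z^{l(i,k)},w_i^{l(i,k)}$. **Assumptions on the parameters.** (A1) There is a fixed integer $M\ge1$ with $\bigcup_{k=j}^{j+M-1}I_k=\{1,\dots,n\}$ for all $j\ge1$. (A2) There is a fixed integer $D\ge0$ with $k-d(i,k)\le D$ for all $i,k$ with $i\in I_k$. (E) For each $i\in\mathcal{I}_B$, $\{\|e_i^k\|\}_k$ is bounded, and for some $\sigma\in[0,1)$, for all $i\in\mathcal{I}_B$ and all $k\ge1$ with $s(i,k)\ge1$ before termination, $\langle G_iz^{l(i,k)}-x_i^k,e_i^{s(i,k)}\rangle\ge-\sigma\|G_iz^{l(i,k)}-x_i^k\|^2$ and $\langle e_i^{s(i,k)},y_i^k-w_i^{l(i,k)}\rangle\le\rho_i^{l(i,k)}\sigma\|y_i^k-w_i^{l(i,k)}\|^2$. (R) $\underline\rho=\min_{i}\inf_{k\ge1}\rho_i^k>0$ and $\overline\rho=\max_i\sup_{k\ge1}\rho_i^k<\infty$. *)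

theory Defs
  imports "HOL-Analysis.Analysis"
begin

text \<open>
  The Hilbert spaces \<open>H 0, \<dots>, H n\<close> are complete linear subspaces of a common real inner product
  space \<open>'a\<close>, with the inherited inner product. This is no restriction: finitely many Hilbert spaces
  always embed isometrically in their Hilbert direct sum. All notions below are relative to these
  carriers. In \<open>x i k\<close>, \<open>\<rho> i k\<close>, \<dots> the subscript comes first and the iteration counter second.
\<close>

definition hilbert_space :: "'a::real_inner set \<Rightarrow> bool" where
  "hilbert_space V \<longleftrightarrow> subspace V \<and> complete V"

definition finite_dimensional :: "'a::real_inner set \<Rightarrow> bool" where
  "finite_dimensional V \<longleftrightarrow> (\<exists>B. finite B \<and> span B = V)"

definition bounded_linear_between :: "'a::real_inner set \<Rightarrow> 'a set \<Rightarrow> ('a \<Rightarrow> 'a) \<Rightarrow> bool" where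
  "bounded_linear_between V W G \<longleftrightarrow>
     (\<forall>x\<in>V. G x \<in> W) \<and>
     (\<forall>x\<in>V. \<forall>y\<in>V. G (x + y) = G x + G y) \<and>
     (\<forall>c. \<forall>x\<in>V. G (c *\<^sub>R x) = c *\<^sub>R G x) \<and>
     (\<exists>K. \<forall>x\<in>V. norm (G x) \<le> norm x * K)"

text \<open>
  The library constant \<open>adjoint\<close> refers to the whole types. For \<open>G\<close> bounded and linear from a Hilbert
  space \<open>V\<close> to \<open>W\<close>, and \<open>y\<close> in \<open>W\<close>, the vector below exists (Riesz) and is unique.
\<close>

definition adjoint_on :: "'a::real_inner set \<Rightarrow> ('a \<Rightarrow> 'a) \<Rightarrow> 'a \<Rightarrow> 'a" where
  "adjoint_on V G y = (THE u. u \<in> V \<and> (\<forall>x\<in>V. G x \<bullet> y = x \<bullet> u))"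


subsection \<open>Set-valued operators\<close>

definition set_operator :: "'a::real_inner set \<Rightarrow> ('a \<Rightarrow> 'a set) \<Rightarrow> bool" where
  "set_operator V A \<longleftrightarrow> (\<forall>x\<in>V. A x \<subseteq> V)"

definition graph_of :: "'a::real_inner set \<Rightarrow> ('a \<Rightarrow> 'a set) \<Rightarrow> ('a \<times> 'a) set" where
  "graph_of V A = {(x, u). x \<in> V \<and> u \<in> A x}"

definition monotone_operator :: "'a::real_inner set \<Rightarrow> ('a \<Rightarrow> 'a set) \<Rightarrow> bool" where
  "monotone_operator V A \<longleftrightarrow>
     set_operator V A \<and>
     (\<forall>(x, u) \<in> graph_of V A. \<forall>(y, v) \<in> graph_of V A. 0 \<le> (x - y) \<bullet> (u - v))"

definition maximal_monotone :: "'a::real_inner set \<Rightarrow> ('a \<Rightarrow> 'a set) \<Rightarrow> bool" where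
  "maximal_monotone V A \<longleftrightarrow>
     monotone_operator V A \<and>
     (\<forall>B. monotone_operator V B \<and> graph_of V A \<subseteq> graph_of V B \<longrightarrow> graph_of V B = graph_of V A)"

definition single_valued_continuous :: "'a::real_inner set \<Rightarrow> ('a \<Rightarrow> 'a set) \<Rightarrow> bool" where
  "single_valued_continuous V A \<longleftrightarrow> (\<exists>f. continuous_on V f \<and> (\<forall>x\<in>V. A x = {f x}))"

text \<open>
  The set-valued inverse of \<open>I + r A\<close>; for maximal monotone \<open>A\<close> and \<open>r > 0\<close> its values are singletons.
\<close>

definition prox :: "'a::real_inner set \<Rightarrow> real \<Rightarrow> ('a \<Rightarrow> 'a set) \<Rightarrow> 'a \<Rightarrow> 'a set" where
  "prox V r A a = {x \<in> V. a \<in> {x + r *\<^sub>R u | u. u \<in> A x}}"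


subsection \<open>The product space, weak convergence, and the extended solution set\<close>

definition product_space :: "nat \<Rightarrow> (nat \<Rightarrow> 'a::real_inner set) \<Rightarrow> ('a \<times> (nat \<Rightarrow> 'a)) set" where
  "product_space n H = H 0 \<times> (\<Pi>\<^sub>E i\<in>{1..<n}. H i)"

definition product_inner ::
    "nat \<Rightarrow> 'a::real_inner \<times> (nat \<Rightarrow> 'a) \<Rightarrow> 'a \<times> (nat \<Rightarrow> 'a) \<Rightarrow> real" where
  "product_inner n p q = fst p \<bullet> fst q + (\<Sum>i\<in>{1..<n}. snd p i \<bullet> snd q i)"

text \<open>
  Weak convergence in the Hilbert space with carrier \<open>C\<close> and inner product \<open>ip\<close>. Membership in \<open>C\<close>
  is only required eventually, since some sequences below start at index 1.
\<close>

definition weakly_converges ::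
    "'p set \<Rightarrow> ('p \<Rightarrow> 'p \<Rightarrow> real) \<Rightarrow> (nat \<Rightarrow> 'p) \<Rightarrow> 'p \<Rightarrow> bool" where
  "weakly_converges C ip X p \<longleftrightarrow>
     (\<forall>\<^sub>F k in sequentially. X k \<in> C) \<and> p \<in> C \<and>
     (\<forall>h\<in>C. (\<lambda>k. ip (X k) h) \<longlonglongrightarrow> ip p h)"

definition extended_solution_set ::
    "nat \<Rightarrow> (nat \<Rightarrow> 'a::real_inner set) \<Rightarrow> (nat \<Rightarrow> 'a \<Rightarrow> 'a) \<Rightarrow> (nat \<Rightarrow> 'a \<Rightarrow> 'a set)
     \<Rightarrow> ('a \<times> (nat \<Rightarrow> 'a)) set" where
  "extended_solution_set n H G T =
     {(z, w) \<in> product_space n H.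
        (\<forall>i\<in>{1..<n}. w i \<in> T i (G i z)) \<and>
        - (\<Sum>i\<in>{1..<n}. adjoint_on (H 0) (G i) (w i)) \<in> T n z}"


subsection \<open>The algorithm\<close>

text \<open>
  In the two steps below, \<open>\<theta>\<close> and \<open>\<omega>\<close> stand for the delayed points \<open>G i (z (d i k))\<close> and
  \<open>w i (d i k)\<close>, and \<open>r\<close> for the delayed stepsize \<open>\<rho> i (d i k)\<close>.
\<close>

definition backward_step ::
    "'a::real_inner set \<Rightarrow> ('a \<Rightarrow> 'a set) \<Rightarrow> real \<Rightarrow> 'a \<Rightarrow> 'a \<Rightarrow> 'a \<Rightarrow> 'a \<Rightarrow> 'a \<Rightarrow> bool" where
  "backward_step V A r \<theta> \<omega> err x y \<longleftrightarrow>
     (let a = \<theta> + r *\<^sub>R \<omega> + err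
      in prox V r A a = {x} \<and> y = inverse r *\<^sub>R (a - x))"

text \<open>
  The accepted trial of the backtracking loop is the first one that passes the test. Finiteness of
  the loop is not assumed: if no trial passes, \<open>J\<close> is an unspecified number.
\<close>

definition forward_step ::
    "real \<Rightarrow> real \<Rightarrow> ('a::real_inner \<Rightarrow> 'a set) \<Rightarrow> real \<Rightarrow> 'a \<Rightarrow> 'a \<Rightarrow> 'a \<Rightarrow> 'a \<Rightarrow> bool" where
  "forward_step \<nu> \<Delta> A r \<theta> \<omega> x y \<longleftrightarrow>
     (let \<zeta> = the_elem (A \<theta>) in
      if \<zeta> = \<omega> then x = \<theta> \<and> y = \<zeta>
      else
        let stepsize = (\<lambda>j. \<nu> ^ (j - 1) * r);
            x' = (\<lambda>j. \<theta> - stepsize j *\<^sub>R (\<zeta> - \<omega>));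
            y' = (\<lambda>j. the_elem (A (x' j)));
            J = (LEAST j. 1 \<le> j \<and> \<Delta> * (norm (\<theta> - x' j))\<^sup>2 - (\<theta> - x' j) \<bullet> (y' j - \<omega>) \<le> 0)
        in x = x' J \<and> y = y' J)"

definition coupling_u ::
    "nat \<Rightarrow> (nat \<Rightarrow> 'a::real_inner \<Rightarrow> 'a) \<Rightarrow> (nat \<Rightarrow> nat \<Rightarrow> 'a) \<Rightarrow> nat \<Rightarrow> nat \<Rightarrow> 'a" where
  "coupling_u n G x i k = x i k - G i (x n k)"

definition coupling_v ::
    "nat \<Rightarrow> (nat \<Rightarrow> 'a::real_inner set) \<Rightarrow> (nat \<Rightarrow> 'a \<Rightarrow> 'a) \<Rightarrow> (nat \<Rightarrow> nat \<Rightarrow> 'a) \<Rightarrow> nat \<Rightarrow> 'a" where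
  "coupling_v n H G y k = (\<Sum>i\<in>{1..<n}. adjoint_on (H 0) (G i) (y i k)) + y n k"

definition sep_pi ::
    "nat \<Rightarrow> (nat \<Rightarrow> 'a::real_inner set) \<Rightarrow> (nat \<Rightarrow> 'a \<Rightarrow> 'a) \<Rightarrow> real
     \<Rightarrow> (nat \<Rightarrow> nat \<Rightarrow> 'a) \<Rightarrow> (nat \<Rightarrow> nat \<Rightarrow> 'a) \<Rightarrow> nat \<Rightarrow> real" where
  "sep_pi n H G \<gamma> x y k =
     (\<Sum>i\<in>{1..<n}. (norm (coupling_u n G x i k))\<^sup>2) + inverse \<gamma> * (norm (coupling_v n H G y k))\<^sup>2"

definition sep_phi ::
    "nat \<Rightarrow> (nat \<Rightarrow> 'a::real_inner set) \<Rightarrow> (nat \<Rightarrow> 'a \<Rightarrow> 'a)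
     \<Rightarrow> (nat \<Rightarrow> nat \<Rightarrow> 'a) \<Rightarrow> (nat \<Rightarrow> nat \<Rightarrow> 'a) \<Rightarrow> (nat \<Rightarrow> 'a) \<Rightarrow> (nat \<Rightarrow> nat \<Rightarrow> 'a) \<Rightarrow> nat \<Rightarrow> real" where
  "sep_phi n H G x y z w k =
     z k \<bullet> coupling_v n H G y k + (\<Sum>i\<in>{1..<n}. w i k \<bullet> coupling_u n G x i k)
     - (\<Sum>i\<in>{1..n}. x i k \<bullet> y i k)"

definition step_length ::
    "nat \<Rightarrow> (nat \<Rightarrow> 'a::real_inner set) \<Rightarrow> (nat \<Rightarrow> 'a \<Rightarrow> 'a) \<Rightarrow> real \<Rightarrow> (nat \<Rightarrow> real)
     \<Rightarrow> (nat \<Rightarrow> nat \<Rightarrow> 'a) \<Rightarrow> (nat \<Rightarrow> nat \<Rightarrow> 'a) \<Rightarrow> (nat \<Rightarrow> 'a) \<Rightarrow> (nat \<Rightarrow> nat \<Rightarrow> 'a) \<Rightarrow> nat \<Rightarrow> real" where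
  "step_length n H G \<gamma> \<beta> x y z w k =
     (if sep_pi n H G \<gamma> x y k > 0
      then \<beta> k / sep_pi n H G \<gamma> x y k * max 0 (sep_phi n H G x y z w k)
      else 0)"

definition returns_at ::
    "nat \<Rightarrow> (nat \<Rightarrow> 'a::real_inner set) \<Rightarrow> (nat \<Rightarrow> 'a \<Rightarrow> 'a) \<Rightarrow> real \<Rightarrow> (nat \<Rightarrow> nat set)
     \<Rightarrow> (nat \<Rightarrow> nat \<Rightarrow> 'a) \<Rightarrow> (nat \<Rightarrow> nat \<Rightarrow> 'a) \<Rightarrow> nat \<Rightarrow> bool" where
  "returns_at n H G \<gamma> I x y k \<longleftrightarrow> sep_pi n H G \<gamma> x y k = 0 \<and> (\<Union>j\<in>{1..k}. I j) = {1..n}"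

text \<open>
  Iteration \<open>k\<close> is carried out. The sequences are total functions, but the algorithm constrains
  them only up to its return.
\<close>

definition executed ::
    "nat \<Rightarrow> (nat \<Rightarrow> 'a::real_inner set) \<Rightarrow> (nat \<Rightarrow> 'a \<Rightarrow> 'a) \<Rightarrow> real \<Rightarrow> (nat \<Rightarrow> nat set)
     \<Rightarrow> (nat \<Rightarrow> nat \<Rightarrow> 'a) \<Rightarrow> (nat \<Rightarrow> nat \<Rightarrow> 'a) \<Rightarrow> nat \<Rightarrow> bool" where
  "executed n H G \<gamma> I x y k \<longleftrightarrow> 1 \<le> k \<and> (\<forall>j\<in>{1..<k}. \<not> returns_at n H G \<gamma> I x y j)"

definition last_update :: "(nat \<Rightarrow> nat set) \<Rightarrow> nat \<Rightarrow> nat \<Rightarrow> nat" where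
  "last_update I i k = Max (insert 0 {j \<in> {1..k}. i \<in> I j})"

definition last_delayed :: "(nat \<Rightarrow> nat set) \<Rightarrow> (nat \<Rightarrow> nat \<Rightarrow> nat) \<Rightarrow> nat \<Rightarrow> nat \<Rightarrow> nat" where
  "last_delayed I d i k = (if last_update I i k = 0 then 0 else d i (last_update I i k))"

end

theory Submission
  imports Defs "HOL-Library.Diagonal_Subsequence"
begin

text \<open>
  For graph points \<open>(x\<^sub>i, y\<^sub>i)\<close> of \<open>T\<^sub>i\<close>, the affine function
  \<open>\<phi> (z, w) = \<Sum>i. (G\<^sub>i z - x\<^sub>i) \<bullet> (y\<^sub>i - w\<^sub>i)\<close> is nonpositive on the extended solution set, and each
  iteration is a relaxed projection onto a half-space \<open>\<phi> \<le> 0\<close>. Hence the iterates are Fejer monotone,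
  consecutive iterates approach each other, and \<open>limsup \<phi>\<^sub>k \<le> 0\<close>. As the delays are bounded, \<open>\<phi>\<^sub>k\<close>
  may be evaluated at the delayed points, where every summand is nonnegative; so each of them
  vanishes in the limit. For a backward step it dominates both \<open>\<parallel>G\<^sub>i z - x\<^sub>i\<parallel>\<^sup>2\<close> and \<open>\<parallel>y\<^sub>i - w\<^sub>i\<parallel>\<^sup>2\<close>; for
  a forward step it dominates the former, and uniform continuity of \<open>T\<^sub>i\<close> on bounded sets gives the
  latter. Weak cluster points then solve the problem by maximal monotonicity, and Opial's lemma
  yields weak convergence of the whole sequence.
\<close>

section \<open>Hilbert subspaces and weak compactness\<close>

text \<open>A sum of maximal monotone operators need not be maximal, so a weak limit is not tested
  against the composite operator: graph points of all \<open>T i\<close> are used at once, in the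
  primal-dual product. The obstacle there is the limit of the sum of
  \<open>x i \<bullet> y i\<close>, whose factors converge only weakly. It is overcome by the
  constraint on \<open>w n\<close>, which makes the sum of \<open>G i z \<bullet> w i\<close> vanish
  identically; the same cancellation is the reason why \<phi> is affine.

  A pair \<open>(x i k, y i k)\<close> lies in the graph only once block \<open>i\<close> has been
  updated, hence most estimates start at iteration \<open>M\<close>.

  The decrease of the energy controls \<open>\<alpha> k ^ 2 * \<pi> k\<close>, not \<phi> itself.
  Passing from one to the other requires \<pi> to be bounded, hence bounds on all \<open>x i\<close>
  and \<open>y i\<close>. For forward blocks these come from compactness of balls, which is also the
  source of the uniform modulus of continuity.

  The ambient space is assumed neither complete nor separable, so representation of functionals and
  weak compactness are established inside the carriers.\<close>

lemma linear_form_minimizer_condition: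
  fixes x :: "'a::real_inner"
  assumes "\<And>t. 0 \<le> t * c + t\<^sup>2 / 2 * (norm x)\<^sup>2"
  shows "c = 0"
proof (rule ccontr)
  assume c: "c \<noteq> 0"
  \<comment> \<open>The minimising \<open>t\<close> would be \<open>- c\<close> divided by the
    squared norm of \<open>x\<close>; the added 1 keeps the denominator positive when
    \<open>x = 0\<close>.\<close>
  define N where "N = (norm x)\<^sup>2 + 1"
  have N: "N > 0" by (simp add: N_def add_nonneg_pos)
  have "0 \<le> (- c / N) * c + (- c / N)\<^sup>2 / 2 * (norm x)\<^sup>2" by (rule assms)
  also have "\<dots> \<le> (- c / N) * c + (- c / N)\<^sup>2 / 2 * N"
    by (intro add_left_mono mult_left_mono) (simp_all add: N_def)
  also have "\<dots> = - (c\<^sup>2 / (2 * N))"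
    using N by (simp add: field_simps power2_eq_square)
  also have "\<dots> < 0" using N c by simp
  finally show False by simp
qed

text \<open>The representing vector minimises \<open>J\<close> over \<open>V\<close>.
  \<open>J\<close> is bounded below by completing a square, and the parallelogram identity turns
  near-minimality into the Cauchy property. The vanishing first variation at the minimiser is the
  equation \<open>f x = x \<bullet> u\<close>.\<close>

theorem riesz_representation_on:
  fixes V :: "'a::real_inner set" and f :: "'a \<Rightarrow> real"
  assumes V: "subspace V" "complete V"
    and add: "\<And>x y. x \<in> V \<Longrightarrow> y \<in> V \<Longrightarrow> f (x + y) = f x + f y"
    and scale: "\<And>c x. x \<in> V \<Longrightarrow> f (c *\<^sub>R x) = c * f x"
    and bound: "\<And>x. x \<in> V \<Longrightarrow> \<bar>f x\<bar> \<le> K * norm x"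
  shows "\<exists>u\<in>V. \<forall>x\<in>V. f x = x \<bullet> u"
proof -
  define J where "J = (\<lambda>x. (norm x)\<^sup>2 / 2 - f x)"
  have lower: "- (K\<^sup>2 / 2) \<le> J x" if "x \<in> V" for x
  proof -
    have "0 \<le> (norm x - K)\<^sup>2" by simp
    then have "K * norm x \<le> (norm x)\<^sup>2 / 2 + K\<^sup>2 / 2"
      by (simp add: power2_eq_square algebra_simps)
    with bound[OF that] show ?thesis by (simp add: J_def abs_le_iff)
  qed
  define m where "m = Inf (J ` V)"
  have bdd: "bdd_below (J ` V)" using lower by (intro bdd_belowI) auto
  have ne: "V \<noteq> {}" using V(1) subspace_0 by blast
  have m_le: "m \<le> J x" if "x \<in> V" for x
    unfolding m_def by (rule cInf_lower) (use bdd that in auto)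
  have "\<exists>x\<in>V. J x < m + 1 / real (Suc k)" for k
  proof -
    have "Inf (J ` V) < m + 1 / real (Suc k)" by (simp add: m_def)
    then show ?thesis using cInf_lessD[of "J ` V"] ne by blast
  qed
  then obtain X where X: "\<And>k. X k \<in> V" "\<And>k. J (X k) < m + 1 / real (Suc k)" by metis
  have para: "(norm (a - b))\<^sup>2 = 4 * (J a + J b - 2 * J ((1/2) *\<^sub>R (a + b)))" if "a \<in> V" "b \<in> V" for a b
  proof -
    have "f ((1/2) *\<^sub>R (a + b)) = (f a + f b) / 2"
      using that V(1) by (simp add: add scale subspace_add)
    then show ?thesis
      by (simp add: J_def power2_norm_eq_inner power_mult_distrib inner_add_left inner_add_right
          inner_diff_left inner_diff_right inner_commute field_simps)
  qed
  have near: "(norm (X a - X b))\<^sup>2 \<le> 4 * (1 / real (Suc a) + 1 / real (Suc b))" for a b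
  proof -
    have "(1/2) *\<^sub>R (X a + X b) \<in> V" using V(1) X(1) by (simp add: subspace_add subspace_scale)
    from m_le[OF this] X(2)[of a] X(2)[of b] show ?thesis
      by (simp add: para[OF X(1) X(1)])
  qed
  have "Cauchy X"
  proof (rule metric_CauchyI)
    fix \<epsilon> :: real assume "0 < \<epsilon>"
    then have "0 < \<epsilon>\<^sup>2 / 8" by simp
    then obtain N where N: "1 / real (Suc N) < \<epsilon>\<^sup>2 / 8"
      using nat_approx_posE by metis
    have "dist (X a) (X b) < \<epsilon>" if "a \<ge> N" "b \<ge> N" for a b
    proof -
      have "1 / real (Suc a) \<le> 1 / real (Suc N)" "1 / real (Suc b) \<le> 1 / real (Suc N)"
        using that by (simp_all add: frac_le)
      moreover have "A < \<eta>" if "A \<le> 4 * (p + q)" "s < \<eta> / 8" "p \<le> s" "q \<le> s" for A p q s \<eta> :: real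
        using that by argo
      ultimately have "(norm (X a - X b))\<^sup>2 < \<epsilon>\<^sup>2" using near[of a b] N by blast
      then show ?thesis using \<open>0 < \<epsilon>\<close> by (simp add: dist_norm power_less_imp_less_base)
    qed
    then show "\<exists>N. \<forall>a\<ge>N. \<forall>b\<ge>N. dist (X a) (X b) < \<epsilon>" by blast
  qed
  then obtain u where u: "u \<in> V" "X \<longlonglongrightarrow> u"
    using V(2) X(1) unfolding complete_def by blast
  have "f x = x \<bullet> u" if x: "x \<in> V" for x
  proof -
    \<comment> \<open>Minimality is written along \<open>X k\<close>, with its error
      \<open>1 / Suc k\<close>, so that the passage to the limit involves only inner products with
      \<open>x\<close>.\<close>
    have "0 \<le> t * (u \<bullet> x - f x) + t\<^sup>2 / 2 * (norm x)\<^sup>2" for t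
    proof (rule LIMSEQ_le_const)
      show "(\<lambda>k. 1 / real (Suc k) + (t * (X k \<bullet> x - f x) + t\<^sup>2 / 2 * (norm x)\<^sup>2))
          \<longlonglongrightarrow> t * (u \<bullet> x - f x) + t\<^sup>2 / 2 * (norm x)\<^sup>2"
        using tendsto_add[OF LIMSEQ_inverse_real_of_nat tendsto_add[OF tendsto_mult_left[OF
              tendsto_diff[OF tendsto_inner[OF u(2) tendsto_const] tendsto_const]] tendsto_const]]
        by (simp add: inverse_eq_divide)
      have "0 \<le> 1 / real (Suc k) + (t * (X k \<bullet> x - f x) + t\<^sup>2 / 2 * (norm x)\<^sup>2)" for k
      proof -
        have "m \<le> J (X k + t *\<^sub>R x)" using V(1) X(1) x by (intro m_le) (simp add: subspace_add subspace_scale)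
        moreover have "(norm (X k + t *\<^sub>R x))\<^sup>2 = (norm (X k))\<^sup>2 + 2 * t * (X k \<bullet> x) + t\<^sup>2 * (norm x)\<^sup>2"
          by (simp add: power2_norm_eq_inner inner_add_left inner_add_right inner_commute
              power2_eq_square[of t] algebra_simps)
        then have "J (X k + t *\<^sub>R x) = J (X k) + (t * (X k \<bullet> x - f x) + t\<^sup>2 / 2 * (norm x)\<^sup>2)"
          using V(1) X(1) x
          by (simp add: J_def add scale subspace_scale field_simps)
        ultimately show ?thesis using X(2)[of k] by linarith
      qed
      then show "\<exists>N. \<forall>k\<ge>N. 0 \<le> 1 / real (Suc k) + (t * (X k \<bullet> x - f x) + t\<^sup>2 / 2 * (norm x)\<^sup>2)"
        by blast
    qed
    then have "u \<bullet> x - f x = 0" by (rule linear_form_minimizer_condition)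
    then show ?thesis by (simp add: inner_commute)
  qed
  with u(1) show ?thesis by blast
qed

text \<open>Riesz for the form \<open>x \<bullet> h\<close> on \<open>V\<close>, where
  \<open>h\<close> is any ambient vector. Through it weak limits can be tested against all vectors
  although the sequences stay in a carrier.\<close>

lemma orthogonal_projection_exists:
  fixes V :: "'a::real_inner set"
  assumes "subspace V" "complete V"
  shows "\<exists>u\<in>V. \<forall>x\<in>V. x \<bullet> h = x \<bullet> u"
  using assms
  by (intro riesz_representation_on[where K = "norm h"])
     (auto simp: inner_add_left Cauchy_Schwarz_ineq2 mult.commute[of "norm h"])

lemma inner_eq_on_subspace:
  fixes u v :: "'a::real_inner"
  assumes "subspace V" "u \<in> V" "v \<in> V" "\<And>x. x \<in> V \<Longrightarrow> x \<bullet> u = x \<bullet> v"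
  shows "u = v"
proof -
  have "(u - v) \<bullet> (u - v) = 0"
    using assms(4)[of "u - v"] subspace_diff[OF assms(1-3)] by (simp add: inner_diff_right)
  then show ?thesis by simp
qed

section \<open>Weak sequential compactness and Opial's lemma\<close>

text \<open>The sequence supplies its own test vectors: a diagonal subsequence makes
  \<open>X (r k) \<bullet> X j\<close> converge for every \<open>j\<close>. The vectors of
  \<open>V\<close> against which it converges form a closed subspace \<open>W\<close> containing all
  \<open>X k\<close>; the limit is a bounded form on \<open>W\<close>, represented by some
  \<open>p\<close> in \<open>W\<close>. No countable dense set is involved.\<close>

lemma weak_subsequence:
  fixes X :: "nat \<Rightarrow> 'a::real_inner"
  assumes V: "subspace V" "complete V" and X: "\<And>k. X k \<in> V" "\<And>k. norm (X k) \<le> B"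
  shows "\<exists>r p. strict_mono r \<and> p \<in> V \<and> (\<forall>h. (\<lambda>k. X (r k) \<bullet> h) \<longlonglongrightarrow> p \<bullet> h)"
proof -
  interpret subseqs "\<lambda>j s. convergent (\<lambda>k. X (s k) \<bullet> X j)"
  proof
    fix j :: nat and s :: "nat \<Rightarrow> nat" assume "strict_mono s"
    have "bounded (range (\<lambda>k. X (s k) \<bullet> X j))"
      unfolding bounded_iff
    proof (intro exI ballI)
      fix c assume "c \<in> range (\<lambda>k. X (s k) \<bullet> X j)"
      then obtain k where "c = X (s k) \<bullet> X j" by blast
      then have "norm c \<le> norm (X (s k)) * norm (X j)" by (simp add: Cauchy_Schwarz_ineq2)
      also have "\<dots> \<le> B * norm (X j)" using X(2) by (simp add: mult_right_mono)
      finally show "norm c \<le> B * norm (X j)" .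
    qed
    from bounded_imp_convergent_subsequence[OF this]
    obtain l r where "strict_mono r" "((\<lambda>k. X (s k) \<bullet> X j) \<circ> r) \<longlonglongrightarrow> l" by blast
    then show "\<exists>r. strict_mono r \<and> convergent (\<lambda>k. X ((s \<circ> r) k) \<bullet> X j)"
      by (auto simp: convergent_def o_def)
  qed
  define r where "r = diagseq"
  have r: "strict_mono r" by (simp add: r_def subseq_diagseq)
  have conv_X: "convergent (\<lambda>k. X (r k) \<bullet> X j)" for j
  proof -
    \<comment> \<open>The diagonal sequence refines the \<open>j\<close>-th subsequence only from
      index \<open>Suc j\<close> on; the shift is removed afterwards.\<close>
    have "convergent (\<lambda>k. X ((diagseq \<circ> ((+) (Suc j))) k) \<bullet> X j)"
    proof (rule diagseq_holds)
      fix r s :: "nat \<Rightarrow> nat" and j assume "strict_mono r" "convergent (\<lambda>k. X (s k) \<bullet> X j)"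
      then show "convergent (\<lambda>k. X ((s \<circ> r) k) \<bullet> X j)"
        using convergent_subseq_convergent by (fastforce simp: o_def)
    qed
    then have "convergent (\<lambda>k. X (diagseq (k + Suc j)) \<bullet> X j)" by (simp add: o_def add.commute)
    then show ?thesis
      unfolding r_def by (subst (asm) convergent_ignore_initial_segment)
  qed
  define W where "W = {h \<in> V. convergent (\<lambda>k. X (r k) \<bullet> h)}"
  have sub: "subspace W"
    unfolding subspace_def W_def
  proof (intro conjI allI ballI)
    show "0 \<in> {h \<in> V. convergent (\<lambda>k. X (r k) \<bullet> h)}"
      using V(1) by (simp add: subspace_0 convergent_const)
    show "a + b \<in> {h \<in> V. convergent (\<lambda>k. X (r k) \<bullet> h)}"
      if "a \<in> {h \<in> V. convergent (\<lambda>k. X (r k) \<bullet> h)}" "b \<in> {h \<in> V. convergent (\<lambda>k. X (r k) \<bullet> h)}" for a b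
      using that V(1) by (auto simp: subspace_add inner_add_right intro: convergent_add)
    show "c *\<^sub>R a \<in> {h \<in> V. convergent (\<lambda>k. X (r k) \<bullet> h)}"
      if "a \<in> {h \<in> V. convergent (\<lambda>k. X (r k) \<bullet> h)}" for a c
      using that V(1) by (auto simp: subspace_scale intro: convergent_mult convergent_const)
  qed
  have "closed W"
    unfolding closed_sequential_limits
  proof (intro allI impI, elim conjE)
    fix h l assume h: "\<forall>j. h j \<in> W" and l: "h \<longlonglongrightarrow> l"
    have "h j \<in> V" for j using h by (simp add: W_def)
    with l have "l \<in> V"
      using closed_sequentially[OF complete_imp_closed[OF V(2)]] by blast
    moreover have "Cauchy (\<lambda>k. X (r k) \<bullet> l)"
    proof (rule metric_CauchyI)
      fix \<epsilon> :: real assume "0 < \<epsilon>"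
      \<comment> \<open>A strictly positive bound, because it is used as a divisor.\<close>
      define B' where "B' = \<bar>B\<bar> + 1"
      have B': "B' > 0" "\<And>k. norm (X k) \<le> B'"
        using X(2) by (force simp: B'_def intro: order_trans[OF X(2)])+
      obtain j where j: "norm (h j - l) < \<epsilon> / (3 * B')"
        using LIMSEQ_D[OF l, of "\<epsilon> / (3 * B')"] \<open>0 < \<epsilon>\<close> B'(1) by auto
      have close: "\<bar>X (r k) \<bullet> h j - X (r k) \<bullet> l\<bar> < \<epsilon> / 3" for k
      proof -
        have "\<bar>X (r k) \<bullet> h j - X (r k) \<bullet> l\<bar> \<le> norm (X (r k)) * norm (h j - l)"
          by (metis Cauchy_Schwarz_ineq2 inner_diff_right)
        also have "\<dots> \<le> B' * norm (h j - l)" using B'(2) by (simp add: mult_right_mono)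
        also have "\<dots> < B' * (\<epsilon> / (3 * B'))" using j B'(1) by (rule mult_strict_left_mono)
        also have "\<dots> = \<epsilon> / 3" using B'(1) by simp
        finally show ?thesis .
      qed
      have "Cauchy (\<lambda>k. X (r k) \<bullet> h j)" using h by (simp add: W_def Cauchy_convergent_iff)
      then obtain N where N: "\<And>a b. a \<ge> N \<Longrightarrow> b \<ge> N \<Longrightarrow> dist (X (r a) \<bullet> h j) (X (r b) \<bullet> h j) < \<epsilon> / 3"
        using \<open>0 < \<epsilon>\<close> unfolding Cauchy_def by (metis divide_pos_pos zero_less_numeral)
      have "dist (X (r a) \<bullet> l) (X (r b) \<bullet> l) < \<epsilon>" if "a \<ge> N" "b \<ge> N" for a b
        using N[OF that] close[of a] close[of b] unfolding dist_real_def by linarith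
      then show "\<exists>N. \<forall>a\<ge>N. \<forall>b\<ge>N. dist (X (r a) \<bullet> l) (X (r b) \<bullet> l) < \<epsilon>" by blast
    qed
    ultimately show "l \<in> W" by (simp add: W_def Cauchy_convergent_iff)
  qed
  then have com: "complete W" using V(2) complete_closed_subset[of W V] unfolding W_def by blast
  have XW: "X k \<in> W" for k using X(1) conv_X by (simp add: W_def)
  define f where "f = (\<lambda>h. lim (\<lambda>k. X (r k) \<bullet> h))"
  have f: "(\<lambda>k. X (r k) \<bullet> h) \<longlonglongrightarrow> f h" if "h \<in> W" for h
    using that unfolding f_def W_def by (simp add: convergent_LIMSEQ_iff)
  have "\<exists>p\<in>W. \<forall>h\<in>W. f h = h \<bullet> p"
  proof (rule riesz_representation_on[OF sub com])
    show "f (a + b) = f a + f b" if "a \<in> W" "b \<in> W" for a b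
    proof (rule LIMSEQ_unique[OF f])
      show "(\<lambda>k. X (r k) \<bullet> (a + b)) \<longlonglongrightarrow> f a + f b"
        using tendsto_add[OF f f] that by (simp add: inner_add_right)
    qed (use that sub in \<open>simp add: subspace_add\<close>)
    show "f (c *\<^sub>R a) = c * f a" if "a \<in> W" for a c
    proof (rule LIMSEQ_unique[OF f])
      show "(\<lambda>k. X (r k) \<bullet> (c *\<^sub>R a)) \<longlonglongrightarrow> c * f a"
        using tendsto_mult_left[OF f] that by simp
    qed (use that sub in \<open>simp add: subspace_scale\<close>)
    show "\<bar>f a\<bar> \<le> B * norm a" if "a \<in> W" for a
    proof (rule LIMSEQ_le_const2)
      show "(\<lambda>k. \<bar>X (r k) \<bullet> a\<bar>) \<longlonglongrightarrow> \<bar>f a\<bar>" using f[OF that] by (rule tendsto_rabs)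
      have "\<bar>X (r k) \<bullet> a\<bar> \<le> B * norm a" for k
        by (rule order_trans[OF Cauchy_Schwarz_ineq2]) (simp add: X(2) mult_right_mono)
      then show "\<exists>N. \<forall>k\<ge>N. \<bar>X (r k) \<bullet> a\<bar> \<le> B * norm a" by blast
    qed
  qed
  then obtain p where p: "p \<in> W" "\<And>h. h \<in> W \<Longrightarrow> f h = h \<bullet> p" by blast
  have "(\<lambda>k. X (r k) \<bullet> h) \<longlonglongrightarrow> p \<bullet> h" for h
  proof -
    \<comment> \<open>All \<open>X k\<close> and \<open>p\<close> lie in \<open>W\<close>, so
      \<open>h\<close> acts on them like its projection, for which convergence is known.\<close>
    obtain u where u: "u \<in> W" "\<And>a. a \<in> W \<Longrightarrow> a \<bullet> h = a \<bullet> u"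
      using orthogonal_projection_exists[OF sub com] by blast
    have "X (r k) \<bullet> h = X (r k) \<bullet> u" for k using u(2) XW by blast
    moreover have "p \<bullet> h = f u" using u(2)[OF p(1)] p(2)[OF u(1)] by (simp add: inner_commute)
    ultimately show ?thesis using f[OF u(1)] by simp
  qed
  then show ?thesis using r p(1) unfolding W_def by blast
qed

text \<open>The indices are treated one after another; refining a subsequence preserves the weak
  limits already found.\<close>

lemma weak_subsequence_family:
  fixes P :: "'i \<Rightarrow> nat \<Rightarrow> 'a::real_inner"
  assumes "finite J" and "\<And>i. i \<in> J \<Longrightarrow> subspace (V i)" "\<And>i. i \<in> J \<Longrightarrow> complete (V i)"
    and "\<And>i k. i \<in> J \<Longrightarrow> P i k \<in> V i" "\<And>i k. i \<in> J \<Longrightarrow> norm (P i k) \<le> B"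
  shows "\<exists>r p. strict_mono r \<and>
    (\<forall>i\<in>J. p i \<in> V i \<and> (\<forall>h. (\<lambda>k. P i (r k) \<bullet> h) \<longlonglongrightarrow> p i \<bullet> h))"
  using assms
proof (induction J rule: finite_induct)
  case empty
  show ?case by (rule exI[of _ id]) (simp add: strict_mono_def)
next
  case (insert j J)
  have "\<exists>r p. strict_mono r \<and>
      (\<forall>i\<in>J. p i \<in> V i \<and> (\<forall>h. (\<lambda>k. P i (r k) \<bullet> h) \<longlonglongrightarrow> p i \<bullet> h))"
    by (rule insert.IH) (use insert.prems in auto)
  then obtain r p where r: "strict_mono r"
    and p: "\<And>i. i \<in> J \<Longrightarrow> p i \<in> V i \<and> (\<forall>h. (\<lambda>k. P i (r k) \<bullet> h) \<longlonglongrightarrow> p i \<bullet> h)"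
    by blast
  obtain s q where s: "strict_mono s" and q: "q \<in> V j" "\<And>h. (\<lambda>k. P j (r (s k)) \<bullet> h) \<longlonglongrightarrow> q \<bullet> h"
    using weak_subsequence[of "V j" "\<lambda>k. P j (r k)" B] insert.prems by auto
  have "(p(j := q)) i \<in> V i \<and> (\<forall>h. (\<lambda>k. P i ((r \<circ> s) k) \<bullet> h) \<longlonglongrightarrow> (p(j := q)) i \<bullet> h)"
    if "i \<in> insert j J" for i
  proof (cases "i = j")
    case False
    with that have "i \<in> J" by simp
    with p[OF this] LIMSEQ_subseq_LIMSEQ[OF _ s, of "\<lambda>k. P i (r k) \<bullet> h" for h] False
    show ?thesis by (auto simp: o_def)
  qed (use q in simp)
  moreover have "strict_mono (r \<circ> s)" using r s by (rule strict_mono_o)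
  ultimately show ?case by blast
qed

text \<open>
  The distances to two cluster points determine the inner product with their difference in the
  limit; this makes the weak cluster point unique.
\<close>

theorem opial_family:
  fixes P :: "'i \<Rightarrow> nat \<Rightarrow> 'a::real_inner" and S :: "('i \<Rightarrow> 'a) set"
  assumes J: "finite J" and V: "\<And>i. i \<in> J \<Longrightarrow> subspace (V i)" "\<And>i. i \<in> J \<Longrightarrow> complete (V i)"
    and P: "\<And>i k. i \<in> J \<Longrightarrow> P i k \<in> V i"
    and c: "\<And>i. i \<in> J \<Longrightarrow> 0 < c i"
    and S: "S \<noteq> {}"
    and dist_conv: "\<And>s. s \<in> S \<Longrightarrow> convergent (\<lambda>k. \<Sum>i\<in>J. c i * (norm (P i k - s i))\<^sup>2)"
    and cluster: "\<And>r q. strict_mono r \<Longrightarrow> (\<And>i. i \<in> J \<Longrightarrow> q i \<in> V i) \<Longrightarrow>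
      (\<And>i h. i \<in> J \<Longrightarrow> (\<lambda>k. P i (r k) \<bullet> h) \<longlonglongrightarrow> q i \<bullet> h) \<Longrightarrow> q \<in> S"
  shows "\<exists>q\<in>S. \<forall>i\<in>J. q i \<in> V i \<and> (\<forall>h. (\<lambda>k. P i k \<bullet> h) \<longlonglongrightarrow> q i \<bullet> h)"
proof -
  have "\<exists>B. \<forall>i\<in>J. \<forall>k. norm (P i k) \<le> B"
  proof -
    obtain s where s: "s \<in> S" using S by blast
    obtain K where K: "\<And>k. (\<Sum>i\<in>J. c i * (norm (P i k - s i))\<^sup>2) \<le> K"
      using convergent_imp_Bseq[OF dist_conv[OF s]] unfolding Bseq_def real_norm_def
      by (meson abs_le_iff)
    have "norm (P i k) \<le> norm (s i) + sqrt (K / c i)" if i: "i \<in> J" for i k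
    proof -
      have "c i * (norm (P i k - s i))\<^sup>2 \<le> (\<Sum>i\<in>J. c i * (norm (P i k - s i))\<^sup>2)"
        using J i c by (intro member_le_sum) (auto simp: less_imp_le)
      also note K[of k]
      finally have "(norm (P i k - s i))\<^sup>2 \<le> K / c i" using c[OF i] by (simp add: field_simps)
      then have "norm (P i k - s i) \<le> sqrt (K / c i)" by (rule real_le_rsqrt)
      moreover have "norm (P i k) \<le> norm (s i) + norm (P i k - s i)"
        using norm_triangle_ineq[of "s i" "P i k - s i"] by simp
      ultimately show ?thesis by linarith
    qed
    moreover have "norm (s i) + sqrt (K / c i) \<le> Max ((\<lambda>i. norm (s i) + sqrt (K / c i)) ` J)" if "i \<in> J" for i
      using J that by (intro Max_ge) auto
    ultimately show ?thesis by (meson order_trans)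
  qed
  then obtain B where B: "\<And>i k. i \<in> J \<Longrightarrow> norm (P i k) \<le> B" by blast
  have sub: "\<exists>r q. strict_mono r \<and> q \<in> S \<and>
      (\<forall>i\<in>J. q i \<in> V i \<and> (\<forall>h. (\<lambda>k. P i (s (r k)) \<bullet> h) \<longlonglongrightarrow> q i \<bullet> h))"
    if s: "strict_mono s" for s :: "nat \<Rightarrow> nat"
  proof -
    obtain r q where rq: "strict_mono r"
      "\<forall>i\<in>J. q i \<in> V i \<and> (\<forall>h. (\<lambda>k. P i (s (r k)) \<bullet> h) \<longlonglongrightarrow> q i \<bullet> h)"
      using weak_subsequence_family[of J V "\<lambda>i k. P i (s k)" B] J V P B by blast
    moreover have "q \<in> S"
      using rq by (intro cluster[of "s \<circ> r"]) (auto intro: strict_mono_o s)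
    ultimately show ?thesis by blast
  qed
  obtain r q where r: "strict_mono r" and q: "q \<in> S" "\<And>i. i \<in> J \<Longrightarrow> q i \<in> V i"
      "\<And>i h. i \<in> J \<Longrightarrow> (\<lambda>k. P i (r k) \<bullet> h) \<longlonglongrightarrow> q i \<bullet> h"
    using sub[of id] by (auto simp: strict_mono_def)
  have unique: "q' i = q i"
    if r': "strict_mono r'" and q': "q' \<in> S" "\<And>i h. i \<in> J \<Longrightarrow> (\<lambda>k. P i (r' k) \<bullet> h) \<longlonglongrightarrow> q' i \<bullet> h" and i: "i \<in> J"
    for r' q' i
  proof -
    define L where "L = (\<lambda>k. \<Sum>i\<in>J. c i * (P i k \<bullet> (q i - q' i)))"
    have "L k = ((\<Sum>i\<in>J. c i * (norm (P i k - q' i))\<^sup>2) - (\<Sum>i\<in>J. c i * (norm (P i k - q i))\<^sup>2)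
        + (\<Sum>i\<in>J. c i * ((norm (q i))\<^sup>2 - (norm (q' i))\<^sup>2))) * (1 / 2)" for k
      unfolding L_def sum_subtractf[symmetric] sum.distrib[symmetric] sum_distrib_right
      by (intro sum.cong) (simp_all add: power2_norm_eq_inner inner_diff_left inner_diff_right inner_commute algebra_simps)
    then have L: "L = (\<lambda>k. ((\<Sum>i\<in>J. c i * (norm (P i k - q' i))\<^sup>2) - (\<Sum>i\<in>J. c i * (norm (P i k - q i))\<^sup>2)
        + (\<Sum>i\<in>J. c i * ((norm (q i))\<^sup>2 - (norm (q' i))\<^sup>2))) * (1 / 2))" by (rule ext)
    have "convergent L"
      unfolding L by (intro convergent_mult convergent_add convergent_diff dist_conv q(1) q'(1)
          convergent_const)
    then obtain l where l: "L \<longlonglongrightarrow> l" by (auto simp: convergent_def)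
    have "(\<lambda>k. L (r k)) \<longlonglongrightarrow> (\<Sum>i\<in>J. c i * (q i \<bullet> (q i - q' i)))"
      unfolding L_def by (intro tendsto_sum tendsto_mult_left q(3))
    with LIMSEQ_subseq_LIMSEQ[OF l r] have 1: "l = (\<Sum>i\<in>J. c i * (q i \<bullet> (q i - q' i)))"
      by (auto simp: o_def intro: LIMSEQ_unique)
    have "(\<lambda>k. L (r' k)) \<longlonglongrightarrow> (\<Sum>i\<in>J. c i * (q' i \<bullet> (q i - q' i)))"
      unfolding L_def by (intro tendsto_sum tendsto_mult_left q'(2))
    with LIMSEQ_subseq_LIMSEQ[OF l r'] have 2: "l = (\<Sum>i\<in>J. c i * (q' i \<bullet> (q i - q' i)))"
      by (auto simp: o_def intro: LIMSEQ_unique)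
    \<comment> \<open>The difference of the two expressions for \<open>l\<close> is the weighted
      squared distance of the cluster points.\<close>
    have "(\<Sum>i\<in>J. c i * (norm (q i - q' i))\<^sup>2) = 0"
      using 1 2
      by (simp add: power2_norm_eq_inner inner_diff_left[of "q i" "q' i" "q i - q' i" for i]
          right_diff_distrib sum_subtractf)
    then have "c i * (norm (q i - q' i))\<^sup>2 = 0"
      using J i c by (subst (asm) sum_nonneg_eq_0_iff) (auto simp: less_imp_le)
    then show ?thesis using c[OF i] by simp
  qed
  have "(\<lambda>k. P i k \<bullet> h) \<longlonglongrightarrow> q i \<bullet> h" if i: "i \<in> J" for i h
  proof (rule ccontr)
    assume "\<not> ?thesis"
    then obtain \<epsilon> where eps: "0 < \<epsilon>" "\<not> (\<forall>\<^sub>F k in sequentially. dist (P i k \<bullet> h) (q i \<bullet> h) < \<epsilon>)"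
      unfolding tendsto_iff by blast
    \<comment> \<open>Failure of convergence produces a subsequence that stays away from the limit.
      A further subsequence of it has a weak cluster point, which uniqueness identifies with
      \<open>q\<close>.\<close>
    then have "infinite {k. \<not> dist (P i k \<bullet> h) (q i \<bullet> h) < \<epsilon>}"
      by (simp add: frequently_cofinite[symmetric] cofinite_eq_sequentially not_eventually)
    from infinite_enumerate[OF this] obtain s :: "nat \<Rightarrow> nat" where s: "strict_mono s"
      and "\<forall>k. s k \<in> {k. \<not> dist (P i k \<bullet> h) (q i \<bullet> h) < \<epsilon>}" by blast
    then have far: "\<not> dist (P i (s k) \<bullet> h) (q i \<bullet> h) < \<epsilon>" for k by blast
    from sub[OF s] obtain r' q' where r': "strict_mono r'" and q': "q' \<in> S"
      "\<forall>i\<in>J. q' i \<in> V i \<and> (\<forall>h. (\<lambda>k. P i (s (r' k)) \<bullet> h) \<longlonglongrightarrow> q' i \<bullet> h)" by blast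
    have "q' i = q i"
      using q' r' s i by (intro unique[of "s \<circ> r'"]) (auto intro: strict_mono_o)
    then have "(\<lambda>k. P i (s (r' k)) \<bullet> h) \<longlonglongrightarrow> q i \<bullet> h" using q' i by metis
    then have "\<forall>\<^sub>F k in sequentially. dist (P i (s (r' k)) \<bullet> h) (q i \<bullet> h) < \<epsilon>"
      using eps(1) by (rule tendstoD)
    then show False using far by (auto simp: eventually_sequentially)
  qed
  with q show ?thesis by blast
qed

section \<open>Compactness in finite dimension\<close>

text \<open>\<open>C\<close> is not normalised and may contain 0. Division by 0 yields 0, so the
  zero vector contributes the correct term without a case distinction.\<close>

lemma orthogonal_expansion:
  fixes C :: "'a::real_inner set"
  assumes C: "finite C" "pairwise orthogonal C" and a: "a \<in> span C"
  shows "(\<Sum>b\<in>C. (a \<bullet> b / (b \<bullet> b)) *\<^sub>R b) = a"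
  using a
proof (rule span_induct_alt)
  show "(\<Sum>b\<in>C. (0 \<bullet> b / (b \<bullet> b)) *\<^sub>R b) = 0" by simp
next
  fix t x y
  assume x: "x \<in> C" and y: "(\<Sum>b\<in>C. (y \<bullet> b / (b \<bullet> b)) *\<^sub>R b) = y"
  have "(\<Sum>b\<in>C. (x \<bullet> b / (b \<bullet> b)) *\<^sub>R b) = (\<Sum>b\<in>C. if b = x then x else 0)"
    using C(2) x by (intro sum.cong) (auto simp: pairwise_def orthogonal_def)
  also have "\<dots> = x" using C(1) x by simp
  finally have "(\<Sum>b\<in>C. (t * (x \<bullet> b) / (b \<bullet> b)) *\<^sub>R b) = t *\<^sub>R x"
    using scaleR_sum_right[of t "\<lambda>b. (x \<bullet> b / (b \<bullet> b)) *\<^sub>R b" C] by simp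
  with y show "(\<Sum>b\<in>C. ((t *\<^sub>R x + y) \<bullet> b / (b \<bullet> b)) *\<^sub>R b) = t *\<^sub>R x + y"
    by (simp add: inner_add_left add_divide_distrib scaleR_add_left sum.distrib)
qed

text \<open>A weak subsequential limit exists anyway; finitely many coordinates in an orthogonal
  spanning set upgrade it to a norm limit.\<close>

lemma compact_finite_dimensional:
  fixes V :: "'a::real_inner set"
  assumes V: "hilbert_space V" "finite_dimensional V"
  shows "compact (V \<inter> cball 0 R)"
  unfolding compact_eq_seq_compact_metric seq_compact_def
proof (intro allI impI)
  fix X :: "nat \<Rightarrow> 'a" assume X: "\<forall>k. X k \<in> V \<inter> cball 0 R"
  obtain C where C: "finite C" "span C = V" "pairwise orthogonal C"
    using V(2) basis_orthogonal unfolding finite_dimensional_def by metis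
  obtain r p where r: "strict_mono r" and p: "p \<in> V" "\<And>h. (\<lambda>k. X (r k) \<bullet> h) \<longlonglongrightarrow> p \<bullet> h"
    using weak_subsequence[of V X R] V(1) X by (auto simp: hilbert_space_def)
  have "(\<lambda>k. \<Sum>b\<in>C. ((X (r k) - p) \<bullet> b / (b \<bullet> b)) *\<^sub>R b) \<longlonglongrightarrow> (\<Sum>b\<in>C. (0 / (b \<bullet> b)) *\<^sub>R b)"
  proof (intro tendsto_sum tendsto_scaleR tendsto_const tendsto_divide_zero)
    show "(\<lambda>k. (X (r k) - p) \<bullet> b / (b \<bullet> b)) \<longlonglongrightarrow> 0 / (b \<bullet> b)" if "b \<in> C" for b
      using tendsto_divide_zero[OF tendsto_diff[OF p(2)[of b] tendsto_const[of "p \<bullet> b"], simplified], of "b \<bullet> b"]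
      by (simp add: inner_diff_left)
  qed
  moreover have "(\<Sum>b\<in>C. ((X (r k) - p) \<bullet> b / (b \<bullet> b)) *\<^sub>R b) = X (r k) - p" for k
  proof -
    have "X (r k) - p \<in> span C"
      using X p(1) C(2) by (auto intro!: span_diff)
    then show ?thesis using orthogonal_expansion[OF C(1,3)] by simp
  qed
  ultimately have "(\<lambda>k. X (r k) - p) \<longlonglongrightarrow> 0" by simp
  then have lim: "(X \<circ> r) \<longlonglongrightarrow> p" by (simp add: LIM_zero_iff o_def)
  have "closed (V \<inter> cball 0 R)"
    using V(1) by (auto simp: hilbert_space_def complete_imp_closed)
  then have "p \<in> V \<inter> cball 0 R"
    using lim X by (metis closed_sequentially o_apply)
  with r lim show "\<exists>l\<in>V \<inter> cball 0 R. \<exists>r. strict_mono r \<and> (X \<circ> r) \<longlonglongrightarrow> l" by blast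
qed


section \<open>Monotone operators and single steps\<close>

text \<open>Boundedness of \<open>G\<close> makes \<open>G x \<bullet> y\<close> a bounded form in
  \<open>x\<close>. Riesz gives existence and \<open>inner_eq_on_subspace\<close> uniqueness, which
  together justify the definite description in \<open>adjoint_on\<close>.\<close>

lemma adjoint_on:
  assumes V: "hilbert_space V" and G: "bounded_linear_between V W G"
  shows adjoint_on_mem: "adjoint_on V G y \<in> V"
    and adjoint_on_inner: "x \<in> V \<Longrightarrow> x \<bullet> adjoint_on V G y = G x \<bullet> y"
proof -
  obtain K where K: "\<And>x. x \<in> V \<Longrightarrow> norm (G x) \<le> norm x * K"
    using G unfolding bounded_linear_between_def by blast
  have sub: "subspace V" "complete V" using V by (auto simp: hilbert_space_def)
  have "\<exists>u\<in>V. \<forall>x\<in>V. G x \<bullet> y = x \<bullet> u"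
  proof (rule riesz_representation_on[OF sub])
    show "\<bar>G x \<bullet> y\<bar> \<le> (K * norm y) * norm x" if "x \<in> V" for x
    proof -
      have "\<bar>G x \<bullet> y\<bar> \<le> norm (G x) * norm y" by (rule Cauchy_Schwarz_ineq2)
      also have "\<dots> \<le> (norm x * K) * norm y" using K[OF that] by (rule mult_right_mono) simp
      finally show ?thesis by (simp add: mult_ac)
    qed
  qed (use G in \<open>auto simp: bounded_linear_between_def inner_add_left\<close>)
  then obtain u where u: "u \<in> V \<and> (\<forall>x\<in>V. G x \<bullet> y = x \<bullet> u)" by blast
  then have "\<exists>!u. u \<in> V \<and> (\<forall>x\<in>V. G x \<bullet> y = x \<bullet> u)"
    using inner_eq_on_subspace[OF sub(1)] by (intro ex1I[of _ u]) auto
  from theI'[OF this]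
  have "adjoint_on V G y \<in> V \<and> (\<forall>x\<in>V. G x \<bullet> y = x \<bullet> adjoint_on V G y)"
    unfolding adjoint_on_def .
  then show "adjoint_on V G y \<in> V" "x \<in> V \<Longrightarrow> x \<bullet> adjoint_on V G y = G x \<bullet> y" by auto
qed

lemma adjoint_on_diff:
  assumes V: "hilbert_space V" and G: "bounded_linear_between V W G"
  shows "adjoint_on V G (a - b) = adjoint_on V G a - adjoint_on V G b"
proof (rule inner_eq_on_subspace)
  show "subspace V" using V by (simp add: hilbert_space_def)
  then show "adjoint_on V G a - adjoint_on V G b \<in> V"
    by (intro subspace_diff adjoint_on_mem[OF V G])
qed (simp_all add: adjoint_on_mem[OF V G] adjoint_on_inner[OF V G] inner_diff_right)

text \<open>The adjoint identity is tested at the adjoint vector itself, and one factor of its norm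
  is cancelled.\<close>

lemma norm_adjoint_on_le:
  assumes V: "hilbert_space V" and G: "bounded_linear_between V W G"
    and K: "\<And>x. x \<in> V \<Longrightarrow> norm (G x) \<le> norm x * K" and K0: "0 \<le> K"
  shows "norm (adjoint_on V G y) \<le> K * norm y"
proof (cases "adjoint_on V G y = 0")
  case True
  then show ?thesis using K0 by simp
next
  case False
  define u where "u = adjoint_on V G y"
  have u: "u \<in> V" "u \<noteq> 0" using False adjoint_on_mem[OF V G] by (auto simp: u_def)
  have "norm u * norm u = u \<bullet> u" by (simp add: power2_norm_eq_inner flip: power2_eq_square)
  also have "\<dots> = G u \<bullet> y" using adjoint_on_inner[OF V G u(1), of y] by (simp add: u_def)
  also have "\<dots> \<le> norm (G u) * norm y" by (rule norm_cauchy_schwarz)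
  also have "\<dots> \<le> (norm u * K) * norm y" using K[OF u(1)] by (rule mult_right_mono) simp
  finally have "norm u * norm u \<le> norm u * (K * norm y)" by (simp add: mult_ac)
  then show ?thesis using u(2) by (simp add: u_def)
qed

text \<open>For two graph points of a monotone operator the cross term of \<open>x - a\<close> and
  \<open>r (y - u)\<close> is nonnegative, so a bound on their sum bounds both. Backward steps are
  kept bounded in this way.\<close>

lemma norm_le_norm_add_of_inner_nonneg:
  fixes a b :: "'a::real_inner"
  assumes "0 \<le> a \<bullet> b"
  shows "norm a \<le> norm (a + b)"
proof -
  have "(norm a)\<^sup>2 \<le> (norm (a + b))\<^sup>2"
    using assms by (simp add: power2_norm_eq_inner inner_add_left inner_add_right inner_commute)
  then show ?thesis by (rule power2_le_imp_le) simp
qed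

section \<open>Criteria for membership in a monotone operator\<close>

lemma monotone_operatorD:
  assumes "monotone_operator V A" "x \<in> V" "u \<in> A x" "y \<in> V" "v \<in> A y"
  shows "0 \<le> (x - y) \<bullet> (u - v)"
  using assms unfolding monotone_operator_def graph_of_def by fast

text \<open>Adjoining the single point \<open>(x, u)\<close> keeps the graph monotone, so by
  maximality the point was already there.\<close>

lemma maximal_monotone_mem:
  assumes A: "maximal_monotone V A" and xu: "x \<in> V" "u \<in> V"
    and rel: "\<And>y v. y \<in> V \<Longrightarrow> v \<in> A y \<Longrightarrow> 0 \<le> (x - y) \<bullet> (u - v)"
  shows "u \<in> A x"
proof -
  define B where "B = (\<lambda>y. if y = x then insert u (A x) else A y)"
  have mon: "monotone_operator V A" using A by (simp add: maximal_monotone_def)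
  have rel': "0 \<le> (y - x) \<bullet> (v - u)" if "y \<in> V" "v \<in> A y" for y v
    using rel[OF that] by (simp add: inner_diff_left inner_diff_right)
  have "0 \<le> (y - y') \<bullet> (v - v')" if "y \<in> V" "v \<in> B y" "y' \<in> V" "v' \<in> B y'" for y v y' v'
    using that rel rel' monotone_operatorD[OF mon] by (auto simp: B_def split: if_splits)
  moreover have "set_operator V B"
    using mon xu unfolding monotone_operator_def set_operator_def B_def by auto
  ultimately have "monotone_operator V B"
    unfolding monotone_operator_def graph_of_def by auto
  moreover have "graph_of V A \<subseteq> graph_of V B" by (auto simp: graph_of_def B_def)
  ultimately have "graph_of V B = graph_of V A" using A unfolding maximal_monotone_def by blast
  moreover have "(x, u) \<in> graph_of V B" using xu by (simp add: graph_of_def B_def)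
  ultimately show ?thesis by (simp add: graph_of_def)
qed

text \<open>Minty's argument: test against points approaching \<open>x\<close> from the direction \<open>u - f x\<close>.\<close>

lemma continuous_monotone_mem:
  assumes V: "subspace V" and A: "set_operator V A" "single_valued_continuous V A"
    and xu: "x \<in> V" "u \<in> V"
    and rel: "\<And>y v. y \<in> V \<Longrightarrow> v \<in> A y \<Longrightarrow> 0 \<le> (x - y) \<bullet> (u - v)"
  shows "u \<in> A x"
proof -
  obtain f where f: "continuous_on V f" "\<And>y. y \<in> V \<Longrightarrow> A y = {f y}"
    using A(2) unfolding single_valued_continuous_def by blast
  have fV: "f x \<in> V" using A(1) f(2)[OF xu(1)] xu(1) unfolding set_operator_def by auto
  define y where "y = (\<lambda>k. x + (1 / real (Suc k)) *\<^sub>R (u - f x))"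
  have yV: "y k \<in> V" for k
    using V xu fV by (simp add: y_def subspace_add subspace_scale subspace_diff)
  have "y \<longlonglongrightarrow> x + 0 *\<^sub>R (u - f x)"
    unfolding y_def by (intro tendsto_intros LIMSEQ_inverse_real_of_nat[unfolded inverse_eq_divide])
  then have "(\<lambda>k. f (y k)) \<longlonglongrightarrow> f x"
    using f(1) xu(1) yV by (auto intro: continuous_on_tendsto_compose)
  then have lim: "(\<lambda>k. (u - f x) \<bullet> (u - f (y k))) \<longlonglongrightarrow> (u - f x) \<bullet> (u - f x)"
    by (intro tendsto_intros)
  have "(u - f x) \<bullet> (u - f (y k)) \<le> 0" for k
  proof -
    have "0 \<le> (x - y k) \<bullet> (u - f (y k))" using rel[OF yV, of "f (y k)"] f(2)[OF yV] by simp
    \<comment> \<open>The positive factor \<open>1 / Suc k\<close> is cancelled before the limit,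
      where it would make the inequality trivial.\<close>
    also have "\<dots> = - ((1 / real (Suc k)) * ((u - f x) \<bullet> (u - f (y k))))" by (simp add: y_def)
    finally show ?thesis by (simp add: divide_le_0_iff)
  qed
  then have "(u - f x) \<bullet> (u - f x) \<le> 0" using lim by (intro LIMSEQ_le_const2) auto
  then have "u - f x = 0" using inner_gt_zero_iff[of "u - f x"] by fastforce
  then show ?thesis using f(2)[OF xu(1)] by simp
qed

section \<open>Estimates for a single backward or forward step\<close>

lemma backward_stepD:
  assumes "backward_step V A r \<theta> \<omega> err x y" "0 < r"
  shows "x \<in> V" "y \<in> A x" "\<theta> - x = r *\<^sub>R (y - \<omega>) - err"
proof -
  define a where "a = \<theta> + r *\<^sub>R \<omega> + err"
  have p: "prox V r A a = {x}" "y = inverse r *\<^sub>R (a - x)"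
    using assms(1) by (auto simp: backward_step_def Let_def a_def)
  then have "x \<in> prox V r A a" by simp
  then obtain u where u: "x \<in> V" "u \<in> A x" "a = x + r *\<^sub>R u" by (auto simp: prox_def)
  then have "y = u" using p(2) assms(2) by simp
  with u show "x \<in> V" "y \<in> A x" "\<theta> - x = r *\<^sub>R (y - \<omega>) - err"
    by (simp_all add: a_def algebra_simps)
qed

text \<open>Here \<open>a = \<theta> - x\<close>, \<open>b = y - \<omega>\<close> and
  \<open>e\<close> is the error. Pairing \<open>r b = a + e\<close> with \<open>a\<close> uses the
  first error condition, pairing \<open>a = r b - e\<close> with \<open>b\<close> the second. The
  former also shows that \<open>a \<bullet> b\<close> is nonnegative, which permits replacing
  \<open>r\<close> by \<open>rhi\<close>.\<close>

lemma backward_gap: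
  fixes a b e :: "'a::real_inner"
  assumes ab: "a = r *\<^sub>R b - e" and r: "0 < rlo" "rlo \<le> r" "r \<le> rhi" and \<sigma>: "\<sigma> < 1"
    and E: "- \<sigma> * (norm a)\<^sup>2 \<le> a \<bullet> e" "e \<bullet> b \<le> r * \<sigma> * (norm b)\<^sup>2"
  shows "(norm a)\<^sup>2 \<le> rhi / (1 - \<sigma>) * (a \<bullet> b)" "(norm b)\<^sup>2 \<le> 1 / ((1 - \<sigma>) * rlo) * (a \<bullet> b)"
proof -
  have "r * (a \<bullet> b) = a \<bullet> (a + e)" by (simp add: ab)
  also have "\<dots> = (norm a)\<^sup>2 + a \<bullet> e" by (simp add: inner_add_right power2_norm_eq_inner)
  finally have 1: "(1 - \<sigma>) * (norm a)\<^sup>2 \<le> r * (a \<bullet> b)" using E(1) by (simp add: algebra_simps)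
  moreover have "0 \<le> (1 - \<sigma>) * (norm a)\<^sup>2" using \<sigma> by simp
  ultimately have "0 \<le> r * (a \<bullet> b)" by linarith
  then have nonneg: "0 \<le> a \<bullet> b" using r by (simp add: zero_le_mult_iff)
  have "(1 - \<sigma>) * (norm a)\<^sup>2 \<le> rhi * (a \<bullet> b)"
    using 1 mult_right_mono[OF r(3) nonneg] by linarith
  then show "(norm a)\<^sup>2 \<le> rhi / (1 - \<sigma>) * (a \<bullet> b)" using \<sigma> by (simp add: field_simps)
  have "a \<bullet> b = r * (norm b)\<^sup>2 - e \<bullet> b" by (simp add: ab inner_diff_left power2_norm_eq_inner)
  then have "r * ((1 - \<sigma>) * (norm b)\<^sup>2) \<le> a \<bullet> b" using E(2) by (simp add: algebra_simps)
  moreover have "rlo * ((1 - \<sigma>) * (norm b)\<^sup>2) \<le> r * ((1 - \<sigma>) * (norm b)\<^sup>2)"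
    using \<sigma> r(2) by (intro mult_right_mono) auto
  ultimately have "(norm b)\<^sup>2 * ((1 - \<sigma>) * rlo) \<le> a \<bullet> b" by (simp add: mult_ac)
  then show "(norm b)\<^sup>2 \<le> 1 / ((1 - \<sigma>) * rlo) * (a \<bullet> b)" using \<sigma> r(1) by (simp add: pos_le_divide_eq)
qed

text \<open>The search ends because the test, divided by the stepsize, compares a quantity tending
  to 0 with one tending to the squared norm of \<open>f \<theta> - \<omega>\<close>, which is
  positive. Leastness of the accepted index is recorded as well: either the initial stepsize was
  accepted or \<open>t / \<nu>\<close> was rejected, and this rejection later controls the dual
  gap.\<close>

lemma forward_step_cases:
  assumes V: "subspace V" and f: "continuous_on V f" "\<And>y. y \<in> V \<Longrightarrow> A y = {f y}" "\<And>y. y \<in> V \<Longrightarrow> f y \<in> V"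
    and par: "0 < \<nu>" "\<nu> < 1" "0 < \<Delta>" "0 < r" and mem: "\<theta> \<in> V" "\<omega> \<in> V"
    and step: "forward_step \<nu> \<Delta> A r \<theta> \<omega> x y"
  obtains t where "0 < t" "t \<le> r" "x = \<theta> - t *\<^sub>R (f \<theta> - \<omega>)" "x \<in> V" "y = f x"
    "\<Delta> * (norm (\<theta> - x))\<^sup>2 \<le> (\<theta> - x) \<bullet> (y - \<omega>)"
    "t = r \<or> t / \<nu> \<le> r \<and>
      (t / \<nu>) * ((f \<theta> - \<omega>) \<bullet> (f (\<theta> - (t / \<nu>) *\<^sub>R (f \<theta> - \<omega>)) - \<omega>))
        < \<Delta> * (t / \<nu>)\<^sup>2 * (norm (f \<theta> - \<omega>))\<^sup>2"
proof (cases "f \<theta> = \<omega>")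
  case True
  \<comment> \<open>No search takes place. Any stepsize describes \<open>x = \<theta>\<close>, and
    \<open>t = r\<close> selects the alternative without a rejected trial.\<close>
  then have "x = \<theta>" "y = \<omega>" using step f(2) mem by (auto simp: forward_step_def)
  with True par mem show ?thesis by (intro that[of r]) auto
next
  case False
  define \<delta> where "\<delta> = f \<theta> - \<omega>"
  define p where "p = (\<lambda>s. \<theta> - s *\<^sub>R \<delta>)"
  \<comment> \<open>The acceptance test at stepsize \<open>s\<close>, after substituting
    \<open>\<theta> - p s = s \<delta>\<close>.\<close>
  define ok where "ok = (\<lambda>s. \<Delta> * s\<^sup>2 * (norm \<delta>)\<^sup>2 \<le> s * (\<delta> \<bullet> (f (p s) - \<omega>)))"
  have pV: "p s \<in> V" for s
    using V mem f(3) by (simp add: p_def \<delta>_def subspace_diff subspace_scale)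
  define J where "J = (LEAST j. 1 \<le> j \<and> ok (\<nu> ^ (j - 1) * r))"
  have xy: "x = p (\<nu> ^ (J - 1) * r)" "y = f x"
  proof -
    have *: "\<Delta> * (norm (\<theta> - p s))\<^sup>2 - (\<theta> - p s) \<bullet> (the_elem (A (p s)) - \<omega>) \<le> 0 \<longleftrightarrow> ok s" for s
      by (simp add: f(2)[OF pV] ok_def) (simp add: p_def power_mult_distrib mult.assoc)
    have J: "J = (LEAST j. 1 \<le> j \<and> \<Delta> * (norm (\<theta> - p (\<nu> ^ (j - 1) * r)))\<^sup>2
        - (\<theta> - p (\<nu> ^ (j - 1) * r)) \<bullet> (the_elem (A (p (\<nu> ^ (j - 1) * r))) - \<omega>) \<le> 0)"
      unfolding J_def * ..
    have \<theta>: "the_elem (A \<theta>) = f \<theta>" using f(2) mem by simp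
    have "x = p (\<nu> ^ (J - 1) * r) \<and> y = the_elem (A (p (\<nu> ^ (J - 1) * r)))"
      using step unfolding forward_step_def Let_def J p_def \<delta>_def \<theta> by (simp only: False if_False)
    then show "x = p (\<nu> ^ (J - 1) * r)" "y = f x" using f(2)[OF pV] by auto
  qed
  have "\<exists>j\<ge>1. ok (\<nu> ^ (j - 1) * r)"
  proof -
    define s where "s = (\<lambda>j. \<nu> ^ j * r)"
    have s: "s \<longlonglongrightarrow> 0" "\<And>j. 0 < s j"
      using par by (auto simp: s_def intro!: tendsto_mult_left_zero LIMSEQ_realpow_zero)
    have "(\<lambda>j. p (s j)) \<longlonglongrightarrow> \<theta> - 0 *\<^sub>R \<delta>"
      unfolding p_def by (intro tendsto_intros s)
    then have "(\<lambda>j. f (p (s j))) \<longlonglongrightarrow> f \<theta>"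
      using f(1) mem pV by (auto intro: continuous_on_tendsto_compose)
    then have "(\<lambda>j. \<delta> \<bullet> (f (p (s j)) - \<omega>) - \<Delta> * s j * (norm \<delta>)\<^sup>2) \<longlonglongrightarrow> \<delta> \<bullet> (f \<theta> - \<omega>) - \<Delta> * 0 * (norm \<delta>)\<^sup>2"
      by (intro tendsto_intros s)
    moreover have "\<delta> \<bullet> (f \<theta> - \<omega>) - \<Delta> * 0 * (norm \<delta>)\<^sup>2 > 0"
      using False by (simp add: \<delta>_def)
    ultimately have "\<forall>\<^sub>F j in sequentially. \<delta> \<bullet> (f (p (s j)) - \<omega>) - \<Delta> * s j * (norm \<delta>)\<^sup>2 > 0"
      by (rule order_tendstoD)
    then obtain j where j: "\<delta> \<bullet> (f (p (s j)) - \<omega>) - \<Delta> * s j * (norm \<delta>)\<^sup>2 > 0"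
      by (auto simp: eventually_sequentially)
    then have "0 < s j * (\<delta> \<bullet> (f (p (s j)) - \<omega>) - \<Delta> * s j * (norm \<delta>)\<^sup>2)"
      using s(2) by (rule mult_pos_pos[rotated])
    then have "ok (s j)" by (simp add: ok_def power2_eq_square algebra_simps)
    then show ?thesis by (intro exI[of _ "Suc j"]) (simp add: s_def)
  qed
  then have "1 \<le> J \<and> ok (\<nu> ^ (J - 1) * r)" unfolding J_def by (rule LeastI_ex)
  then have J: "1 \<le> J" "ok (\<nu> ^ (J - 1) * r)" by auto
  define t where "t = \<nu> ^ (J - 1) * r"
  show ?thesis
  proof (rule that)
    show "0 < t" using par by (simp add: t_def)
    show "t \<le> r" using par by (simp add: t_def power_le_one mult_left_le_one_le)
    show "x = \<theta> - t *\<^sub>R (f \<theta> - \<omega>)" using xy by (simp add: p_def \<delta>_def t_def)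
    show "x \<in> V" using xy pV by simp
    show "y = f x" by (rule xy)
    show "\<Delta> * (norm (\<theta> - x))\<^sup>2 \<le> (\<theta> - x) \<bullet> (y - \<omega>)"
      using J(2) unfolding xy(2) unfolding xy(1) by (simp add: ok_def p_def power_mult_distrib mult.assoc)
    show "t = r \<or> t / \<nu> \<le> r \<and>
      (t / \<nu>) * ((f \<theta> - \<omega>) \<bullet> (f (\<theta> - (t / \<nu>) *\<^sub>R (f \<theta> - \<omega>)) - \<omega>))
        < \<Delta> * (t / \<nu>)\<^sup>2 * (norm (f \<theta> - \<omega>))\<^sup>2"
    proof (cases "J = 1")
      case False
      \<comment> \<open>The preceding trial has number \<open>Suc j\<close>, which is at least 1; so
        it failed the test itself, and its stepsize is \<open>t / \<nu>\<close>.\<close>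
      then obtain j where j: "J = Suc (Suc j)" using J(1) by (metis One_nat_def Suc_le_D not0_implies_Suc)
      have t: "t / \<nu> = \<nu> ^ j * r" using par by (simp add: t_def j)
      have "\<not> (1 \<le> Suc j \<and> ok (\<nu> ^ (Suc j - 1) * r))"
        by (rule not_less_Least) (use j in \<open>simp add: J_def\<close>)
      then have "\<not> ok (t / \<nu>)" by (simp add: t)
      moreover have "t / \<nu> \<le> r" using par by (simp add: t power_le_one mult_left_le_one_le)
      ultimately show ?thesis by (simp add: ok_def p_def \<delta>_def)
    qed (simp add: t_def)
  qed
qed

lemma forward_stepD:
  assumes V: "subspace V" and A: "set_operator V A" "single_valued_continuous V A"
    and par: "0 < \<nu>" "\<nu> < 1" "0 < \<Delta>" "0 < r" and mem: "\<theta> \<in> V" "\<omega> \<in> V"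
    and step: "forward_step \<nu> \<Delta> A r \<theta> \<omega> x y"
  shows "x \<in> V" "y \<in> A x" "\<Delta> * (norm (\<theta> - x))\<^sup>2 \<le> (\<theta> - x) \<bullet> (y - \<omega>)"
proof -
  obtain f where f: "continuous_on V f" "\<And>y. y \<in> V \<Longrightarrow> A y = {f y}"
    using A(2) unfolding single_valued_continuous_def by blast
  have fV: "f y \<in> V" if "y \<in> V" for y using A(1) f(2)[OF that] that unfolding set_operator_def by auto
  have "x \<in> V \<and> y \<in> A x \<and> \<Delta> * (norm (\<theta> - x))\<^sup>2 \<le> (\<theta> - x) \<bullet> (y - \<omega>)"
    by (rule forward_step_cases[OF V f fV par mem step]) (auto simp: f(2))
  then show "x \<in> V" "y \<in> A x" "\<Delta> * (norm (\<theta> - x))\<^sup>2 \<le> (\<theta> - x) \<bullet> (y - \<omega>)" by auto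
qed

lemma bounded_image_finite_dimensional:
  assumes "hilbert_space V" "finite_dimensional V" "continuous_on V f"
  shows "\<exists>B\<ge>0. \<forall>x\<in>V. norm x \<le> R \<longrightarrow> norm (f x) \<le> B"
proof -
  have "compact (f ` (V \<inter> cball 0 R))"
    using assms by (intro compact_continuous_image compact_finite_dimensional) (auto intro: continuous_on_subset)
  then have "bounded (f ` (V \<inter> cball 0 R))" by (rule compact_imp_bounded)
  then obtain B where "\<forall>y\<in>f ` (V \<inter> cball 0 R). norm y \<le> B" unfolding bounded_iff by blast
  then show ?thesis by (intro exI[of _ "max 0 B"]) (auto simp: le_max_iff_disj)
qed

lemma uniformly_continuous_finite_dimensional:
  assumes "hilbert_space V" "finite_dimensional V" "continuous_on V f" "0 < \<epsilon>"
  shows "\<exists>\<delta>>0. \<forall>x\<in>V. \<forall>y\<in>V. norm x \<le> R \<longrightarrow> norm y \<le> R \<longrightarrow>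
    norm (x - y) < \<delta> \<longrightarrow> norm (f x - f y) < \<epsilon>"
proof -
  have "uniformly_continuous_on (V \<inter> cball 0 R) f"
    using assms by (intro compact_uniformly_continuous compact_finite_dimensional) (auto intro: continuous_on_subset)
  then obtain \<delta> where "0 < \<delta>" "\<forall>x\<in>V \<inter> cball 0 R. \<forall>y\<in>V \<inter> cball 0 R.
    dist y x < \<delta> \<longrightarrow> dist (f y) (f x) < \<epsilon>"
    using assms(4) unfolding uniformly_continuous_on_def by blast
  then show ?thesis by (intro exI[of _ \<delta>]) (auto simp: dist_norm)
qed

context
  fixes V :: "'a::real_inner set" and A :: "'a \<Rightarrow> 'a set" and \<nu> \<Delta> R rlo rhi :: real
  assumes V: "hilbert_space V" "finite_dimensional V"
    and A: "set_operator V A" "single_valued_continuous V A"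
    and par: "0 < \<nu>" "\<nu> < 1" "0 < \<Delta>"
begin

text \<open>Backtracking only shrinks the stepsize, so the accepted point stays within
  \<open>rhi * norm (f \<theta> - \<omega>)\<close> of \<theta> however many trials occur.
  \<open>f\<close> is bounded on the ball of the points \<theta> and then on the larger ball of
  radius \<open>R'\<close> containing the accepted points.\<close>

lemma forward_step_bounded:
  "\<exists>B. \<forall>\<theta>\<in>V. \<forall>\<omega>\<in>V. \<forall>r x y. norm \<theta> \<le> R \<longrightarrow> norm \<omega> \<le> R \<longrightarrow> 0 < r \<longrightarrow> r \<le> rhi \<longrightarrow>
    forward_step \<nu> \<Delta> A r \<theta> \<omega> x y \<longrightarrow> norm x \<le> B \<and> norm y \<le> B"
proof -
  obtain f where f: "continuous_on V f" "\<And>y. y \<in> V \<Longrightarrow> A y = {f y}"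
    using A(2) unfolding single_valued_continuous_def by blast
  have fV: "f y \<in> V" if "y \<in> V" for y using A(1) f(2)[OF that] that unfolding set_operator_def by auto
  have sub: "subspace V" using V by (simp add: hilbert_space_def)
  obtain B1 where B1: "0 \<le> B1" "\<And>x. x \<in> V \<Longrightarrow> norm x \<le> R \<Longrightarrow> norm (f x) \<le> B1"
    using bounded_image_finite_dimensional[OF V f(1), of R] by blast
  define R' where "R' = R + rhi * (B1 + R)"
  obtain B2 where B2: "0 \<le> B2" "\<And>x. x \<in> V \<Longrightarrow> norm x \<le> R' \<Longrightarrow> norm (f x) \<le> B2"
    using bounded_image_finite_dimensional[OF V f(1), of R'] by blast
  show ?thesis
  proof (intro exI[of _ "max R' B2"] ballI allI impI)
    fix \<theta> \<omega> r x y
    assume asm: "\<theta> \<in> V" "\<omega> \<in> V" "norm \<theta> \<le> R" "norm \<omega> \<le> R" "0 < r" "r \<le> rhi"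
      "forward_step \<nu> \<Delta> A r \<theta> \<omega> x y"
    obtain t where t: "0 < t" "t \<le> r" "x = \<theta> - t *\<^sub>R (f \<theta> - \<omega>)" "x \<in> V" "y = f x"
      using forward_step_cases[OF sub f fV par asm(5,1,2,7)] by blast
    have "norm x \<le> norm \<theta> + t * norm (f \<theta> - \<omega>)"
      using norm_triangle_ineq4[of \<theta> "t *\<^sub>R (f \<theta> - \<omega>)"] t by simp
    also have "\<dots> \<le> R + rhi * (B1 + R)"
      using asm t B1(2)[OF asm(1,3)] norm_triangle_ineq4[of "f \<theta>" \<omega>]
      by (intro add_mono mult_mono) auto
    finally have "norm x \<le> R'" by (simp add: R'_def)
    then show "norm x \<le> max R' B2 \<and> norm y \<le> max R' B2"
      using B2(2)[OF t(4)] t(5) by auto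
  qed
qed

text \<open>
  If the accepted stepsize is small then the previous, rejected trial is as close to \<open>\<theta>\<close> up to the
  factor \<open>1 / \<nu>\<close>, and its rejection bounds \<open>norm (f \<theta> - \<omega>)\<close> by twice the oscillation of \<open>f\<close>.
\<close>

lemma forward_step_dual_gap:
  assumes "0 < rlo" "0 < \<epsilon>"
  shows "\<exists>\<delta>>0. \<forall>\<theta>\<in>V. \<forall>\<omega>\<in>V. \<forall>r x y. norm \<theta> \<le> R \<longrightarrow> norm \<omega> \<le> R \<longrightarrow> rlo \<le> r \<longrightarrow> r \<le> rhi \<longrightarrow>
    forward_step \<nu> \<Delta> A r \<theta> \<omega> x y \<longrightarrow> norm (\<theta> - x) < \<delta> \<longrightarrow> norm (y - \<omega>) < \<epsilon>"
proof -
  obtain f where f: "continuous_on V f" "\<And>y. y \<in> V \<Longrightarrow> A y = {f y}"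
    using A(2) unfolding single_valued_continuous_def by blast
  have fV: "f y \<in> V" if "y \<in> V" for y using A(1) f(2)[OF that] that unfolding set_operator_def by auto
  have sub: "subspace V" using V by (simp add: hilbert_space_def)
  \<comment> \<open>Contains \<theta>, the accepted point (at distance at most 1 from it) and the
    rejected one (at distance at most \<open>1 / \<nu>\<close>).\<close>
  define R' where "R' = R + 1 + 1 / \<nu>"
  obtain \<delta>0 where d0: "0 < \<delta>0" "\<And>x y. x \<in> V \<Longrightarrow> y \<in> V \<Longrightarrow> norm x \<le> R' \<Longrightarrow> norm y \<le> R' \<Longrightarrow>
    norm (x - y) < \<delta>0 \<Longrightarrow> norm (f x - f y) < \<epsilon> / 4"
    using uniformly_continuous_finite_dimensional[OF V f(1), of "\<epsilon> / 4" R'] assms(2) by auto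
  \<comment> \<open>Below \<open>rlo\<close> the accepted stepsize is not the initial one; below
    \<open>\<nu> / (2 * \<Delta>)\<close> the rejected stepsize \<open>s\<close> satisfies
    \<open>\<Delta> * s \<le> 1 / 2\<close>.\<close>
  define t0 where "t0 = min rlo (\<nu> / (2 * \<Delta>))"
  have t0: "0 < t0" using assms par by (simp add: t0_def)
  \<comment> \<open>The three bounds keep the points in the ball, bring the rejected trial within
    \<open>\<delta>0\<close> in spite of the factor \<open>1 / \<nu>\<close>, and make
    \<open>g\<close> small when \<open>t\<close> is at least \<open>t0\<close>.\<close>
  define \<delta> where "\<delta> = min 1 (min (\<nu> * \<delta>0) (t0 * \<epsilon> / 4))"
  have d: "0 < \<delta>" "\<delta> \<le> 1" "\<delta> \<le> \<nu> * \<delta>0" "\<delta> \<le> t0 * \<epsilon> / 4"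
    using d0(1) par(1) t0 assms(2) unfolding \<delta>_def by simp_all
  have "\<nu> * \<delta>0 \<le> \<delta>0" using d0 par by simp
  with d have d': "\<delta> \<le> \<delta>0" by linarith
  show ?thesis
  proof (intro exI[of _ \<delta>] conjI ballI allI impI)
    fix \<theta> \<omega> r x y
    assume asm: "\<theta> \<in> V" "\<omega> \<in> V" "norm \<theta> \<le> R" "norm \<omega> \<le> R" "rlo \<le> r" "r \<le> rhi"
      "forward_step \<nu> \<Delta> A r \<theta> \<omega> x y" and close: "norm (\<theta> - x) < \<delta>"
    define p where "p = (\<lambda>s. \<theta> - s *\<^sub>R (f \<theta> - \<omega>))"
    have r: "0 < r" using asm assms by linarith
    obtain t where t: "0 < t" "t \<le> r" "x = p t" "x \<in> V" "y = f x"
      and rejected: "t = r \<or> t / \<nu> \<le> r \<and>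
        (t / \<nu>) * ((f \<theta> - \<omega>) \<bullet> (f (p (t / \<nu>)) - \<omega>)) < \<Delta> * (t / \<nu>)\<^sup>2 * (norm (f \<theta> - \<omega>))\<^sup>2"
      using forward_step_cases[OF sub f fV par r asm(1,2,7)] unfolding p_def by metis
    define g where "g = norm (f \<theta> - \<omega>)"
    have tg: "t * g = norm (\<theta> - x)" using t by (simp add: p_def g_def)
    have near: "norm (p s) \<le> R'" if "norm (\<theta> - p s) \<le> 1 + 1 / \<nu>" for s
      using that asm(3) norm_triangle_ineq4[of \<theta> "\<theta> - p s"] by (simp add: R'_def)
    have "0 < 1 / \<nu>" using par by simp
    have "norm \<theta> \<le> R'" using asm(3) \<open>0 < 1 / \<nu>\<close> unfolding R'_def by linarith
    have "norm (\<theta> - p t) \<le> 1 + 1 / \<nu>" using close d \<open>0 < 1 / \<nu>\<close> unfolding t(3) by linarith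
    then have "norm (f x - f \<theta>) < \<epsilon> / 4"
      using close d' t \<open>norm \<theta> \<le> R'\<close> asm(1) near[of t] by (intro d0(2)) (auto simp: norm_minus_commute)
    moreover have "g \<le> \<epsilon> / 2"
    proof (cases "t0 \<le> t")
      case True
      have "t0 * g \<le> t * g" using True by (simp add: g_def mult_right_mono)
      also have "\<dots> \<le> t0 * (\<epsilon> / 4)" using tg close d by simp
      finally have "g \<le> \<epsilon> / 4" using t0 by simp
      then show ?thesis using assms by simp
    next
      case False
      define s where "s = t / \<nu>"
      have s: "0 < s" "s * g = norm (\<theta> - x) / \<nu>" using t par tg by (simp_all add: s_def mult.commute)
      have "t \<noteq> r" using False asm(5) by (simp add: t0_def)
      then have rej: "s * ((f \<theta> - \<omega>) \<bullet> (f (p s) - \<omega>)) < s * (\<Delta> * s * g\<^sup>2)"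
        using rejected by (simp add: s_def g_def power2_eq_square mult_ac)
      have "t < \<nu> / (2 * \<Delta>)" using False asm(5) \<open>t \<noteq> r\<close> t(2) by (auto simp: t0_def min_def split: if_splits)
      then have half: "\<Delta> * s \<le> 1 / 2" using par by (simp add: s_def field_simps)
      have ps: "norm (\<theta> - p s) = s * g" using s(1) by (simp add: p_def g_def)
      have "s * g \<le> 1 / \<nu>" unfolding s(2) using close d par by (intro divide_right_mono) auto
      then have "norm (p s) \<le> R'" using ps by (intro near) simp
      moreover have "s * g < \<delta>0"
      proof -
        have "norm (\<theta> - x) / \<nu> < (\<nu> * \<delta>0) / \<nu>" using close d par by (intro divide_strict_right_mono) auto
        then show ?thesis using s(2) par by simp
      qed
      moreover have "p s \<in> V" using sub asm fV by (simp add: p_def subspace_diff subspace_scale)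
      ultimately have osc: "norm (f (p s) - f \<theta>) < \<epsilon> / 4"
        using ps \<open>norm \<theta> \<le> R'\<close> asm(1) by (intro d0(2)) (auto simp: norm_minus_commute)
      have "g\<^sup>2 - g * norm (f (p s) - f \<theta>) \<le> (f \<theta> - \<omega>) \<bullet> (f (p s) - \<omega>)"
      proof -
        have "(f \<theta> - \<omega>) \<bullet> (f (p s) - \<omega>) = g\<^sup>2 + (f \<theta> - \<omega>) \<bullet> (f (p s) - f \<theta>)"
          by (simp add: g_def power2_norm_eq_inner inner_diff_right)
        moreover have "\<bar>(f \<theta> - \<omega>) \<bullet> (f (p s) - f \<theta>)\<bar> \<le> g * norm (f (p s) - f \<theta>)"
          unfolding g_def by (rule Cauchy_Schwarz_ineq2)
        ultimately show ?thesis by linarith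
      qed
      also have "\<dots> < \<Delta> * s * g\<^sup>2" using rej s(1) by simp
      \<comment> \<open>Half of the square of \<open>g\<close> is absorbed; cancelling one factor
        \<open>g\<close> leaves a bound by the oscillation of \<open>f\<close>.\<close>
      also have "\<dots> \<le> 1 / 2 * g\<^sup>2" using half by (rule mult_right_mono) simp
      finally have "g * g < g * (2 * norm (f (p s) - f \<theta>))" by (simp add: power2_eq_square)
      then have "g < 2 * norm (f (p s) - f \<theta>)"
        by (rule mult_left_less_imp_less) (simp add: g_def)
      then show ?thesis using osc by simp
    qed
    moreover have "norm (y - \<omega>) \<le> norm (f x - f \<theta>) + g"
      using norm_triangle_ineq[of "f x - f \<theta>" "f \<theta> - \<omega>"] t(5) by (simp add: g_def)
    ultimately show "norm (y - \<omega>) < \<epsilon>" using assms(2) by linarith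
  qed (rule d)
qed

end


section \<open>Sequences\<close>

declare One_nat_def [simp del]

text \<open>\<open>l\<close> may jump irregularly within its window. The difference is dominated by
  the sum over all fixed offsets up to \<open>N\<close>, each of which is a finite sum of
  consecutive differences.\<close>

lemma delayed_difference_tendsto_0:
  fixes X :: "nat \<Rightarrow> 'a::real_normed_vector"
  assumes steps: "(\<lambda>k. X (Suc k) - X k) \<longlonglongrightarrow> 0"
    and l: "\<And>k. K \<le> k \<Longrightarrow> l k \<le> k \<and> k \<le> l k + N"
  shows "(\<lambda>k. X k - X (l k)) \<longlonglongrightarrow> 0"
proof -
  have fixed: "(\<lambda>k. X k - X (k - j)) \<longlonglongrightarrow> 0" for j
  proof (induction j)
    case (Suc j)
    \<comment> \<open>Subtraction on naturals truncates; after the shift by \<open>Suc j\<close> the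
      indices are exact.\<close>
    have "(\<lambda>k. X (k + Suc j - j) - X (k + Suc j - Suc j)) \<longlonglongrightarrow> 0"
      using steps by simp
    then have "(\<lambda>k. X (k - j) - X (k - Suc j)) \<longlonglongrightarrow> 0" by (rule LIMSEQ_offset)
    with Suc have "(\<lambda>k. (X k - X (k - j)) + (X (k - j) - X (k - Suc j))) \<longlonglongrightarrow> 0 + 0"
      by (rule tendsto_add)
    then show ?case by simp
  qed simp
  have "(\<lambda>k. \<Sum>j\<le>N. norm (X k - X (k - j))) \<longlonglongrightarrow> (\<Sum>j\<le>N. 0)"
    by (intro tendsto_sum tendsto_norm_zero fixed)
  then have lim: "(\<lambda>k. \<Sum>j\<le>N. norm (X k - X (k - j))) \<longlonglongrightarrow> 0" by simp
  have bound: "norm (X k - X (l k)) \<le> (\<Sum>j\<le>N. norm (X k - X (k - j)))" if "K \<le> k" for k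
  proof -
    define j where "j = k - l k"
    have j: "l k = k - j" "j \<in> {..N}" using l[OF that] by (auto simp: j_def)
    have "norm (X k - X (k - j)) \<le> (\<Sum>j\<le>N. norm (X k - X (k - j)))"
      by (rule member_le_sum[OF j(2)]) auto
    then show ?thesis unfolding j(1) .
  qed
  show ?thesis
    by (rule Lim_null_comparison[OF eventually_sequentiallyI[OF bound] lim])
qed

lemma Bseq_inner_tendsto_0:
  fixes X Y :: "nat \<Rightarrow> 'a::real_inner"
  assumes "Bseq X" "Y \<longlonglongrightarrow> 0"
  shows "(\<lambda>k. X k \<bullet> Y k) \<longlonglongrightarrow> 0" "(\<lambda>k. Y k \<bullet> X k) \<longlonglongrightarrow> 0"
proof -
  have "Zfun Y sequentially" using assms(2) by (simp add: tendsto_Zfun_iff)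
  then have "Zfun (\<lambda>k. Y k \<bullet> X k) sequentially"
    using bounded_bilinear.Zfun_prod_Bfun[OF bounded_bilinear_inner] assms(1) by blast
  then show "(\<lambda>k. X k \<bullet> Y k) \<longlonglongrightarrow> 0" "(\<lambda>k. Y k \<bullet> X k) \<longlonglongrightarrow> 0"
    by (simp_all add: tendsto_Zfun_iff inner_commute)
qed

lemma BseqI_eventually:
  fixes X :: "nat \<Rightarrow> 'a::real_normed_vector"
  assumes "\<And>k. K \<le> k \<Longrightarrow> norm (X k) \<le> B"
  shows "Bseq X"
  using assms by (intro BfunI[of _ B]) (auto simp: eventually_sequentially)

lemma norm_diff_scaleR_squared:
  fixes a b :: "'a::real_inner"
  shows "(norm (a - t *\<^sub>R b))\<^sup>2 = (norm a)\<^sup>2 - 2 * t * (a \<bullet> b) + t\<^sup>2 * (norm b)\<^sup>2"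
  by (simp add: power2_norm_eq_inner inner_diff_left inner_diff_right inner_commute
      power2_eq_square[of t] algebra_simps)

lemma last_update_0 [simp]: "last_update I i 0 = 0"
  by (simp add: last_update_def)

lemma last_update_Suc:
  "last_update I i (Suc k) = (if i \<in> I (Suc k) then Suc k else last_update I i k)"
proof -
  have "{j \<in> {1..Suc k}. i \<in> I j} =
      (if i \<in> I (Suc k) then insert (Suc k) {j \<in> {1..k}. i \<in> I j} else {j \<in> {1..k}. i \<in> I j})"
    by (auto simp: le_Suc_eq)
  moreover have "Max (insert 0 (insert (Suc k) {j \<in> {1..k}. i \<in> I j})) = Suc k"
    by (intro Max_eqI) auto
  ultimately show ?thesis by (cases "i \<in> I (Suc k)") (simp_all only: last_update_def if_True if_False)
qed

lemma last_update_le: "last_update I i k \<le> k"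
  by (induction k) (auto simp: last_update_Suc)

lemma last_update_mem: "1 \<le> last_update I i k \<Longrightarrow> i \<in> I (last_update I i k)"
  by (induction k) (auto simp: last_update_Suc split: if_splits)

lemma last_update_ge: "1 \<le> j \<Longrightarrow> j \<le> k \<Longrightarrow> i \<in> I j \<Longrightarrow> j \<le> last_update I i k"
  by (induction k) (auto simp: last_update_Suc le_Suc_eq)

lemma tendsto_0_of_norm_squared_le:
  fixes X :: "nat \<Rightarrow> 'a::real_normed_vector"
  assumes "\<And>k. K \<le> k \<Longrightarrow> (norm (X k))\<^sup>2 \<le> c * g k" "g \<longlonglongrightarrow> 0"
  shows "X \<longlonglongrightarrow> 0"
proof (rule Lim_null_comparison[OF eventually_sequentiallyI])
  show "norm (X k) \<le> sqrt (c * g k)" if "K \<le> k" for k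
    using assms(1)[OF that] by (rule real_le_rsqrt)
  have "(\<lambda>k. sqrt (c * g k)) \<longlonglongrightarrow> sqrt (c * 0)" by (intro tendsto_intros assms(2))
  then show "(\<lambda>k. sqrt (c * g k)) \<longlonglongrightarrow> 0" by simp
qed

lemma Bseq_diff:
  fixes X Y :: "nat \<Rightarrow> 'a::real_normed_vector"
  assumes "Bseq X" "Bseq Y"
  shows "Bseq (\<lambda>k. X k - Y k)"
proof -
  obtain A B where "\<And>k. norm (X k) \<le> A" "\<And>k. norm (Y k) \<le> B"
    using assms unfolding Bseq_def by blast
  then have "norm (X k - Y k) \<le> A + B" for k
    by (meson add_mono norm_triangle_ineq4 order_trans)
  then show ?thesis by (rule BseqI')
qed

lemma Bseq_compose:
  fixes X :: "nat \<Rightarrow> 'a::real_normed_vector"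
  shows "Bseq X \<Longrightarrow> Bseq (\<lambda>k. X (l k))"
  by (auto simp: Bseq_def)


section \<open>The monotone inclusion\<close>

text \<open>With \<open>H n = H 0\<close> and \<open>G n\<close> the identity on \<open>H 0\<close>,
  the last operator is one more block of the same kind.\<close>

locale splitting_problem =
  fixes n :: nat
    and H :: "nat \<Rightarrow> 'a::real_inner set"
    and G :: "nat \<Rightarrow> 'a \<Rightarrow> 'a"
    and T :: "nat \<Rightarrow> 'a \<Rightarrow> 'a set"
    and IF IB :: "nat set"
  assumes n: "1 \<le> n"
    and partition: "IF \<union> IB = {1..n}"
    and G_n: "\<And>\<xi>. \<xi> \<in> H 0 \<Longrightarrow> G n \<xi> = \<xi>"
    and hilbert: "\<And>i. i \<le> n \<Longrightarrow> hilbert_space (H i)"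
    and H_n: "H n = H 0"
    and monotone: "\<And>i. i \<in> {1..n} \<Longrightarrow> monotone_operator (H i) (T i)"
    and IF: "\<And>i. i \<in> IF \<Longrightarrow> finite_dimensional (H i) \<and> single_valued_continuous (H i) (T i)"
    and IB: "\<And>i. i \<in> IB \<Longrightarrow> maximal_monotone (H i) (T i)"
    and G_bounded_linear: "\<And>i. i \<in> {1..<n} \<Longrightarrow> bounded_linear_between (H 0) (H i) (G i)"
begin

text \<open>\<open>w n = dual w\<close> expresses that the adjoint images of all \<open>n\<close>
  components sum to 0. Only the components below \<open>n\<close> enter, so the equation is not
  circular.\<close>

definition dual :: "(nat \<Rightarrow> 'a) \<Rightarrow> 'a" where
  "dual w = - (\<Sum>i\<in>{1..<n}. adjoint_on (H 0) (G i) (w i))"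

lemma subspace_H: "i \<le> n \<Longrightarrow> subspace (H i)"
  and complete_H: "i \<le> n \<Longrightarrow> complete (H i)"
  using hilbert by (auto simp: hilbert_space_def)

lemma set_operator: "i \<in> {1..n} \<Longrightarrow> set_operator (H i) (T i)"
  using monotone by (auto simp: monotone_operator_def)

lemma T_mem: "i \<in> {1..n} \<Longrightarrow> \<xi> \<in> H i \<Longrightarrow> u \<in> T i \<xi> \<Longrightarrow> u \<in> H i"
  using set_operator by (auto simp: set_operator_def)

lemma G_bl: "i \<in> {1..n} \<Longrightarrow> bounded_linear_between (H 0) (H i) (G i)"
  using G_bounded_linear[of i] subspace_H[of 0] H_n
  by (cases "i = n") (auto simp: bounded_linear_between_def G_n subspace_add subspace_scale intro!: exI[of _ 1])

lemma G_mem: "i \<in> {1..n} \<Longrightarrow> \<xi> \<in> H 0 \<Longrightarrow> G i \<xi> \<in> H i"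
  using G_bl by (auto simp: bounded_linear_between_def)

lemma G_diff:
  assumes "i \<in> {1..n}" "a \<in> H 0" "b \<in> H 0"
  shows "G i (a - b) = G i a - G i b"
proof -
  have "(-1) *\<^sub>R b \<in> H 0" using subspace_H[of 0] assms by (simp add: subspace_neg)
  then have "G i (a + (-1) *\<^sub>R b) = G i a + (-1) *\<^sub>R G i b"
    using G_bl[OF assms(1)] assms unfolding bounded_linear_between_def by metis
  then show ?thesis by simp
qed

lemma G_bound:
  assumes i: "i \<in> {1..n}"
  shows "\<exists>K\<ge>0. \<forall>\<xi>\<in>H 0. norm (G i \<xi>) \<le> norm \<xi> * K"
proof -
  obtain K where K: "\<forall>\<xi>\<in>H 0. norm (G i \<xi>) \<le> norm \<xi> * K"
    using G_bl[OF i] unfolding bounded_linear_between_def by blast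
  have "norm (G i \<xi>) \<le> norm \<xi> * max 0 K" if "\<xi> \<in> H 0" for \<xi>
    by (rule order_trans[OF K[rule_format, OF that]]) (simp add: mult_left_mono)
  then show ?thesis by (intro exI[of _ "max 0 K"]) auto
qed

lemma adjoint_mem: "i \<in> {1..n} \<Longrightarrow> adjoint_on (H 0) (G i) y \<in> H 0"
  using adjoint_on_mem[OF hilbert[of 0] G_bl] by simp

lemma adjoint_inner:
  "i \<in> {1..n} \<Longrightarrow> \<xi> \<in> H 0 \<Longrightarrow> \<xi> \<bullet> adjoint_on (H 0) (G i) y = G i \<xi> \<bullet> y"
  using adjoint_on_inner[OF hilbert[of 0] G_bl] by simp

lemma dual_mem: "dual w \<in> H 0"
  unfolding dual_def
  by (intro subspace_neg subspace_sum subspace_H adjoint_mem) auto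

lemma dual_cong: "(\<And>i. i \<in> {1..<n} \<Longrightarrow> w i = w' i) \<Longrightarrow> dual w = dual w'"
  by (simp add: dual_def)

lemma inner_dual: "\<xi> \<in> H 0 \<Longrightarrow> \<xi> \<bullet> dual w = - (\<Sum>i\<in>{1..<n}. G i \<xi> \<bullet> w i)"
  by (simp add: dual_def inner_sum_right adjoint_inner)

lemma sum_blocks: "(\<Sum>i\<in>{1..n}. f i) = (\<Sum>i\<in>{1..<n}. f i) + (f n :: 'b::ab_group_add)"
proof -
  have "{1..n} = insert n {1..<n}" using n by auto
  then show ?thesis by simp
qed

text \<open>The points \<open>(G i \<xi>)\<close> and the constrained \<open>w\<close> are
  orthogonal in the product space. This removes the bilinear term from \<phi> and the product of
  weakly convergent factors from the limit argument.\<close>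

lemma sum_inner_dual_eq_0:
  assumes "\<xi> \<in> H 0" "w n = dual w"
  shows "(\<Sum>i\<in>{1..n}. G i \<xi> \<bullet> w i) = 0"
  using assms by (simp add: sum_blocks G_n inner_dual)

lemma adjoint_tendsto_0:
  assumes i: "i \<in> {1..n}" and "X \<longlonglongrightarrow> 0"
  shows "(\<lambda>k. adjoint_on (H 0) (G i) (X k)) \<longlonglongrightarrow> 0"
proof -
  obtain K where K: "0 \<le> K" "\<And>\<xi>. \<xi> \<in> H 0 \<Longrightarrow> norm (G i \<xi>) \<le> norm \<xi> * K"
    using G_bound[OF i] by blast
  have lim: "(\<lambda>k. K * norm (X k)) \<longlonglongrightarrow> 0"
    using assms(2) by (intro tendsto_mult_right_zero tendsto_norm_zero)
  have bound: "norm (adjoint_on (H 0) (G i) (X k)) \<le> K * norm (X k)" for k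
    using norm_adjoint_on_le[OF hilbert[of 0] G_bl[OF i] K(2,1)] by simp
  show ?thesis
    by (rule Lim_null_comparison[OF always_eventually lim]) (simp add: bound)
qed

lemma G_tendsto_0:
  assumes i: "i \<in> {1..n}" and "X \<longlonglongrightarrow> 0" and mem: "\<And>k. N \<le> k \<Longrightarrow> X k \<in> H 0"
  shows "(\<lambda>k. G i (X k)) \<longlonglongrightarrow> 0"
proof -
  obtain K where K: "0 \<le> K" "\<And>\<xi>. \<xi> \<in> H 0 \<Longrightarrow> norm (G i \<xi>) \<le> norm \<xi> * K"
    using G_bound[OF i] by blast
  have lim: "(\<lambda>k. norm (X k) * K) \<longlonglongrightarrow> 0"
    using assms(2) by (intro tendsto_mult_left_zero tendsto_norm_zero)
  show ?thesis
    by (rule Lim_null_comparison[OF eventually_sequentiallyI lim]) (rule K(2)[OF mem])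
qed

lemma Bseq_G:
  assumes i: "i \<in> {1..n}" and "Bseq X" and mem: "\<And>k. N \<le> k \<Longrightarrow> X k \<in> H 0"
  shows "Bseq (\<lambda>k. G i (X k))"
proof -
  obtain K where K: "0 \<le> K" "\<And>\<xi>. \<xi> \<in> H 0 \<Longrightarrow> norm (G i \<xi>) \<le> norm \<xi> * K"
    using G_bound[OF i] by blast
  obtain B where B: "\<And>k. norm (X k) \<le> B" using assms(2) unfolding Bseq_def by blast
  have "norm (G i (X k)) \<le> B * K" if "N \<le> k" for k
    using K(2)[OF mem[OF that]] mult_right_mono[OF B K(1)] order_trans by blast
  then show ?thesis by (rule BseqI_eventually)
qed

lemma dual_diff_tendsto_0:
  assumes "\<And>i. i \<in> {1..<n} \<Longrightarrow> (\<lambda>k. X i k - X' i k) \<longlonglongrightarrow> 0"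
  shows "(\<lambda>k. dual (\<lambda>i. X i k) - dual (\<lambda>i. X' i k)) \<longlonglongrightarrow> 0"
proof -
  have "(\<lambda>k. - (\<Sum>i\<in>{1..<n}. adjoint_on (H 0) (G i) (X i k - X' i k))) \<longlonglongrightarrow> - (\<Sum>i\<in>{1..<n}. 0)"
    using assms by (intro tendsto_minus tendsto_sum adjoint_tendsto_0) auto
  moreover have "- (\<Sum>i\<in>{1..<n}. adjoint_on (H 0) (G i) (X i k - X' i k))
      = dual (\<lambda>i. X i k) - dual (\<lambda>i. X' i k)" for k
  proof -
    have "(\<Sum>i\<in>{1..<n}. adjoint_on (H 0) (G i) (X i k - X' i k))
      = (\<Sum>i\<in>{1..<n}. adjoint_on (H 0) (G i) (X i k) - adjoint_on (H 0) (G i) (X' i k))"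
      using adjoint_on_diff[OF hilbert[of 0] G_bl] by (intro sum.cong) auto
    then show ?thesis by (simp add: dual_def sum_subtractf)
  qed
  ultimately show ?thesis by simp
qed

lemma Bseq_dual:
  assumes "\<And>i. i \<in> {1..<n} \<Longrightarrow> Bseq (X i)"
  shows "Bseq (\<lambda>k. dual (\<lambda>i. X i k))"
proof -
  have "Bseq (\<lambda>k. adjoint_on (H 0) (G i) (X i k))" if i: "i \<in> {1..<n}" for i
  proof -
    have i': "i \<in> {1..n}" using i by simp
    obtain K where K: "0 \<le> K" "\<And>\<xi>. \<xi> \<in> H 0 \<Longrightarrow> norm (G i \<xi>) \<le> norm \<xi> * K"
      using G_bound[OF i'] by blast
    obtain B where B: "\<And>k. norm (X i k) \<le> B" using assms[OF i] unfolding Bseq_def by blast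
    have "norm (adjoint_on (H 0) (G i) (X i k)) \<le> K * B" for k
      by (rule order_trans[OF norm_adjoint_on_le[OF hilbert[of 0] G_bl[OF i'] K(2,1)]])
         (use B K in \<open>auto intro: mult_left_mono\<close>)
    then show ?thesis by (rule BseqI')
  qed
  then have "\<forall>i\<in>{1..<n}. \<exists>B. \<forall>k. norm (adjoint_on (H 0) (G i) (X i k)) \<le> B"
    unfolding Bseq_def by blast
  from bchoice[OF this] obtain B
    where B: "\<And>i k. i \<in> {1..<n} \<Longrightarrow> norm (adjoint_on (H 0) (G i) (X i k)) \<le> B i" by blast
  have "norm (dual (\<lambda>i. X i k)) \<le> (\<Sum>i\<in>{1..<n}. B i)" for k
    unfolding dual_def norm_minus_cancel by (rule sum_norm_le) (rule B)
  then show ?thesis by (rule BseqI')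
qed

text \<open>Backward blocks have this by maximality and forward blocks by Minty's argument; limits
  can then be taken without distinguishing the two.\<close>

lemma maximality:
  assumes i: "i \<in> {1..n}" and "\<xi> \<in> H i" "u \<in> H i"
    and "\<And>a b. a \<in> H i \<Longrightarrow> b \<in> T i a \<Longrightarrow> 0 \<le> (\<xi> - a) \<bullet> (u - b)"
  shows "u \<in> T i \<xi>"
proof (cases "i \<in> IB")
  case True
  then show ?thesis using maximal_monotone_mem[OF IB] assms by blast
next
  case False
  then have "i \<in> IF" using partition i by blast
  then show ?thesis
    using continuous_monotone_mem[OF subspace_H set_operator] IF i assms by simp
qed

lemma extended_solutionI:
  assumes "z \<in> H 0" "\<And>i. i \<in> {1..n} \<Longrightarrow> w i \<in> T i (G i z)" "w n = dual w"
  shows "(z, \<lambda>i\<in>{1..<n}. w i) \<in> extended_solution_set n H G T"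
proof -
  have "w i \<in> H i" if "i \<in> {1..<n}" for i
    using that T_mem[of i "G i z" "w i"] G_mem[of i z] assms(1) assms(2)[of i] by simp
  moreover have "- (\<Sum>i\<in>{1..<n}. adjoint_on (H 0) (G i) (w i)) \<in> T n z"
    using assms(2)[of n] assms(1,3) n by (simp add: dual_def G_n)
  ultimately show ?thesis
    using assms by (auto simp: extended_solution_set_def product_space_def)
qed

lemma extended_solutionD:
  assumes "(z, w) \<in> extended_solution_set n H G T"
  shows "z \<in> H 0" and "\<And>i. i \<in> {1..n} \<Longrightarrow> (w(n := dual w)) i \<in> T i (G i z)"
    and "\<And>i. i \<in> {1..<n} \<Longrightarrow> w i \<in> H i"
  using assms by (auto simp: extended_solution_set_def product_space_def dual_def G_n)

section \<open>Weak limits of primal-dual sequences\<close>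

lemma weak_limit_perturbed:
  fixes X Y :: "nat \<Rightarrow> 'a"
  assumes "(\<lambda>k. X k \<bullet> h) \<longlonglongrightarrow> a \<bullet> h" "(\<lambda>k. Y k - X k) \<longlonglongrightarrow> 0"
  shows "(\<lambda>k. Y k \<bullet> h) \<longlonglongrightarrow> a \<bullet> h"
proof -
  have "(\<lambda>k. X k \<bullet> h + (Y k - X k) \<bullet> h) \<longlonglongrightarrow> a \<bullet> h + 0 \<bullet> h"
    by (intro tendsto_add tendsto_inner assms tendsto_const)
  then show ?thesis by (simp add: inner_diff_left)
qed

text \<open>The adjoint moves \<open>G i\<close> onto the test vector, so \<open>G i\<close> is
  weakly continuous; the norm-null gap carries the limit over to \<open>X\<close>.\<close>

lemma weak_limit_image:
  assumes i: "i \<in> {1..n}" and mem: "\<And>k. N \<le> k \<Longrightarrow> Z k \<in> H 0" "z' \<in> H 0"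
    and weak: "\<And>h. (\<lambda>k. Z k \<bullet> h) \<longlonglongrightarrow> z' \<bullet> h"
    and gap: "(\<lambda>k. G i (Z k) - X k) \<longlonglongrightarrow> 0"
  shows "(\<lambda>k. X k \<bullet> h) \<longlonglongrightarrow> G i z' \<bullet> h"
proof (rule weak_limit_perturbed)
  have lim: "(\<lambda>k. Z k \<bullet> adjoint_on (H 0) (G i) h) \<longlonglongrightarrow> G i z' \<bullet> h"
    using weak[of "adjoint_on (H 0) (G i) h"] unfolding adjoint_inner[OF i mem(2)] .
  have eq: "Z k \<bullet> adjoint_on (H 0) (G i) h = G i (Z k) \<bullet> h" if "N \<le> k" for k
    using adjoint_inner[OF i mem(1)[OF that]] .
  show "(\<lambda>k. G i (Z k) \<bullet> h) \<longlonglongrightarrow> G i z' \<bullet> h"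
    by (rule Lim_transform_eventually[OF lim eventually_sequentiallyI[OF eq]])
  show "(\<lambda>k. X k - G i (Z k)) \<longlonglongrightarrow> 0" using tendsto_minus[OF gap] by simp
qed

lemma weak_limit_dual:
  assumes "\<And>i h. i \<in> {1..<n} \<Longrightarrow> (\<lambda>k. W i k \<bullet> h) \<longlonglongrightarrow> w' i \<bullet> h" and h: "h \<in> H 0"
  shows "(\<lambda>k. dual (\<lambda>i. W i k) \<bullet> h) \<longlonglongrightarrow> dual w' \<bullet> h"
proof -
  have dual: "dual v \<bullet> h = - (\<Sum>i\<in>{1..<n}. v i \<bullet> G i h)" for v
    using inner_dual[OF h, of v] by (simp add: inner_commute)
  show ?thesis unfolding dual by (intro tendsto_minus tendsto_sum assms(1))
qed

text \<open>
  Weak limits satisfy \<open>0 \<le> \<Sum>i. (G i z' - a i) \<bullet> (w' i - b i)\<close> for all choices of graph points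
  \<open>(a i, b i)\<close>. If some component were outside its graph, maximality would provide a strictly
  negative term there, while every component inside its graph can be made to contribute 0.
\<close>

lemma weak_cluster_point_solves:
  assumes mem: "\<And>k. Z k \<in> H 0" "\<And>i k. i \<in> {1..n} \<Longrightarrow> W i k \<in> H i" "\<And>i k. i \<in> {1..n} \<Longrightarrow> X i k \<in> H i"
    and dual: "\<And>k. W n k = dual (\<lambda>i. W i k)"
    and graph: "\<And>i k. i \<in> {1..n} \<Longrightarrow> Y i k \<in> T i (X i k)"
    and gap: "\<And>i. i \<in> {1..n} \<Longrightarrow> (\<lambda>k. G i (Z k) - X i k) \<longlonglongrightarrow> 0"
      "\<And>i. i \<in> {1..n} \<Longrightarrow> (\<lambda>k. Y i k - W i k) \<longlonglongrightarrow> 0"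
    and bound: "Bseq Z" "\<And>i. i \<in> {1..n} \<Longrightarrow> Bseq (Y i)"
    and lim_mem: "z' \<in> H 0" "\<And>i. i \<in> {1..<n} \<Longrightarrow> w' i \<in> H i" and lim_dual: "w' n = dual w'"
    and weak: "\<And>h. (\<lambda>k. Z k \<bullet> h) \<longlonglongrightarrow> z' \<bullet> h"
      "\<And>i h. i \<in> {1..<n} \<Longrightarrow> (\<lambda>k. W i k \<bullet> h) \<longlonglongrightarrow> w' i \<bullet> h"
    and i: "i \<in> {1..n}"
  shows "w' i \<in> T i (G i z')"
proof -
  have w'_mem: "w' j \<in> H j" if "j \<in> {1..n}" for j
    using that lim_mem lim_dual dual_mem H_n by (cases "j = n") auto
  have weak_X: "(\<lambda>k. X j k \<bullet> h) \<longlonglongrightarrow> G j z' \<bullet> h" if j: "j \<in> {1..n}" and h: "h \<in> H j" for j h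
    by (rule weak_limit_image[OF j mem(1) lim_mem(1) weak(1) gap(1)[OF j]])
  have weak_Y: "(\<lambda>k. Y j k \<bullet> h) \<longlonglongrightarrow> w' j \<bullet> h" if j: "j \<in> {1..n}" and h: "h \<in> H j" for j h
  proof (rule weak_limit_perturbed[OF _ gap(2)[OF j]])
    show "(\<lambda>k. W j k \<bullet> h) \<longlonglongrightarrow> w' j \<bullet> h"
      using weak_limit_dual[OF weak(2)] weak(2) j h H_n by (cases "j = n") (auto simp: dual lim_dual)
  qed
  \<comment> \<open>\<open>X j \<bullet> Y j\<close> differs from \<open>G j Z \<bullet> W j\<close>
    by products of a norm-null and a bounded sequence, and the sum of the latter terms is 0 by the
    constraint. Hence the limit exists although both factors converge only weakly.\<close>
  have XY: "(\<lambda>k. \<Sum>j\<in>{1..n}. X j k \<bullet> Y j k) \<longlonglongrightarrow> 0"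
  proof -
    have "(\<lambda>k. \<Sum>j\<in>{1..n}. G j (Z k) \<bullet> (Y j k - W j k) - (G j (Z k) - X j k) \<bullet> Y j k) \<longlonglongrightarrow> (\<Sum>j\<in>{1..n}. 0 - 0)"
      by (intro tendsto_sum tendsto_diff Bseq_inner_tendsto_0 Bseq_G[OF _ _ mem(1)] gap bound)
    moreover have "(\<Sum>j\<in>{1..n}. G j (Z k) \<bullet> (Y j k - W j k) - (G j (Z k) - X j k) \<bullet> Y j k)
        = (\<Sum>j\<in>{1..n}. X j k \<bullet> Y j k)" for k
    proof -
      have "(\<Sum>j\<in>{1..n}. G j (Z k) \<bullet> (Y j k - W j k) - (G j (Z k) - X j k) \<bullet> Y j k)
        = (\<Sum>j\<in>{1..n}. X j k \<bullet> Y j k - G j (Z k) \<bullet> W j k)"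
        by (intro sum.cong) (auto simp: inner_diff_left inner_diff_right)
      also have "\<dots> = (\<Sum>j\<in>{1..n}. X j k \<bullet> Y j k)"
        using sum_inner_dual_eq_0[of "Z k" "\<lambda>i. W i k"] mem(1) dual by (simp add: sum_subtractf)
      finally show ?thesis .
    qed
    ultimately show ?thesis by simp
  qed
  have key: "0 \<le> (\<Sum>j\<in>{1..n}. (G j z' - a j) \<bullet> (w' j - b j))"
    if ab: "\<And>j. j \<in> {1..n} \<Longrightarrow> a j \<in> H j \<and> b j \<in> T j (a j)" for a b
  proof -
    have b: "b j \<in> H j" if "j \<in> {1..n}" for j using that ab T_mem by blast
    have "(\<lambda>k. (\<Sum>j\<in>{1..n}. X j k \<bullet> Y j k) + (\<Sum>j\<in>{1..n}. a j \<bullet> b j - X j k \<bullet> b j - Y j k \<bullet> a j))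
        \<longlonglongrightarrow> 0 + (\<Sum>j\<in>{1..n}. a j \<bullet> b j - G j z' \<bullet> b j - w' j \<bullet> a j)"
      using ab b by (intro tendsto_add XY tendsto_sum tendsto_diff weak_X weak_Y tendsto_const) auto
    moreover have "(\<Sum>j\<in>{1..n}. X j k \<bullet> Y j k) + (\<Sum>j\<in>{1..n}. a j \<bullet> b j - X j k \<bullet> b j - Y j k \<bullet> a j)
        = (\<Sum>j\<in>{1..n}. (X j k - a j) \<bullet> (Y j k - b j))" for k
      unfolding sum.distrib[symmetric]
      by (intro sum.cong) (auto simp: inner_diff_left inner_diff_right inner_commute)
    moreover have "0 \<le> (\<Sum>j\<in>{1..n}. (X j k - a j) \<bullet> (Y j k - b j))" for k
      using ab graph mem(3) by (intro sum_nonneg monotone_operatorD[OF monotone]) auto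
    ultimately have "0 \<le> (\<Sum>j\<in>{1..n}. a j \<bullet> b j - G j z' \<bullet> b j - w' j \<bullet> a j)"
      by (intro LIMSEQ_le_const[where X = "\<lambda>k. \<Sum>j\<in>{1..n}. (X j k - a j) \<bullet> (Y j k - b j)"]) auto
    \<comment> \<open>The added sum is 0 by the constraint on \<open>w'\<close> and completes the
      product.\<close>
    also have "\<dots> = (\<Sum>j\<in>{1..n}. a j \<bullet> b j - G j z' \<bullet> b j - w' j \<bullet> a j) + (\<Sum>j\<in>{1..n}. G j z' \<bullet> w' j)"
      using sum_inner_dual_eq_0[of z' w'] lim_mem lim_dual by simp
    also have "\<dots> = (\<Sum>j\<in>{1..n}. (G j z' - a j) \<bullet> (w' j - b j))"
      unfolding sum.distrib[symmetric]
      by (intro sum.cong) (auto simp: inner_diff_left inner_diff_right inner_commute)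
    finally show ?thesis .
  qed
  show ?thesis
  proof (rule ccontr)
    assume out: "w' i \<notin> T i (G i z')"
    have "\<exists>a b. a \<in> H j \<and> b \<in> T j a \<and>
        (if w' j \<in> T j (G j z') then a = G j z' \<and> b = w' j else (G j z' - a) \<bullet> (w' j - b) < 0)"
      if j: "j \<in> {1..n}" for j
    proof (cases "w' j \<in> T j (G j z')")
      case True
      then show ?thesis using G_mem[OF j lim_mem(1)] by auto
    next
      case False
      then obtain a b where "a \<in> H j" "b \<in> T j a" "\<not> 0 \<le> (G j z' - a) \<bullet> (w' j - b)"
        using maximality[OF j G_mem[OF j lim_mem(1)] w'_mem[OF j]] by blast
      then show ?thesis using False by (auto simp: not_le)
    qed
    then obtain a b where ab: "\<And>j. j \<in> {1..n} \<Longrightarrow> a j \<in> H j \<and> b j \<in> T j (a j) \<and>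
        (if w' j \<in> T j (G j z') then a j = G j z' \<and> b j = w' j else (G j z' - a j) \<bullet> (w' j - b j) < 0)"
      by metis
    have "(\<Sum>j\<in>{1..n}. (G j z' - a j) \<bullet> (w' j - b j)) < (\<Sum>j\<in>{1..n}. 0)"
    proof (rule sum_strict_mono_ex1)
      show "\<forall>j\<in>{1..n}. (G j z' - a j) \<bullet> (w' j - b j) \<le> 0"
        using ab by (force split: if_splits)
      show "\<exists>j\<in>{1..n}. (G j z' - a j) \<bullet> (w' j - b j) < 0"
        using ab[OF i] i out by auto
    qed simp
    then show False using key[of a b] ab by simp
  qed
qed

text \<open>The two sides differ by the sum of \<open>G i (z k) \<bullet> w i k\<close>, which
  vanishes. In this form \<phi> can be compared block by block with its values at delayed
  points.\<close>

lemma sep_phi_eq: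
  assumes "z k \<in> H 0" "x n k \<in> H 0" "w n k = dual (\<lambda>i. w i k)"
  shows "sep_phi n H G x y z w k = (\<Sum>i\<in>{1..n}. (G i (z k) - x i k) \<bullet> (y i k - w i k))"
proof -
  have 1: "z k \<bullet> coupling_v n H G y k = (\<Sum>i\<in>{1..n}. G i (z k) \<bullet> y i k)"
    using assms(1) by (simp add: coupling_v_def inner_add_right inner_sum_right adjoint_inner sum_blocks G_n)
  have 2: "(\<Sum>i\<in>{1..<n}. w i k \<bullet> coupling_u n G x i k) = (\<Sum>i\<in>{1..n}. x i k \<bullet> w i k)"
    using assms(2,3)
    by (simp add: coupling_u_def inner_diff_right sum_subtractf sum_blocks inner_dual) (simp add: inner_commute)
  have "(\<Sum>i\<in>{1..n}. (G i (z k) - x i k) \<bullet> (y i k - w i k))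
      = (\<Sum>i\<in>{1..n}. G i (z k) \<bullet> y i k) + (\<Sum>i\<in>{1..n}. x i k \<bullet> w i k) - (\<Sum>i\<in>{1..n}. x i k \<bullet> y i k)
        - (\<Sum>i\<in>{1..n}. G i (z k) \<bullet> w i k)"
    by (simp add: inner_diff_left inner_diff_right sum.distrib sum_subtractf)
  also have "(\<Sum>i\<in>{1..n}. G i (z k) \<bullet> w i k) = 0"
    using assms(1,3) by (rule sum_inner_dual_eq_0)
  finally show ?thesis by (simp add: sep_phi_def 1 2)
qed

end


section \<open>The algorithm\<close>

text \<open>Infimum and supremum of the stepsizes are replaced by real constants. The recursions are
  assumed for executed iterations only, since the sequences are unconstrained after a
  return.\<close>

locale projective_splitting = splitting_problem n H G T IF IB
  for n and H :: "nat \<Rightarrow> 'a::real_inner set" and G T IF IB +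
  fixes I :: "nat \<Rightarrow> nat set" and \<beta>lo \<beta>hi \<gamma> \<nu> \<Delta> \<sigma> \<rho>lo \<rho>hi :: real and \<beta> :: "nat \<Rightarrow> real"
    and \<rho> :: "nat \<Rightarrow> nat \<Rightarrow> real" and d :: "nat \<Rightarrow> nat \<Rightarrow> nat" and M D :: nat
    and e x y w :: "nat \<Rightarrow> nat \<Rightarrow> 'a" and z :: "nat \<Rightarrow> 'a"
  assumes solvable: "extended_solution_set n H G T \<noteq> {}"
    and beta: "0 < \<beta>lo" "\<beta>hi < 2" "\<And>k. 1 \<le> k \<Longrightarrow> \<beta>lo \<le> \<beta> k \<and> \<beta> k \<le> \<beta>hi"
    and gamma: "0 < \<gamma>"
    and linesearch: "0 < \<nu>" "\<nu> < 1" "0 < \<Delta>"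
    and blocks: "\<And>k. 1 \<le> k \<Longrightarrow> I k \<subseteq> {1..n}"
    and rho: "0 < \<rho>lo" "\<And>i k. i \<in> {1..n} \<Longrightarrow> 1 \<le> k \<Longrightarrow> \<rho>lo \<le> \<rho> i k \<and> \<rho> i k \<le> \<rho>hi"
    and delay: "\<And>i k. i \<in> {1..n} \<Longrightarrow> 1 \<le> k \<Longrightarrow> 1 \<le> d i k \<and> d i k \<le> k"
    and A1: "1 \<le> M" "\<And>j. 1 \<le> j \<Longrightarrow> (\<Union>k\<in>{j..j + M - 1}. I k) = {1..n}"
    and A2: "\<And>i k. 1 \<le> k \<Longrightarrow> i \<in> I k \<Longrightarrow> k - d i k \<le> D"
    and E_bounded: "\<And>i. i \<in> IB \<Longrightarrow> bdd_above ((\<lambda>k. norm (e i k)) ` {1..})"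
    and E_sigma: "\<sigma> < 1"
    and E: "\<And>i k. i \<in> IB \<Longrightarrow> 1 \<le> k \<Longrightarrow> 1 \<le> last_update I i k \<Longrightarrow>
        (\<forall>j\<in>{1..k}. \<not> returns_at n H G \<gamma> I x y j) \<Longrightarrow>
        - \<sigma> * (norm (G i (z (last_delayed I d i k)) - x i k))\<^sup>2
          \<le> (G i (z (last_delayed I d i k)) - x i k) \<bullet> e i (last_update I i k) \<and>
        e i (last_update I i k) \<bullet> (y i k - w i (last_delayed I d i k))
          \<le> \<rho> i (last_delayed I d i k) * \<sigma> * (norm (y i k - w i (last_delayed I d i k)))\<^sup>2"
    and start: "z 1 \<in> H 0" "\<And>i. i \<in> {1..<n} \<Longrightarrow> w i 1 \<in> H i"
      "\<And>i. i \<in> {1..n} \<Longrightarrow> x i 0 \<in> H i \<and> y i 0 \<in> H i"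
    and w_n: "\<And>k. executed n H G \<gamma> I x y k \<Longrightarrow> w n k = dual (\<lambda>i. w i k)"
    and backward: "\<And>i k. executed n H G \<gamma> I x y k \<Longrightarrow> i \<in> I k \<Longrightarrow> i \<in> IB \<Longrightarrow>
        backward_step (H i) (T i) (\<rho> i (d i k)) (G i (z (d i k))) (w i (d i k)) (e i k) (x i k) (y i k)"
    and forward: "\<And>i k. executed n H G \<gamma> I x y k \<Longrightarrow> i \<in> I k \<Longrightarrow> i \<in> IF \<Longrightarrow>
        forward_step \<nu> \<Delta> (T i) (\<rho> i (d i k)) (G i (z (d i k))) (w i (d i k)) (x i k) (y i k)"
    and idle: "\<And>i k. executed n H G \<gamma> I x y k \<Longrightarrow> i \<in> {1..n} \<Longrightarrow> i \<notin> I k \<Longrightarrow>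
        x i k = x i (k - 1) \<and> y i k = y i (k - 1)"
    and return: "\<And>k. executed n H G \<gamma> I x y k \<Longrightarrow> returns_at n H G \<gamma> I x y k \<Longrightarrow>
        z (k + 1) = x n k \<and> (\<forall>i\<in>{1..<n}. w i (k + 1) = y i k)"
    and update: "\<And>k. executed n H G \<gamma> I x y k \<Longrightarrow> \<not> returns_at n H G \<gamma> I x y k \<Longrightarrow>
        z (k + 1) = z k - (inverse \<gamma> * step_length n H G \<gamma> \<beta> x y z w k) *\<^sub>R coupling_v n H G y k \<and>
        (\<forall>i\<in>{1..<n}. w i (k + 1) = w i k - step_length n H G \<gamma> \<beta> x y z w k *\<^sub>R coupling_u n G x i k)"
begin

abbreviation exec :: "nat \<Rightarrow> bool" where "exec \<equiv> executed n H G \<gamma> I x y"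

abbreviation ret :: "nat \<Rightarrow> bool" where "ret \<equiv> returns_at n H G \<gamma> I x y"

abbreviation \<alpha> :: "nat \<Rightarrow> real" where "\<alpha> \<equiv> step_length n H G \<gamma> \<beta> x y z w"

abbreviation \<pi> :: "nat \<Rightarrow> real" where "\<pi> \<equiv> sep_pi n H G \<gamma> x y"

abbreviation \<phi> :: "nat \<Rightarrow> real" where "\<phi> \<equiv> sep_phi n H G x y z w"

lemma exec_Suc: "exec (Suc k) \<longleftrightarrow> k = 0 \<or> exec k \<and> \<not> ret k"
  by (auto simp: executed_def less_Suc_eq)

lemma trial_step:
  assumes k: "exec k" and i: "i \<in> {1..n}" "i \<in> I k"
    and mem: "z (d i k) \<in> H 0" "w i (d i k) \<in> H i"
  shows "x i k \<in> H i \<and> y i k \<in> T i (x i k)"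
proof -
  have "1 \<le> k" using k by (simp add: executed_def)
  then have r: "0 < \<rho> i (d i k)" using rho(1) rho(2)[of i "d i k"] delay[of i k] i by force
  show ?thesis
  proof (cases "i \<in> IB")
    case True
    then show ?thesis using backward_stepD(1,2)[OF backward[OF k i(2)] r] by blast
  next
    case False
    then have F: "i \<in> IF" using partition i by blast
    have "i \<le> n" using i by simp
    from forward_stepD(1,2)[OF subspace_H[OF this] set_operator[OF i(1)] _ linesearch r G_mem[OF i(1) mem(1)]
        mem(2) forward[OF k i(2) F]] IF[OF F]
    show ?thesis by blast
  qed
qed

lemma coupling_mem:
  assumes "\<And>i. i \<in> {1..n} \<Longrightarrow> x i k \<in> H i \<and> y i k \<in> H i"
  shows "coupling_v n H G y k \<in> H 0" "\<And>i. i \<in> {1..<n} \<Longrightarrow> coupling_u n G x i k \<in> H i"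
proof -
  have "x n k \<in> H 0" "y n k \<in> H 0" using assms[of n] n H_n by auto
  then show "coupling_v n H G y k \<in> H 0" "\<And>i. i \<in> {1..<n} \<Longrightarrow> coupling_u n G x i k \<in> H i"
    using assms unfolding coupling_v_def coupling_u_def
    by (auto intro!: subspace_add subspace_sum subspace_diff subspace_H adjoint_mem G_mem)
qed

text \<open>All earlier indices are included because a delay may reach back to any of them. It may
  also be 0, so in the inductive step \<open>z\<close> and \<open>w\<close> at \<open>Suc k\<close>
  precede \<open>x\<close> and \<open>y\<close>.\<close>

lemma iterates_mem:
  "exec k \<Longrightarrow> (\<forall>j\<in>{1..k}. z j \<in> H 0 \<and> (\<forall>i\<in>{1..n}. w i j \<in> H i)) \<and>
    (\<forall>j\<le>k. \<forall>i\<in>{1..n}. x i j \<in> H i \<and> y i j \<in> H i)"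
proof (induction k)
  case 0
  then show ?case by (simp add: executed_def)
next
  case (Suc k)
  have old: "(\<forall>j\<in>{1..k}. z j \<in> H 0 \<and> (\<forall>i\<in>{1..n}. w i j \<in> H i)) \<and>
    (\<forall>j\<le>k. \<forall>i\<in>{1..n}. x i j \<in> H i \<and> y i j \<in> H i)"
    using Suc start(3) by (cases "k = 0") (auto simp: exec_Suc)
  have new: "z (Suc k) \<in> H 0 \<and> (\<forall>i\<in>{1..<n}. w i (Suc k) \<in> H i)"
  proof (cases "k = 0")
    case True
    then show ?thesis using start by (simp add: One_nat_def)
  next
    case False
    then have k: "exec k" "\<not> ret k" "k \<in> {1..k}" using Suc.prems by (auto simp: exec_Suc)
    have "coupling_v n H G y k \<in> H 0" "\<And>i. i \<in> {1..<n} \<Longrightarrow> coupling_u n G x i k \<in> H i"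
      using coupling_mem[of k] old by auto
    then show ?thesis
      using update[OF k(1,2)] old k(3)
      by (auto simp: Suc_eq_plus1 intro!: subspace_diff subspace_scale subspace_H)
  qed
  moreover have "w n (Suc k) \<in> H n" using w_n[OF Suc.prems] dual_mem H_n by simp
  ultimately have "w i (Suc k) \<in> H i" if "i \<in> {1..n}" for i
    using that by (cases "i = n") auto
  with new old have pts: "\<forall>j\<in>{1..Suc k}. z j \<in> H 0 \<and> (\<forall>i\<in>{1..n}. w i j \<in> H i)"
    by (auto simp: le_Suc_eq)
  have "x i (Suc k) \<in> H i \<and> y i (Suc k) \<in> H i" if i: "i \<in> {1..n}" for i
  proof (cases "i \<in> I (Suc k)")
    case True
    have "d i (Suc k) \<in> {1..Suc k}" using delay[OF i, of "Suc k"] by simp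
    then have "x i (Suc k) \<in> H i \<and> y i (Suc k) \<in> T i (x i (Suc k))"
      using trial_step[OF Suc.prems i True] pts i by blast
    then show ?thesis using T_mem[OF i] by blast
  next
    case False
    then show ?thesis using idle[OF Suc.prems i False] old i by simp
  qed
  with pts old show ?case by (auto simp: le_Suc_eq)
qed

lemma frozen_iterates:
  assumes i: "i \<in> {1..n}"
  shows "exec k \<Longrightarrow> x i k = x i (last_update I i k) \<and> y i k = y i (last_update I i k)"
proof (induction k)
  case (Suc k)
  show ?case
  proof (cases "i \<in> I (Suc k)")
    case False
    then show ?thesis using idle[OF Suc.prems i False] Suc
      by (cases "k = 0") (auto simp: last_update_Suc exec_Suc)
  qed (simp add: last_update_Suc)
qed (simp add: executed_def)

lemma exec_mono: "exec k \<Longrightarrow> 1 \<le> j \<Longrightarrow> j \<le> k \<Longrightarrow> exec j"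
  by (auto simp: executed_def)

text \<open>The initial pairs are arbitrary, so an update of block \<open>i\<close> must have
  occurred; the pair then remains the one produced by the latest update.\<close>

lemma iterates_graph:
  assumes k: "exec k" and i: "i \<in> {1..n}" and s: "1 \<le> last_update I i k"
  shows "y i k \<in> T i (x i k)"
proof -
  define s where "s = last_update I i k"
  have s': "exec s" "1 \<le> s" using exec_mono[OF k s last_update_le] s by (simp_all add: s_def)
  have "d i s \<in> {1..s}" using delay[OF i s'(2)] by simp
  then have "y i s \<in> T i (x i s)"
    using trial_step[OF s'(1) i] last_update_mem[OF s] iterates_mem[OF s'(1)] i unfolding s_def by blast
  then show ?thesis using frozen_iterates[OF i k] by (simp add: s_def)
qed

text \<open>\<open>\<pi> k = 0\<close> forces \<open>x i k = G i (x n k)\<close> and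
  \<open>y n k\<close> to be the dual of the other \<open>y i k\<close>. As every block has been
  updated, these are graph points, so they form a solution.\<close>

lemma termination_solves:
  assumes k: "exec k" "ret k"
  shows "(z (k + 1), \<lambda>i\<in>{1..<n}. w i (k + 1)) \<in> extended_solution_set n H G T"
proof -
  have mem: "x i k \<in> H i" if "i \<in> {1..n}" for i using iterates_mem[OF k(1)] that by blast
  have xn: "x n k \<in> H 0" using mem[of n] n H_n by simp
  have "\<pi> k = 0" and all: "(\<Union>j\<in>{1..k}. I j) = {1..n}" using k(2) by (auto simp: returns_at_def)
  moreover have "0 \<le> (\<Sum>i\<in>{1..<n}. (norm (coupling_u n G x i k))\<^sup>2)" "0 \<le> inverse \<gamma> * (norm (coupling_v n H G y k))\<^sup>2"
    using gamma by (auto intro: sum_nonneg)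
  ultimately have "(\<Sum>i\<in>{1..<n}. (norm (coupling_u n G x i k))\<^sup>2) = 0 \<and> inverse \<gamma> * (norm (coupling_v n H G y k))\<^sup>2 = 0"
    unfolding sep_pi_def by linarith
  then have uv: "\<And>i. i \<in> {1..<n} \<Longrightarrow> coupling_u n G x i k = 0" "coupling_v n H G y k = 0"
    using gamma by (auto simp: sum_nonneg_eq_0_iff)
  have x: "G i (x n k) = x i k" if "i \<in> {1..n}" for i
    using uv(1)[of i] that G_n[OF xn] by (cases "i = n") (auto simp: coupling_u_def)
  have "y n k = dual (\<lambda>i. y i k)"
    using minus_unique[OF uv(2)[unfolded coupling_v_def]] by (simp add: dual_def)
  moreover have "y i k \<in> T i (G i (x n k))" if i: "i \<in> {1..n}" for i
  proof -
    have "i \<in> (\<Union>j\<in>{1..k}. I j)" using all i by (simp only:)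
    then obtain j where "1 \<le> j" "j \<le> k" "i \<in> I j" by auto
    then have "1 \<le> last_update I i k" using last_update_ge order_trans by blast
    then show ?thesis using iterates_graph[OF k(1) i] x[OF i] by simp
  qed
  ultimately have "(x n k, \<lambda>i\<in>{1..<n}. y i k) \<in> extended_solution_set n H G T"
    using extended_solutionI[of "x n k" "\<lambda>i. y i k"] xn by blast
  moreover have "(\<lambda>i\<in>{1..<n}. w i (k + 1)) = (\<lambda>i\<in>{1..<n}. y i k)"
    using return[OF k] by (intro restrict_ext) auto
  ultimately show ?thesis using return[OF k] by simp
qed

end

locale nonterminating_projective_splitting = projective_splitting +
  assumes nonterminating: "\<And>k. 1 \<le> k \<Longrightarrow> \<not> ret k"
begin

abbreviation l :: "nat \<Rightarrow> nat \<Rightarrow> nat" where "l \<equiv> last_delayed I d"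

lemma executes: "1 \<le> k \<Longrightarrow> exec k"
  using nonterminating by (simp add: executed_def)

lemma z_mem: "1 \<le> k \<Longrightarrow> z k \<in> H 0"
  and w_mem: "1 \<le> k \<Longrightarrow> i \<in> {1..n} \<Longrightarrow> w i k \<in> H i"
  and x_mem: "1 \<le> k \<Longrightarrow> i \<in> {1..n} \<Longrightarrow> x i k \<in> H i"
  and y_mem: "1 \<le> k \<Longrightarrow> i \<in> {1..n} \<Longrightarrow> y i k \<in> H i"
  using iterates_mem[OF executes[of k]] by auto

lemma w_dual: "1 \<le> k \<Longrightarrow> w n k = dual (\<lambda>i. w i k)"
  by (rule w_n[OF executes])

text \<open>The \<open>M\<close> iterations ending at \<open>k\<close> update every block;
  \<open>M \<le> k\<close> makes their first index \<open>k + 1 - M\<close> at least 1.\<close>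

lemma window:
  assumes "M \<le> k" "i \<in> {1..n}"
  shows "1 \<le> last_update I i k" "k < last_update I i k + M"
proof -
  have "i \<in> (\<Union>j\<in>{k + 1 - M..k + 1 - M + M - 1}. I j)"
    using A1(2)[of "k + 1 - M"] assms by simp
  then obtain j where j: "k + 1 - M \<le> j" "j \<le> k" "i \<in> I j"
    using assms(1) by auto
  then have "1 \<le> j" "k < j + M" using assms(1) by auto
  then show "1 \<le> last_update I i k" "k < last_update I i k + M"
    using last_update_ge[of j k i I] j by auto
qed

text \<open>The pair is at most \<open>M - 1\<close> iterations old and its data at most
  \<open>D\<close> older; \<open>M + D\<close> is a rounded bound.\<close>

lemma window_delay:
  assumes k: "M \<le> k" and i: "i \<in> {1..n}"
  shows "l i k = d i (last_update I i k)" "1 \<le> l i k" "l i k \<le> k" "k \<le> l i k + (M + D)"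
proof -
  define s where "s = last_update I i k"
  have s: "1 \<le> s" "k < s + M" "s \<le> k" "i \<in> I s"
    using window[OF k i] last_update_le[of I i k] last_update_mem[of I i k] by (auto simp: s_def)
  then show l: "l i k = d i (last_update I i k)" by (simp add: last_delayed_def s_def)
  have "1 \<le> d i s" "d i s \<le> s" "s - d i s \<le> D" using delay[OF i s(1)] A2[OF s(1,4)] by auto
  then show "1 \<le> l i k" "l i k \<le> k" "k \<le> l i k + (M + D)"
    using s unfolding l by (auto simp: s_def)
qed

lemma graph:
  assumes "M \<le> k" "i \<in> {1..n}"
  shows "y i k \<in> T i (x i k)"
  using iterates_graph[OF executes assms(2) window(1)[OF assms]] assms A1(1) by simp

text \<open>From iteration \<open>M\<close> on every block has been updated, so
  \<open>\<pi> k = 0\<close> would trigger the return.\<close>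

lemma pi_pos:
  assumes k: "M \<le> k"
  shows "0 < \<pi> k"
proof -
  have k1: "1 \<le> k" using k A1(1) by simp
  have "{1..n} \<subseteq> (\<Union>j\<in>{1..k}. I j)"
  proof
    fix i assume i: "i \<in> {1..n}"
    show "i \<in> (\<Union>j\<in>{1..k}. I j)"
      using window(1)[OF k i] last_update_le[of I i k] last_update_mem[of I i k] by auto
  qed
  moreover have "(\<Union>j\<in>{1..k}. I j) \<subseteq> {1..n}" using blocks by fastforce
  ultimately have "\<pi> k \<noteq> 0" using nonterminating[OF k1] by (auto simp: returns_at_def)
  moreover have "0 \<le> \<pi> k"
    using gamma unfolding sep_pi_def by (auto intro!: add_nonneg_nonneg sum_nonneg)
  ultimately show ?thesis by simp
qed

text \<open>\<open>\<alpha> k\<close> vanishes unless \<open>\<phi> k\<close> is positive, so \<phi>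
  and its positive part agree when multiplied by \<alpha>.\<close>

lemma alpha_phi:
  assumes k: "M \<le> k"
  shows "0 \<le> \<alpha> k" "\<beta> k * (\<alpha> k * \<phi> k) = (\<alpha> k)\<^sup>2 * \<pi> k" "\<alpha> k * \<pi> k = \<beta> k * max 0 (\<phi> k)"
proof -
  have k1: "1 \<le> k" using k A1(1) by simp
  have b: "0 < \<beta> k" using beta(1) beta(3)[OF k1] by simp
  have a: "\<alpha> k = \<beta> k / \<pi> k * max 0 (\<phi> k)" using pi_pos[OF k] by (simp add: step_length_def)
  show "0 \<le> \<alpha> k" using b pi_pos[OF k] by (simp add: a)
  show ap: "\<alpha> k * \<pi> k = \<beta> k * max 0 (\<phi> k)" using pi_pos[OF k] by (simp add: a)
  have "\<alpha> k * \<phi> k = \<alpha> k * max 0 (\<phi> k)" by (simp add: a max_def)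
  then have "\<beta> k * (\<alpha> k * \<phi> k) = \<alpha> k * (\<beta> k * max 0 (\<phi> k))" by (simp add: mult_ac)
  then show "\<beta> k * (\<alpha> k * \<phi> k) = (\<alpha> k)\<^sup>2 * \<pi> k" by (simp add: ap[symmetric] power2_eq_square)
qed

lemma z_Suc: "1 \<le> k \<Longrightarrow> z (Suc k) = z k - (inverse \<gamma> * \<alpha> k) *\<^sub>R coupling_v n H G y k"
  and w_Suc: "1 \<le> k \<Longrightarrow> i \<in> {1..<n} \<Longrightarrow> w i (Suc k) = w i k - \<alpha> k *\<^sub>R coupling_u n G x i k"
  using update[OF executes nonterminating] by (auto simp: Suc_eq_plus1)

section \<open>Fejer monotonicity and its consequences\<close>

text \<open>In the inner product with weight \<gamma> on \<open>z\<close>, the gradient of \<phi> is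
  \<open>(v / \<gamma>, u)\<close>, and \<open>\<pi> k\<close> is its squared norm. The update is a
  step along this gradient.\<close>

definition energy :: "'a \<Rightarrow> (nat \<Rightarrow> 'a) \<Rightarrow> nat \<Rightarrow> real" where
  "energy zs ws k = \<gamma> * (norm (z k - zs))\<^sup>2 + (\<Sum>i\<in>{1..<n}. (norm (w i k - ws i))\<^sup>2)"

text \<open>
  Every solution lies in the half-space where the affine function behind \<open>\<phi> k\<close> is nonpositive, and
  the iteration is a relaxed projection onto that half-space in the norm weighted by \<open>\<gamma>\<close>.
\<close>

lemma energy_step:
  assumes sol: "(zs, ws) \<in> extended_solution_set n H G T" and k: "M \<le> k"
  shows "energy zs ws (Suc k) + (2 / \<beta>hi - 1) * ((\<alpha> k)\<^sup>2 * \<pi> k) \<le> energy zs ws k"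
proof -
  have k1: "1 \<le> k" using k A1(1) by simp
  define v u where "v = coupling_v n H G y k" and "u = (\<lambda>i. coupling_u n G x i k)"
  define ws' where "ws' = ws(n := dual ws)"
  have ws': "ws' n = dual ws'" "\<And>i. i \<in> {1..<n} \<Longrightarrow> ws' i = ws i"
    using dual_cong[of ws' ws] by (auto simp: ws'_def)
  \<comment> \<open>The same affine function at the solution, obtained from constant sequences; the
    prepared \<open>ws'\<close> satisfies the constraint at \<open>n\<close>.\<close>
  define \<phi>s where "\<phi>s = sep_phi n H G x y (\<lambda>_. zs) (\<lambda>i _. ws' i) k"
  have xn: "x n k \<in> H 0" using x_mem[OF k1, of n] n H_n by simp
  have "\<phi>s = (\<Sum>i\<in>{1..n}. (G i zs - x i k) \<bullet> (y i k - ws' i))"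
    unfolding \<phi>s_def using extended_solutionD(1)[OF sol] xn ws'(1) by (intro sep_phi_eq) auto
  also have "\<dots> = - (\<Sum>i\<in>{1..n}. (x i k - G i zs) \<bullet> (y i k - ws' i))"
    by (simp add: inner_diff_left sum_subtractf)
  also have "\<dots> \<le> 0"
    unfolding neg_le_0_iff_le
  proof (rule sum_nonneg)
    fix i assume i: "i \<in> {1..n}"
    show "0 \<le> (x i k - G i zs) \<bullet> (y i k - ws' i)"
      using monotone_operatorD[OF monotone[OF i] x_mem[OF k1 i] graph[OF k i]]
        G_mem[OF i extended_solutionD(1)[OF sol]] extended_solutionD(2)[OF sol i]
      by (simp add: ws'_def)
  qed
  finally have \<phi>s: "\<phi>s \<le> 0" .
  \<comment> \<open>The linear part of \<phi> at the difference of iterate and solution, which is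
    also the first-order term in the expansion of the energy.\<close>
  define \<delta> where "\<delta> = (z k - zs) \<bullet> v + (\<Sum>i\<in>{1..<n}. (w i k - ws i) \<bullet> u i)"
  have "\<phi> k - \<phi>s = \<delta>"
    using ws'(2) by (simp add: sep_phi_def \<phi>s_def \<delta>_def v_def u_def inner_diff_left sum_subtractf)
  with \<phi>s have "\<alpha> k * \<phi> k \<le> \<alpha> k * \<delta>" using alpha_phi(1)[OF k] by (intro mult_left_mono) auto
  define A where "A = (\<alpha> k)\<^sup>2 * \<pi> k"
  have "\<gamma> * (norm (z (Suc k) - zs))\<^sup>2 =
      \<gamma> * (norm (z k - zs))\<^sup>2 - 2 * \<alpha> k * ((z k - zs) \<bullet> v) + (\<alpha> k)\<^sup>2 * (inverse \<gamma> * (norm v)\<^sup>2)"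
  proof -
    have "z (Suc k) - zs = (z k - zs) - (inverse \<gamma> * \<alpha> k) *\<^sub>R v"
      by (simp add: z_Suc[OF k1] v_def)
    then show ?thesis
      using gamma by (simp only: norm_diff_scaleR_squared) (simp add: field_simps power2_eq_square)
  qed
  moreover have "(\<Sum>i\<in>{1..<n}. (norm (w i (Suc k) - ws i))\<^sup>2) =
      (\<Sum>i\<in>{1..<n}. (norm (w i k - ws i))\<^sup>2) - 2 * \<alpha> k * (\<Sum>i\<in>{1..<n}. (w i k - ws i) \<bullet> u i)
      + (\<alpha> k)\<^sup>2 * (\<Sum>i\<in>{1..<n}. (norm (u i))\<^sup>2)"
  proof -
    have "(norm (w i (Suc k) - ws i))\<^sup>2 = (norm (w i k - ws i))\<^sup>2 - 2 * \<alpha> k * ((w i k - ws i) \<bullet> u i)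
        + (\<alpha> k)\<^sup>2 * (norm (u i))\<^sup>2" if i: "i \<in> {1..<n}" for i
    proof -
      have "w i (Suc k) - ws i = (w i k - ws i) - \<alpha> k *\<^sub>R u i"
        by (simp add: w_Suc[OF k1 i] u_def)
      then show ?thesis by (simp only: norm_diff_scaleR_squared)
    qed
    then show ?thesis by (simp add: sum.distrib sum_subtractf sum_distrib_left)
  qed
  ultimately have "energy zs ws (Suc k) = energy zs ws k - 2 * (\<alpha> k * \<delta>) + A"
    by (simp add: energy_def \<delta>_def A_def sep_pi_def u_def v_def algebra_simps)
  also have "\<dots> \<le> energy zs ws k - 2 * (\<alpha> k * \<phi> k) + A"
    using \<open>\<alpha> k * \<phi> k \<le> \<alpha> k * \<delta>\<close> by simp
  finally have main: "energy zs ws (Suc k) \<le> energy zs ws k - 2 * (\<alpha> k * \<phi> k) + A" .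
  have b: "0 < \<beta> k" "\<beta> k \<le> \<beta>hi" using beta(1) beta(3)[OF k1] by auto
  have "0 \<le> A" using pi_pos[OF k] by (simp add: A_def)
  \<comment> \<open>Since \<open>\<alpha> k * \<phi> k = A / \<beta> k\<close>, the net decrease is
    at least \<open>(2 / \<beta> k - 1) * A\<close>; the upper bound on \<beta> makes the factor
    uniform.\<close>
  have "A / \<beta>hi \<le> A / \<beta> k" using b \<open>0 \<le> A\<close> by (intro divide_left_mono) auto
  also have "\<dots> = \<alpha> k * \<phi> k" using alpha_phi(2)[OF k] b by (simp add: A_def field_simps)
  finally have "2 * (A / \<beta>hi) \<le> 2 * (\<alpha> k * \<phi> k)" by simp
  then show ?thesis
    using main by (simp add: A_def[symmetric] left_diff_distrib)
qed

lemma relaxation_pos: "0 < 2 / \<beta>hi - 1"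
  using beta(1,2) beta(3)[of 1] by simp

lemma energy_nonneg: "0 \<le> energy zs ws k"
  using gamma by (auto simp: energy_def intro!: add_nonneg_nonneg sum_nonneg)

lemma residual_nonneg: "M \<le> k \<Longrightarrow> 0 \<le> (\<alpha> k)\<^sup>2 * \<pi> k"
  using pi_pos[of k] by simp

lemma energy_convergent:
  assumes sol: "(zs, ws) \<in> extended_solution_set n H G T"
  shows "convergent (\<lambda>k. energy zs ws (k + M))"
proof -
  have "decseq (\<lambda>k. energy zs ws (k + M))"
  proof (rule decseq_SucI)
    fix k
    have "0 \<le> (2 / \<beta>hi - 1) * ((\<alpha> (k + M))\<^sup>2 * \<pi> (k + M))"
      by (rule mult_nonneg_nonneg[OF less_imp_le[OF relaxation_pos] residual_nonneg]) simp
    then show "energy zs ws (Suc k + M) \<le> energy zs ws (k + M)"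
      using energy_step[OF sol, of "k + M"] by simp
  qed
  then show ?thesis
    using decseq_convergent[of "\<lambda>k. energy zs ws (k + M)" 0] energy_nonneg by (metis convergentI)
qed

text \<open>Consecutive decreases of a convergent energy tend to 0 and dominate a fixed positive
  multiple of the residual.\<close>

lemma residual_tendsto_0: "(\<lambda>k. (\<alpha> k)\<^sup>2 * \<pi> k) \<longlonglongrightarrow> 0"
proof -
  obtain zs ws where sol: "(zs, ws) \<in> extended_solution_set n H G T" using solvable by fast
  define c where "c = 2 / \<beta>hi - 1"
  define E where "E = (\<lambda>k. energy zs ws (k + M))"
  obtain L where L: "E \<longlonglongrightarrow> L" using energy_convergent[OF sol] by (auto simp: convergent_def E_def)
  have lim: "(\<lambda>k. (E k - E (Suc k)) / c) \<longlonglongrightarrow> 0"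
    using tendsto_divide_zero[OF tendsto_diff[OF L LIMSEQ_Suc[OF L], simplified], of c] by simp
  have "norm ((\<alpha> (k + M))\<^sup>2 * \<pi> (k + M)) \<le> (E k - E (Suc k)) / c" for k
    using energy_step[OF sol, of "k + M"] residual_nonneg[of "k + M"] relaxation_pos
    by (simp add: E_def c_def[symmetric] pos_le_divide_eq mult.commute)
  then have "(\<lambda>k. (\<alpha> (k + M))\<^sup>2 * \<pi> (k + M)) \<longlonglongrightarrow> 0"
    by (intro Lim_null_comparison[OF always_eventually lim]) blast
  then show ?thesis by (rule LIMSEQ_offset)
qed

text \<open>The squared step is \<open>inverse \<gamma>\<close> times the share of the residual that
  stems from \<open>v\<close>.\<close>

lemma z_step: "(\<lambda>k. z (Suc k) - z k) \<longlonglongrightarrow> 0"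
proof (rule tendsto_0_of_norm_squared_le[OF _ residual_tendsto_0])
  fix k assume k: "M \<le> k"
  then have k1: "1 \<le> k" using A1(1) by simp
  have "(norm (z (Suc k) - z k))\<^sup>2 = inverse \<gamma> * ((\<alpha> k)\<^sup>2 * (inverse \<gamma> * (norm (coupling_v n H G y k))\<^sup>2))"
    by (simp add: z_Suc[OF k1] power_mult_distrib) (simp add: power2_eq_square)
  also have "\<dots> \<le> inverse \<gamma> * ((\<alpha> k)\<^sup>2 * \<pi> k)"
    using gamma by (intro mult_left_mono) (auto simp: sep_pi_def intro: sum_nonneg)
  finally show "(norm (z (Suc k) - z k))\<^sup>2 \<le> inverse \<gamma> * ((\<alpha> k)\<^sup>2 * \<pi> k)" .
qed

lemma w_step:
  assumes "i \<in> {1..n}"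
  shows "(\<lambda>k. w i (Suc k) - w i k) \<longlonglongrightarrow> 0"
proof -
  have primal: "(\<lambda>k. w i (Suc k) - w i k) \<longlonglongrightarrow> 0" if i: "i \<in> {1..<n}" for i
  proof (rule tendsto_0_of_norm_squared_le[OF _ residual_tendsto_0])
    fix k assume k: "M \<le> k"
    then have k1: "1 \<le> k" using A1(1) by simp
    have "(norm (coupling_u n G x i k))\<^sup>2 \<le> (\<Sum>i\<in>{1..<n}. (norm (coupling_u n G x i k))\<^sup>2)"
      using i by (intro member_le_sum) auto
    also have "\<dots> \<le> \<pi> k" using gamma by (simp add: sep_pi_def)
    finally have "(\<alpha> k)\<^sup>2 * (norm (coupling_u n G x i k))\<^sup>2 \<le> (\<alpha> k)\<^sup>2 * \<pi> k" by (rule mult_left_mono) simp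
    then show "(norm (w i (Suc k) - w i k))\<^sup>2 \<le> 1 * ((\<alpha> k)\<^sup>2 * \<pi> k)"
      by (simp add: w_Suc[OF k1 i] power_mult_distrib)
  qed
  show ?thesis
  proof (cases "i = n")
    case True
    have lim: "(\<lambda>k. dual (\<lambda>i. w i (Suc k)) - dual (\<lambda>i. w i k)) \<longlonglongrightarrow> 0"
      by (rule dual_diff_tendsto_0) (rule primal)
    have "dual (\<lambda>i. w i (Suc k)) - dual (\<lambda>i. w i k) = w n (Suc k) - w n k" if "1 \<le> k" for k
      using that by (simp add: w_dual)
    then have "(\<lambda>k. w n (Suc k) - w n k) \<longlonglongrightarrow> 0"
      by (rule Lim_transform_eventually[OF lim eventually_sequentiallyI])
    then show ?thesis using True by simp
  qed (use assms primal in auto)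
qed

lemma z_delay: "i \<in> {1..n} \<Longrightarrow> (\<lambda>k. z k - z (l i k)) \<longlonglongrightarrow> 0"
  using window_delay by (intro delayed_difference_tendsto_0[OF z_step]) blast

lemma w_delay: "i \<in> {1..n} \<Longrightarrow> (\<lambda>k. w i k - w i (l i k)) \<longlonglongrightarrow> 0"
  using window_delay by (intro delayed_difference_tendsto_0[OF w_step]) blast+

section \<open>Boundedness of the iterates and the limit of the separator\<close>

lemma Bseq_z: "Bseq z" and Bseq_w_primal: "i \<in> {1..<n} \<Longrightarrow> Bseq (w i)"
proof -
  obtain zs ws where sol: "(zs, ws) \<in> extended_solution_set n H G T" using solvable by fast
  obtain K where K: "\<And>k. energy zs ws (k + M) \<le> K"
    using convergent_imp_Bseq[OF energy_convergent[OF sol]] unfolding Bseq_def real_norm_def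
    by (meson abs_le_iff)
  have near: "norm (X (k + M)) \<le> norm a + sqrt (1 / c * K)"
    if "c * (norm (X (k + M) - a))\<^sup>2 \<le> energy zs ws (k + M)" "0 < c" for X a k and c :: real
  proof -
    have "(norm (X (k + M) - a))\<^sup>2 \<le> 1 / c * K"
      using that K[of k] by (simp add: pos_le_divide_eq mult.commute)
    then have "norm (X (k + M) - a) \<le> sqrt (1 / c * K)" by (rule real_le_rsqrt)
    then show ?thesis using norm_triangle_ineq[of a "X (k + M) - a"] by simp
  qed
  have "\<gamma> * (norm (z (k + M) - zs))\<^sup>2 \<le> energy zs ws (k + M)" for k
    by (auto simp: energy_def intro: sum_nonneg)
  then have "Bseq (\<lambda>k. z (k + M))" using near[of \<gamma> z _ zs] gamma by (intro BseqI') blast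
  then show "Bseq z" by (rule Bseq_offset)
  show "Bseq (w i)" if i: "i \<in> {1..<n}"
  proof -
    have "1 * (norm (w i (k + M) - ws i))\<^sup>2 \<le> energy zs ws (k + M)" for k
    proof -
      have "(norm (w i (k + M) - ws i))\<^sup>2 \<le> (\<Sum>i\<in>{1..<n}. (norm (w i (k + M) - ws i))\<^sup>2)"
        using i by (intro member_le_sum) auto
      then show ?thesis using gamma by (simp add: energy_def add_increasing)
    qed
    then have "Bseq (\<lambda>k. w i (k + M))" using near[of 1 "w i" _ "ws i"] by (intro BseqI') auto
    then show ?thesis by (rule Bseq_offset)
  qed
qed

lemma Bseq_w: "i \<in> {1..n} \<Longrightarrow> Bseq (w i)"
proof (cases "i = n")
  case True
  have "Bseq (\<lambda>k. dual (\<lambda>i. w i k))" by (rule Bseq_dual[OF Bseq_w_primal])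
  then obtain B where B: "\<And>k. norm (dual (\<lambda>i. w i k)) \<le> B" unfolding Bseq_def by blast
  have "norm (w n k) \<le> B" if "1 \<le> k" for k using B[of k] w_dual[OF that] by simp
  then show ?thesis unfolding True by (rule BseqI_eventually)
qed (use Bseq_w_primal in auto)

lemma Bseq_G_delayed: "i \<in> {1..n} \<Longrightarrow> Bseq (\<lambda>k. G i (z (l i k)))"
  using window_delay(2) by (intro Bseq_G[where N = M] Bseq_compose[OF Bseq_z] z_mem) auto

lemma backward_equation:
  assumes k: "M \<le> k" and i: "i \<in> {1..n}" "i \<in> IB"
  shows "G i (z (l i k)) - x i k
    = \<rho> i (l i k) *\<^sub>R (y i k - w i (l i k)) - e i (last_update I i k)"
proof -
  have k1: "1 \<le> k" using k A1(1) by simp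
  define s where "s = last_update I i k"
  have s: "1 \<le> s" "i \<in> I s" using window(1)[OF k i(1)] last_update_mem[of I i k] by (auto simp: s_def)
  have "0 < \<rho> i (d i s)" using rho(1) rho(2)[OF i(1), of "d i s"] delay[OF i(1) s(1)] by force
  from backward_stepD(3)[OF backward[OF executes[OF s(1)] s(2) i(2)] this]
  show ?thesis
    using frozen_iterates[OF i(1) executes[OF k1]] window_delay(1)[OF k i(1)] by (simp add: s_def)
qed

lemma forward_equation:
  assumes k: "M \<le> k" and i: "i \<in> {1..n}" "i \<in> IF"
  shows "forward_step \<nu> \<Delta> (T i) (\<rho> i (l i k)) (G i (z (l i k))) (w i (l i k)) (x i k) (y i k)"
proof -
  have k1: "1 \<le> k" using k A1(1) by simp
  define s where "s = last_update I i k"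
  have s: "1 \<le> s" "i \<in> I s" using window(1)[OF k i(1)] last_update_mem[of I i k] by (auto simp: s_def)
  show ?thesis
    using forward[OF executes[OF s(1)] s(2) i(2)] frozen_iterates[OF i(1) executes[OF k1]]
      window_delay(1)[OF k i(1)] by (simp add: s_def)
qed

lemma rho_delayed: "M \<le> k \<Longrightarrow> i \<in> {1..n} \<Longrightarrow> \<rho>lo \<le> \<rho> i (l i k) \<and> \<rho> i (l i k) \<le> \<rho>hi"
  using rho(2) window_delay(2) by blast

text \<open>A backward pair is compared with the graph point \<open>(a, u)\<close> of a solution: by
  monotonicity \<open>x - a\<close> and \<open>r (y - u)\<close> are each bounded by their sum
  \<open>q\<close>. For a forward pair the compactness bound applies.\<close>

lemma Bseq_xy:
  assumes i: "i \<in> {1..n}"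
  shows "Bseq (x i) \<and> Bseq (y i)"
proof -
  obtain B1 where B1: "\<And>k. norm (G i (z (l i k))) \<le> B1"
    using Bseq_G_delayed[OF i] unfolding Bseq_def by blast
  obtain B2 where B2: "\<And>k. norm (w i k) \<le> B2"
    using Bseq_w[OF i] unfolding Bseq_def by blast
  show ?thesis
  proof (cases "i \<in> IB")
    case True
    obtain zs ws where sol: "(zs, ws) \<in> extended_solution_set n H G T" using solvable by fast
    define a u where "a = G i zs" and "u = (ws(n := dual ws)) i"
    have au: "a \<in> H i" "u \<in> T i a"
      using G_mem[OF i extended_solutionD(1)[OF sol]] extended_solutionD(2)[OF sol i] by (auto simp: a_def u_def)
    obtain B3 where B3: "\<And>k. 1 \<le> k \<Longrightarrow> norm (e i k) \<le> B3"
      using E_bounded[OF True] unfolding bdd_above_def by auto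
    define C where "C = B1 + norm a + \<rho>hi * (B2 + norm u) + B3"
    have bnd: "norm (x i k - a) \<le> C \<and> \<rho>lo * norm (y i k - u) \<le> C" if k: "M \<le> k" for k
    proof -
      have k1: "1 \<le> k" using k A1(1) by simp
      define r where "r = \<rho> i (l i k)"
      have r: "\<rho>lo \<le> r" "r \<le> \<rho>hi" "0 < r" using rho_delayed[OF k i] rho(1) by (auto simp: r_def)
      have mon: "0 \<le> (x i k - a) \<bullet> (y i k - u)"
        using monotone_operatorD[OF monotone[OF i] x_mem[OF k1 i] graph[OF k i] au] .
      define q where "q = (x i k - a) + r *\<^sub>R (y i k - u)"
      \<comment> \<open>Substituting the step equation for \<open>x i k\<close> cancels
        \<open>y i k\<close>; only bounded delayed points and errors are left.\<close>
      have q: "q = (G i (z (l i k)) - a) + r *\<^sub>R (w i (l i k) - u) + e i (last_update I i k)"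
      proof -
        have "x i k = G i (z (l i k)) - r *\<^sub>R (y i k - w i (l i k)) + e i (last_update I i k)"
          using backward_equation[OF k i True] by (simp add: r_def algebra_simps)
        then show ?thesis by (simp add: q_def algebra_simps)
      qed
      have "norm q \<le> norm (G i (z (l i k)) - a) + norm (r *\<^sub>R (w i (l i k) - u)) + norm (e i (last_update I i k))"
        unfolding q by (intro norm_triangle_le add_mono norm_triangle_ineq) auto
      also have "\<dots> \<le> (B1 + norm a) + \<rho>hi * (B2 + norm u) + B3"
      proof (intro add_mono)
        show "norm (G i (z (l i k)) - a) \<le> B1 + norm a"
          using norm_triangle_ineq4[of "G i (z (l i k))" a] B1[of k] by linarith
        have "norm (w i (l i k) - u) \<le> B2 + norm u"
          using norm_triangle_ineq4[of "w i (l i k)" u] B2[of "l i k"] by linarith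
        then show "norm (r *\<^sub>R (w i (l i k) - u)) \<le> \<rho>hi * (B2 + norm u)"
          using r by (auto intro: mult_mono)
        show "norm (e i (last_update I i k)) \<le> B3" using B3 window(1)[OF k i] by blast
      qed
      finally have qC: "norm q \<le> C" by (simp add: C_def)
      have "norm (x i k - a) \<le> norm q"
        unfolding q_def using mon r by (intro norm_le_norm_add_of_inner_nonneg) simp
      moreover have "norm (r *\<^sub>R (y i k - u)) \<le> norm (r *\<^sub>R (y i k - u) + (x i k - a))"
        using mon r by (intro norm_le_norm_add_of_inner_nonneg) (simp add: inner_commute)
      then have "r * norm (y i k - u) \<le> norm q" using r by (simp add: q_def add.commute)
      moreover have "\<rho>lo * norm (y i k - u) \<le> r * norm (y i k - u)" using r by (simp add: mult_right_mono)
      ultimately show ?thesis using qC by linarith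
    qed
    have bnd_x: "norm (x i k) \<le> norm a + C" if "M \<le> k" for k
      using bnd[OF that] norm_triangle_ineq[of a "x i k - a"] by simp
    have bnd_y: "norm (y i k) \<le> norm u + C / \<rho>lo" if "M \<le> k" for k
    proof -
      have "norm (y i k - u) \<le> C / \<rho>lo" using bnd[OF that] rho(1) by (simp add: pos_le_divide_eq mult.commute)
      then show ?thesis using norm_triangle_ineq[of u "y i k - u"] by simp
    qed
    show ?thesis using BseqI_eventually[OF bnd_x] BseqI_eventually[OF bnd_y] ..
  next
    case False
    then have F: "i \<in> IF" using partition i by blast
    have "i \<le> n" using i by simp
    obtain B where B: "\<And>\<theta> \<omega> r \<xi> \<upsilon>. \<theta> \<in> H i \<Longrightarrow> \<omega> \<in> H i \<Longrightarrow> norm \<theta> \<le> max B1 B2 \<Longrightarrow> norm \<omega> \<le> max B1 B2 \<Longrightarrow>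
        0 < r \<Longrightarrow> r \<le> \<rho>hi \<Longrightarrow> forward_step \<nu> \<Delta> (T i) r \<theta> \<omega> \<xi> \<upsilon> \<Longrightarrow> norm \<xi> \<le> B \<and> norm \<upsilon> \<le> B"
      using forward_step_bounded[OF hilbert[OF \<open>i \<le> n\<close>] _ set_operator[OF i] _ linesearch, of "max B1 B2" \<rho>hi]
        IF[OF F] by blast
    have "norm (x i k) \<le> B \<and> norm (y i k) \<le> B" if k: "M \<le> k" for k
    proof (rule B[OF _ _ _ _ _ _ forward_equation[OF k i F]])
      show "G i (z (l i k)) \<in> H i" "w i (l i k) \<in> H i"
        using window_delay(2)[OF k i] by (auto intro: G_mem[OF i] z_mem w_mem i)
      show "norm (G i (z (l i k))) \<le> max B1 B2" "norm (w i (l i k)) \<le> max B1 B2"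
        using B1[of k] B2[of "l i k"] by auto
      show "0 < \<rho> i (l i k)" "\<rho> i (l i k) \<le> \<rho>hi" using rho_delayed[OF k i] rho(1) by auto
    qed
    then have "norm (x i k) \<le> B" "norm (y i k) \<le> B" if "M \<le> k" for k using that by auto
    from BseqI_eventually[OF this(1)] BseqI_eventually[OF this(2)] show ?thesis ..
  qed
qed

lemma Bseq_pi: "Bseq \<pi>"
proof -
  have xn: "Bseq (\<lambda>k. x n k)" using Bseq_xy[of n] n by simp
  have "Bseq (\<lambda>k. coupling_u n G x i k)" if i: "i \<in> {1..<n}" for i
  proof -
    have "x n k \<in> H 0" if "1 \<le> k" for k using x_mem[OF that, of n] n H_n by simp
    then have "Bseq (\<lambda>k. G i (x n k))" using i by (intro Bseq_G[OF _ xn]) auto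
    then show ?thesis unfolding coupling_u_def using Bseq_xy[of i] i by (intro Bseq_diff) auto
  qed
  then have "\<forall>i\<in>{1..<n}. \<exists>B. \<forall>k. norm (coupling_u n G x i k) \<le> B" unfolding Bseq_def by blast
  from bchoice[OF this] obtain B where B: "\<And>i k. i \<in> {1..<n} \<Longrightarrow> norm (coupling_u n G x i k) \<le> B i" by blast
  have "Bseq (\<lambda>k. y n k - dual (\<lambda>i. y i k))"
    using Bseq_xy n by (intro Bseq_diff Bseq_dual) auto
  then obtain C where C: "\<And>k. norm (y n k - dual (\<lambda>i. y i k)) \<le> C" unfolding Bseq_def by blast
  have "norm (\<pi> k) \<le> (\<Sum>i\<in>{1..<n}. (B i)\<^sup>2) + inverse \<gamma> * C\<^sup>2" for k
  proof -
    have "coupling_v n H G y k = y n k - dual (\<lambda>i. y i k)"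
      by (simp add: coupling_v_def dual_def)
    then have "norm (coupling_v n H G y k) \<le> C" using C[of k] by simp
    then have "\<pi> k \<le> (\<Sum>i\<in>{1..<n}. (B i)\<^sup>2) + inverse \<gamma> * C\<^sup>2"
      unfolding sep_pi_def using gamma B
      by (intro add_mono sum_mono mult_left_mono power_mono) auto
    moreover have "0 \<le> \<pi> k"
      using gamma unfolding sep_pi_def by (auto intro!: add_nonneg_nonneg sum_nonneg)
    ultimately show ?thesis by simp
  qed
  then show ?thesis by (rule BseqI')
qed

text \<open>The square of \<open>\<beta> k * max 0 (\<phi> k) = \<alpha> k * \<pi> k\<close> is
  \<open>\<pi> k\<close> times the residual; \<pi> is bounded and \<beta> is bounded away from
  0.\<close>

lemma phi_tendsto: "(\<lambda>k. max 0 (\<phi> k)) \<longlonglongrightarrow> 0"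
proof -
  obtain B where "\<And>k. norm (\<pi> k) \<le> B" using Bseq_pi unfolding Bseq_def by blast
  then have B: "\<pi> k \<le> B" for k by (simp add: abs_le_iff)
  show ?thesis
  proof (rule tendsto_0_of_norm_squared_le[OF _ residual_tendsto_0])
    fix k assume k: "M \<le> k"
    have k1: "1 \<le> k" using k A1(1) by simp
    have b: "0 < \<beta>lo" "\<beta>lo \<le> \<beta> k" using beta(1) beta(3)[OF k1] by auto
    define m where "m = max 0 (\<phi> k)"
    have "\<beta>lo * m \<le> \<beta> k * m" using b by (intro mult_right_mono) (auto simp: m_def)
    also have "\<dots> = \<alpha> k * \<pi> k" using alpha_phi(3)[OF k] by (simp add: m_def)
    finally have "(\<beta>lo * m)\<^sup>2 \<le> (\<alpha> k * \<pi> k)\<^sup>2" using b by (intro power_mono) (auto simp: m_def)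
    also have "\<dots> = \<pi> k * ((\<alpha> k)\<^sup>2 * \<pi> k)" by (simp add: power2_eq_square)
    also have "\<dots> \<le> B * ((\<alpha> k)\<^sup>2 * \<pi> k)" using B residual_nonneg[OF k] by (intro mult_right_mono) auto
    finally have "\<beta>lo\<^sup>2 * m\<^sup>2 \<le> B * ((\<alpha> k)\<^sup>2 * \<pi> k)" by (simp add: power_mult_distrib)
    then have "m\<^sup>2 \<le> B / \<beta>lo\<^sup>2 * ((\<alpha> k)\<^sup>2 * \<pi> k)" using b by (simp add: pos_le_divide_eq mult.commute)
    then show "(norm (max 0 (\<phi> k)))\<^sup>2 \<le> B / \<beta>lo\<^sup>2 * ((\<alpha> k)\<^sup>2 * \<pi> k)" by (simp add: m_def)
  qed
qed

section \<open>Vanishing primal and dual gaps\<close>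

text \<open>The \<open>i\<close>-th summand of \<phi> at the point from which the current pair was
  computed. The step estimates give it a sign, which a summand at the current point need not
  have.\<close>

definition \<psi> :: "nat \<Rightarrow> nat \<Rightarrow> real" where
  "\<psi> i k = (G i (z (l i k)) - x i k) \<bullet> (y i k - w i (l i k))"

lemma backward_psi:
  assumes k: "M \<le> k" and i: "i \<in> {1..n}" "i \<in> IB"
  shows "(norm (G i (z (l i k)) - x i k))\<^sup>2 \<le> \<rho>hi / (1 - \<sigma>) * \<psi> i k"
    "(norm (y i k - w i (l i k)))\<^sup>2 \<le> 1 / ((1 - \<sigma>) * \<rho>lo) * \<psi> i k"
proof -
  have k1: "1 \<le> k" using k A1(1) by simp
  have E': "- \<sigma> * (norm (G i (z (l i k)) - x i k))\<^sup>2
          \<le> (G i (z (l i k)) - x i k) \<bullet> e i (last_update I i k)"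
      "e i (last_update I i k) \<bullet> (y i k - w i (l i k))
          \<le> \<rho> i (l i k) * \<sigma> * (norm (y i k - w i (l i k)))\<^sup>2"
    using E[OF i(2) k1 window(1)[OF k i(1)]] nonterminating by auto
  show "(norm (G i (z (l i k)) - x i k))\<^sup>2 \<le> \<rho>hi / (1 - \<sigma>) * \<psi> i k"
    "(norm (y i k - w i (l i k)))\<^sup>2 \<le> 1 / ((1 - \<sigma>) * \<rho>lo) * \<psi> i k"
    unfolding \<psi>_def
    using backward_gap[OF backward_equation[OF k i] rho(1) _ _ E_sigma E'] rho_delayed[OF k i(1)] by auto
qed

lemma forward_psi:
  assumes k: "M \<le> k" and i: "i \<in> {1..n}" "i \<in> IF"
  shows "(norm (G i (z (l i k)) - x i k))\<^sup>2 \<le> 1 / \<Delta> * \<psi> i k"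
proof -
  have "i \<le> n" using i by simp
  have "\<Delta> * (norm (G i (z (l i k)) - x i k))\<^sup>2 \<le> \<psi> i k"
    unfolding \<psi>_def
  proof (rule forward_stepD(3)[OF subspace_H set_operator _ linesearch _ _ _ forward_equation[OF k i]])
    show "single_valued_continuous (H i) (T i)" using IF[OF i(2)] by blast
    show "0 < \<rho> i (l i k)" using rho_delayed[OF k i(1)] rho(1) by simp
    show "G i (z (l i k)) \<in> H i" "w i (l i k) \<in> H i"
      using window_delay(2)[OF k i(1)] by (auto intro: G_mem[OF i(1)] z_mem w_mem i(1))
  qed (use i in auto)
  then show ?thesis using linesearch by (simp add: pos_le_divide_eq mult.commute)
qed

text \<open>Each step estimate bounds a square by a positive multiple of \<psi>. The sign allows a
  single summand to be bounded by the sum.\<close>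

lemma psi_nonneg:
  assumes k: "M \<le> k" and i: "i \<in> {1..n}"
  shows "0 \<le> \<psi> i k"
proof -
  obtain c where c: "0 < c" "(norm (G i (z (l i k)) - x i k))\<^sup>2 \<le> c * \<psi> i k"
  proof (cases "i \<in> IB")
    case True
    have "0 < \<rho>hi / (1 - \<sigma>)" using rho_delayed[OF k i] rho(1) E_sigma by auto
    then show ?thesis using backward_psi(1)[OF k i True] that by blast
  next
    case False
    then have "i \<in> IF" using partition i by blast
    moreover have "0 < 1 / \<Delta>" using linesearch by simp
    ultimately show ?thesis using forward_psi[OF k i] that by blast
  qed
  have "0 \<le> c * \<psi> i k" by (rule order_trans[OF zero_le_power2 c(2)])
  then show ?thesis using c(1) by (simp add: zero_le_mult_iff)
qed

lemma phi_eq: "1 \<le> k \<Longrightarrow> \<phi> k = (\<Sum>i\<in>{1..n}. (G i (z k) - x i k) \<bullet> (y i k - w i k))"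
  using z_mem x_mem[of k n] n H_n w_dual by (intro sep_phi_eq) auto

lemma G_delay:
  assumes i: "i \<in> {1..n}"
  shows "(\<lambda>k. G i (z k) - G i (z (l i k))) \<longlonglongrightarrow> 0"
proof -
  have mem: "z k \<in> H 0" "z (l i k) \<in> H 0" if "M \<le> k" for k
    using that A1(1) window_delay(2)[OF that i] z_mem by auto
  have "z k - z (l i k) \<in> H 0" if "M \<le> k" for k
    using mem[OF that] by (intro subspace_diff subspace_H) auto
  from G_tendsto_0[OF i z_delay[OF i] this]
  have lim: "(\<lambda>k. G i (z k - z (l i k))) \<longlonglongrightarrow> 0" .
  show ?thesis
    by (rule Lim_transform_eventually[OF lim eventually_sequentiallyI[of M]]) (rule G_diff[OF i mem])
qed

lemma psi_tendsto_0:
  assumes i: "i \<in> {1..n}"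
  shows "\<psi> i \<longlonglongrightarrow> 0"
proof -
  \<comment> \<open>What remains when every summand of \<phi> is moved to its delayed point; each
    product pairs a null sequence with a bounded one.\<close>
  define r where "r = (\<lambda>k. \<Sum>j\<in>{1..n}. (G j (z k) - G j (z (l j k))) \<bullet> (y j k - w j k)
      - (G j (z (l j k)) - x j k) \<bullet> (w j k - w j (l j k)))"
  have "r \<longlonglongrightarrow> (\<Sum>j\<in>{1..n}. 0 - 0)"
    unfolding r_def using Bseq_xy Bseq_w
    by (intro tendsto_sum tendsto_diff Bseq_inner_tendsto_0 Bseq_diff G_delay w_delay Bseq_G_delayed) auto
  then have lim: "(\<lambda>k. max 0 (\<phi> k) - r k) \<longlonglongrightarrow> 0"
    using tendsto_diff[OF phi_tendsto, of r 0] by simp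
  have "norm (\<psi> i k) \<le> max 0 (\<phi> k) - r k" if k: "M \<le> k" for k
  proof -
    have k1: "1 \<le> k" using k A1(1) by simp
    have "\<phi> k - r k = (\<Sum>j\<in>{1..n}. \<psi> j k)"
      unfolding phi_eq[OF k1] r_def sum_subtractf[symmetric]
      by (intro sum.cong) (auto simp: \<psi>_def inner_diff_left inner_diff_right)
    moreover have "\<psi> i k \<le> (\<Sum>j\<in>{1..n}. \<psi> j k)"
      using i psi_nonneg[OF k] by (intro member_le_sum) auto
    ultimately show ?thesis using psi_nonneg[OF k i] by simp
  qed
  then show ?thesis
    by (rule Lim_null_comparison[OF eventually_sequentiallyI lim])
qed

lemma delayed_primal_gap:
  assumes i: "i \<in> {1..n}"
  shows "(\<lambda>k. G i (z (l i k)) - x i k) \<longlonglongrightarrow> 0"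
proof (cases "i \<in> IB")
  case True
  show ?thesis
    by (rule tendsto_0_of_norm_squared_le[OF backward_psi(1)[OF _ i True] psi_tendsto_0[OF i]])
next
  case False
  then have "i \<in> IF" using partition i by blast
  then show ?thesis
    by (intro tendsto_0_of_norm_squared_le[OF forward_psi[OF _ i] psi_tendsto_0[OF i]])
qed

text \<open>For forward blocks \<psi> yields no quadratic bound here. The threshold of
  \<open>forward_step_dual_gap\<close> is uniform over bounded points and admissible stepsizes, so
  the vanishing primal gap is enough.\<close>

lemma delayed_dual_gap:
  assumes i: "i \<in> {1..n}"
  shows "(\<lambda>k. y i k - w i (l i k)) \<longlonglongrightarrow> 0"
proof (cases "i \<in> IB")
  case True
  show ?thesis
    by (rule tendsto_0_of_norm_squared_le[OF backward_psi(2)[OF _ i True] psi_tendsto_0[OF i]])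
next
  case False
  then have F: "i \<in> IF" using partition i by blast
  have "i \<le> n" using i by simp
  obtain B1 where B1: "\<And>k. norm (G i (z (l i k))) \<le> B1"
    using Bseq_G_delayed[OF i] unfolding Bseq_def by blast
  obtain B2 where B2: "\<And>k. norm (w i k) \<le> B2"
    using Bseq_w[OF i] unfolding Bseq_def by blast
  show ?thesis
    unfolding LIMSEQ_iff
  proof (intro allI impI)
    fix \<epsilon> :: real assume "0 < \<epsilon>"
    obtain \<delta> where "0 < \<delta>" and \<delta>: "\<And>\<theta> \<omega> r \<xi> \<upsilon>. \<theta> \<in> H i \<Longrightarrow> \<omega> \<in> H i \<Longrightarrow> norm \<theta> \<le> max B1 B2 \<Longrightarrow>
        norm \<omega> \<le> max B1 B2 \<Longrightarrow> \<rho>lo \<le> r \<Longrightarrow> r \<le> \<rho>hi \<Longrightarrow> forward_step \<nu> \<Delta> (T i) r \<theta> \<omega> \<xi> \<upsilon> \<Longrightarrow>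
        norm (\<theta> - \<xi>) < \<delta> \<Longrightarrow> norm (\<upsilon> - \<omega>) < \<epsilon>"
      using forward_step_dual_gap[OF hilbert[OF \<open>i \<le> n\<close>] _ set_operator[OF i] _ linesearch rho(1) \<open>0 < \<epsilon>\<close>,
          of "max B1 B2" \<rho>hi] IF[OF F] by blast
    obtain N where N: "\<And>k. N \<le> k \<Longrightarrow> norm (G i (z (l i k)) - x i k) < \<delta>"
      using LIMSEQ_D[OF delayed_primal_gap[OF i] \<open>0 < \<delta>\<close>] by auto
    have "norm (y i k - w i (l i k)) < \<epsilon>" if "max M N \<le> k" for k
    proof (rule \<delta>[OF _ _ _ _ _ _ forward_equation[OF _ i F]])
      show k: "M \<le> k" using that by simp
      show "G i (z (l i k)) \<in> H i" "w i (l i k) \<in> H i"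
        using window_delay(2)[OF k i] by (auto intro: G_mem[OF i] z_mem w_mem i)
      show "norm (G i (z (l i k))) \<le> max B1 B2" "norm (w i (l i k)) \<le> max B1 B2"
        using B1[of k] B2[of "l i k"] by auto
      show "\<rho>lo \<le> \<rho> i (l i k)" "\<rho> i (l i k) \<le> \<rho>hi" using rho_delayed[OF k i] by auto
      show "norm (G i (z (l i k)) - x i k) < \<delta>" using N that by simp
    qed
    then show "\<exists>N. \<forall>k\<ge>N. norm (y i k - w i (l i k) - 0) < \<epsilon>"
      by (intro exI[of _ "max M N"]) auto
  qed
qed

lemma primal_gap: "i \<in> {1..n} \<Longrightarrow> (\<lambda>k. G i (z k) - x i k) \<longlonglongrightarrow> 0"
  using tendsto_add[OF G_delay delayed_primal_gap] by fastforce

lemma dual_gap: "i \<in> {1..n} \<Longrightarrow> (\<lambda>k. y i k - w i k) \<longlonglongrightarrow> 0"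
  using tendsto_diff[OF delayed_dual_gap w_delay] by fastforce

section \<open>Weak convergence of the whole sequence\<close>

text \<open>\<open>z\<close> becomes member 0 of one finite family with the components of
  \<open>w\<close>, and \<gamma> its weight, so that the energy is the weighted distance in Opial's
  lemma. The shift by \<open>M\<close> starts the family where the energy is known to
  decrease.\<close>

lemma weak_limit:
  "\<exists>zb wb. (zb, \<lambda>i\<in>{1..<n}. wb i) \<in> extended_solution_set n H G T \<and>
    (\<forall>h. (\<lambda>k. z k \<bullet> h) \<longlonglongrightarrow> zb \<bullet> h) \<and> (\<forall>i\<in>{1..<n}. \<forall>h. (\<lambda>k. w i k \<bullet> h) \<longlonglongrightarrow> wb i \<bullet> h)"
proof -
  define P where "P = (\<lambda>i k. if i = 0 then z (k + M) else w i (k + M))"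
  define c where "c = (\<lambda>i::nat. if i = 0 then \<gamma> else 1)"
  define S where "S = {q. (q 0, \<lambda>i\<in>{1..<n}. q i) \<in> extended_solution_set n H G T}"
  have split: "(\<Sum>i\<in>{0..<n}. f i) = f 0 + (\<Sum>i\<in>{1..<n}. f i)" for f :: "nat \<Rightarrow> real"
    using n by (simp add: sum.atLeast_Suc_lessThan One_nat_def)
  have pos: "1 \<le> k + M" for k using A1(1) by simp
  have "\<exists>q\<in>S. \<forall>i\<in>{0..<n}. q i \<in> H i \<and> (\<forall>h. (\<lambda>k. P i k \<bullet> h) \<longlonglongrightarrow> q i \<bullet> h)"
  proof (rule opial_family)
    show "subspace (H i)" "complete (H i)" if "i \<in> {0..<n}" for i
      using that subspace_H complete_H by auto
    show "P i k \<in> H i" if "i \<in> {0..<n}" for i k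
      using that z_mem[OF pos] w_mem[OF pos] by (auto simp: P_def)
    show "0 < c i" for i using gamma by (simp add: c_def)
    show "S \<noteq> {}"
    proof -
      obtain zs ws where sol: "(zs, ws) \<in> extended_solution_set n H G T" using solvable by fast
      then have "ws \<in> (\<Pi>\<^sub>E i\<in>{1..<n}. H i)"
        by (auto simp: extended_solution_set_def product_space_def)
      then have "restrict ws {1..<n} = ws" by (rule PiE_restrict)
      moreover have "(\<lambda>i\<in>{1..<n}. (ws(0 := zs)) i) = restrict ws {1..<n}"
        by (intro restrict_ext) auto
      ultimately have "ws(0 := zs) \<in> S"
        unfolding S_def mem_Collect_eq fun_upd_same using sol by (simp only:)
      then show ?thesis by blast
    qed
    show "convergent (\<lambda>k. \<Sum>i\<in>{0..<n}. c i * (norm (P i k - q i))\<^sup>2)" if "q \<in> S" for q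
    proof -
      have "(\<Sum>i\<in>{0..<n}. c i * (norm (P i k - q i))\<^sup>2) = energy (q 0) (\<lambda>i\<in>{1..<n}. q i) (k + M)" for k
        unfolding split energy_def by (auto simp: c_def P_def intro!: sum.cong)
      then show ?thesis using energy_convergent that by (simp add: S_def)
    qed
    show "q \<in> S" if r: "strict_mono r" and q_mem: "\<And>i. i \<in> {0..<n} \<Longrightarrow> q i \<in> H i"
      and q: "\<And>i h. i \<in> {0..<n} \<Longrightarrow> (\<lambda>k. P i (r k) \<bullet> h) \<longlonglongrightarrow> q i \<bullet> h" for r q
    proof -
      \<comment> \<open>The family has no member \<open>n\<close>; the constrained last component is
        supplied here.\<close>
      define w' where "w' = q(n := dual q)"
      have w': "w' n = dual w'" "\<And>i. i \<in> {1..<n} \<Longrightarrow> w' i = q i"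
        using dual_cong[of w' q] by (auto simp: w'_def)
      have rM: "strict_mono (\<lambda>k. r k + M)" using r by (simp add: strict_mono_def)
      have M: "M \<le> r k + M" for k by simp
      have "w' i \<in> T i (G i (q 0))" if i: "i \<in> {1..n}" for i
      proof (rule weak_cluster_point_solves[where Z = "\<lambda>k. z (r k + M)" and W = "\<lambda>i k. w i (r k + M)"
            and X = "\<lambda>i k. x i (r k + M)" and Y = "\<lambda>i k. y i (r k + M)"])
        show "(\<lambda>k. G i (z (r k + M)) - x i (r k + M)) \<longlonglongrightarrow> 0" if "i \<in> {1..n}" for i
          using LIMSEQ_subseq_LIMSEQ[OF primal_gap[OF that] rM] by (simp add: o_def)
        show "(\<lambda>k. y i (r k + M) - w i (r k + M)) \<longlonglongrightarrow> 0" if "i \<in> {1..n}" for i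
          using LIMSEQ_subseq_LIMSEQ[OF dual_gap[OF that] rM] by (simp add: o_def)
        show "(\<lambda>k. z (r k + M) \<bullet> h) \<longlonglongrightarrow> q 0 \<bullet> h" for h
          using q[of 0 h] n by (simp add: P_def)
        show "(\<lambda>k. w i (r k + M) \<bullet> h) \<longlonglongrightarrow> w' i \<bullet> h" if "i \<in> {1..<n}" for i h
          using q[of i h] that w'(2) by (simp add: P_def)
        show "Bseq (\<lambda>k. z (r k + M))" by (rule Bseq_compose[OF Bseq_z])
        show "Bseq (\<lambda>k. y i (r k + M))" if "i \<in> {1..n}" for i
          by (rule Bseq_compose[OF conjunct2[OF Bseq_xy[OF that]]])
        show "q 0 \<in> H 0" using q_mem[of 0] n by simp
        show "w' i \<in> H i" if "i \<in> {1..<n}" for i using q_mem[of i] w'(2)[OF that] that by simp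
      qed (fact z_mem[OF pos] w_mem[OF pos] x_mem[OF pos] w_dual[OF pos] graph[OF M] w'(1) i)+
      moreover have "q 0 \<in> H 0" using q_mem[of 0] n by simp
      ultimately have "(q 0, \<lambda>i\<in>{1..<n}. w' i) \<in> extended_solution_set n H G T"
        using w'(1) by (intro extended_solutionI)
      moreover have "(\<lambda>i\<in>{1..<n}. w' i) = (\<lambda>i\<in>{1..<n}. q i)" using w'(2) by (intro restrict_ext) auto
      ultimately show ?thesis by (simp add: S_def)
    qed
  qed simp
  then obtain q where q: "q \<in> S" "\<And>i h. i \<in> {0..<n} \<Longrightarrow> (\<lambda>k. P i k \<bullet> h) \<longlonglongrightarrow> q i \<bullet> h" by blast
  have "(\<lambda>k. z k \<bullet> h) \<longlonglongrightarrow> q 0 \<bullet> h" for h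
    by (rule LIMSEQ_offset[of _ M]) (use q(2)[of 0 h] n in \<open>simp add: P_def\<close>)
  moreover have "(\<lambda>k. w i k \<bullet> h) \<longlonglongrightarrow> q i \<bullet> h" if "i \<in> {1..<n}" for i h
    by (rule LIMSEQ_offset[of _ M]) (use q(2)[of i h] that in \<open>simp add: P_def\<close>)
  ultimately show ?thesis using q(1) unfolding S_def by blast
qed

text \<open>The gaps vanish in norm, so \<open>x\<close> and \<open>y\<close> inherit the weak
  limits of \<open>G i (z k)\<close> and \<open>w i k\<close>. For \<open>y n\<close> the limit is
  computed through \<open>dual\<close>, with test vectors in \<open>H 0\<close>.\<close>

lemma converges:
  "\<exists>zbar wbar. (zbar, wbar) \<in> extended_solution_set n H G T \<and>
     weakly_converges (product_space n H) (product_inner n) (\<lambda>k. (z k, \<lambda>i\<in>{1..<n}. w i k)) (zbar, wbar) \<and>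
     (\<forall>i\<in>{1..<n}. weakly_converges (H i) (\<bullet>) (\<lambda>k. x i k) (G i zbar) \<and>
                   weakly_converges (H i) (\<bullet>) (\<lambda>k. y i k) (wbar i)) \<and>
     weakly_converges (H 0) (\<bullet>) (\<lambda>k. x n k) zbar \<and>
     weakly_converges (H 0) (\<bullet>) (\<lambda>k. y n k) (dual wbar)"
proof -
  obtain zb wb where sol': "(zb, \<lambda>i\<in>{1..<n}. wb i) \<in> extended_solution_set n H G T"
    and z: "\<And>h. (\<lambda>k. z k \<bullet> h) \<longlonglongrightarrow> zb \<bullet> h"
    and w: "\<And>i h. i \<in> {1..<n} \<Longrightarrow> (\<lambda>k. w i k \<bullet> h) \<longlonglongrightarrow> wb i \<bullet> h"
    using weak_limit by blast
  define wbar where "wbar = (\<lambda>i\<in>{1..<n}. wb i)"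
  have sol: "(zb, wbar) \<in> extended_solution_set n H G T" using sol' by (simp add: wbar_def)
  have wbar: "(\<lambda>k. w i k \<bullet> h) \<longlonglongrightarrow> wbar i \<bullet> h" if "i \<in> {1..<n}" for i h
    using w[OF that] that by (simp add: wbar_def)
  have zb: "zb \<in> H 0" using extended_solutionD(1)[OF sol] .
  have X: "weakly_converges (H i) (\<bullet>) (\<lambda>k. x i k) (G i zb)" if i: "i \<in> {1..n}" for i
    unfolding weakly_converges_def
    using x_mem[OF _ i] G_mem[OF i zb] weak_limit_image[OF i z_mem zb z primal_gap[OF i]]
    by (auto intro: eventually_sequentiallyI[of 1])
  have Y: "weakly_converges (H i) (\<bullet>) (\<lambda>k. y i k) (wbar i)" if i: "i \<in> {1..<n}" for i
  proof -
    have i': "i \<in> {1..n}" using i by simp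
    show ?thesis
      unfolding weakly_converges_def
      using y_mem[OF _ i'] extended_solutionD(3)[OF sol i] weak_limit_perturbed[OF wbar[OF i] dual_gap[OF i']]
      by (auto intro: eventually_sequentiallyI[of 1])
  qed
  have n': "n \<in> {1..n}" using n by simp
  have Xn: "weakly_converges (H 0) (\<bullet>) (\<lambda>k. x n k) zb"
    using X[OF n'] zb by (simp add: H_n G_n)
  have Yn: "weakly_converges (H 0) (\<bullet>) (\<lambda>k. y n k) (dual wbar)"
    unfolding weakly_converges_def
  proof (intro conjI ballI)
    show "\<forall>\<^sub>F k in sequentially. y n k \<in> H 0"
      using y_mem[OF _ n'] H_n by (auto intro: eventually_sequentiallyI[of 1])
    show "dual wbar \<in> H 0" by (rule dual_mem)
    fix h assume h: "h \<in> H 0"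
    have lim: "(\<lambda>k. dual (\<lambda>i. w i k) \<bullet> h) \<longlonglongrightarrow> dual wbar \<bullet> h"
      using wbar h by (rule weak_limit_dual)
    have "dual (\<lambda>i. w i k) \<bullet> h = w n k \<bullet> h" if "1 \<le> k" for k using w_dual[OF that] by simp
    then have "(\<lambda>k. w n k \<bullet> h) \<longlonglongrightarrow> dual wbar \<bullet> h"
      by (rule Lim_transform_eventually[OF lim eventually_sequentiallyI])
    then show "(\<lambda>k. y n k \<bullet> h) \<longlonglongrightarrow> dual wbar \<bullet> h"
      using dual_gap[OF n'] by (rule weak_limit_perturbed)
  qed
  have "weakly_converges (product_space n H) (product_inner n) (\<lambda>k. (z k, \<lambda>i\<in>{1..<n}. w i k)) (zb, wbar)"
    unfolding weakly_converges_def
  proof (intro conjI ballI)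
    show "\<forall>\<^sub>F k in sequentially. (z k, \<lambda>i\<in>{1..<n}. w i k) \<in> product_space n H"
      using z_mem w_mem by (intro eventually_sequentiallyI[of 1]) (auto simp: product_space_def)
    show "(zb, wbar) \<in> product_space n H" using sol by (auto simp: extended_solution_set_def)
    fix h
    have "(\<lambda>k. z k \<bullet> fst h + (\<Sum>i\<in>{1..<n}. w i k \<bullet> snd h i)) \<longlonglongrightarrow> zb \<bullet> fst h + (\<Sum>i\<in>{1..<n}. wbar i \<bullet> snd h i)"
      by (intro tendsto_add tendsto_sum z wbar)
    then show "(\<lambda>k. product_inner n (z k, \<lambda>i\<in>{1..<n}. w i k) h) \<longlonglongrightarrow> product_inner n (zb, wbar) h"
      by (simp add: product_inner_def)
  qed
  then show ?thesis using sol X Y Xn Yn by (intro exI[of _ zb] exI[of _ wbar]) auto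
qed

end

section \<open>From extended-real stepsize bounds to the theorem\<close>

lemma stepsize_bounds:
  fixes \<rho> :: "nat \<Rightarrow> nat \<Rightarrow> real"
  assumes J: "finite J" "j \<in> J"
    and lo: "0 < (MIN i\<in>J. INF k\<in>{1..}. ereal (\<rho> i k))"
    and hi: "(MAX i\<in>J. SUP k\<in>{1..}. ereal (\<rho> i k)) < \<infinity>"
  shows "\<exists>a b. 0 < a \<and> (\<forall>i\<in>J. \<forall>k\<ge>1. a \<le> \<rho> i k \<and> \<rho> i k \<le> b)"
proof -
  define A where "A = (MIN i\<in>J. INF k\<in>{1..}. ereal (\<rho> i k))"
  define B where "B = (MAX i\<in>J. SUP k\<in>{1..}. ereal (\<rho> i k))"
  have A: "A \<le> ereal (\<rho> i k)" if "i \<in> J" "1 \<le> k" for i k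
  proof -
    have "A \<le> (INF k\<in>{1..}. ereal (\<rho> i k))" unfolding A_def using J that by (intro Min_le) auto
    also have "\<dots> \<le> ereal (\<rho> i k)" using that by (intro INF_lower) auto
    finally show ?thesis .
  qed
  have B: "ereal (\<rho> i k) \<le> B" if "i \<in> J" "1 \<le> k" for i k
  proof -
    have "ereal (\<rho> i k) \<le> (SUP k\<in>{1..}. ereal (\<rho> i k))" using that by (intro SUP_upper) auto
    also have "\<dots> \<le> B" unfolding B_def using J that by (intro Max_ge) auto
    finally show ?thesis .
  qed
  \<comment> \<open>\<open>A\<close> is positive and at most the real number
    \<open>\<rho> j 1\<close>, hence itself real; dually for \<open>B\<close> below.\<close>
  obtain a where a: "A = ereal a"
    using A[OF J(2), of 1] lo unfolding A_def[symmetric] by (cases A) auto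
  obtain b where b: "B = ereal b"
    using B[OF J(2), of 1] hi unfolding B_def[symmetric] by (cases B) auto
  have "0 < a" using lo unfolding A_def[symmetric] a by simp
  moreover have "a \<le> \<rho> i k \<and> \<rho> i k \<le> b" if "i \<in> J" "1 \<le> k" for i k
    using A[OF that] B[OF that] by (simp add: a b)
  ultimately show ?thesis by blast
qed

theorem theorem1:
  fixes n :: nat
    and H :: "nat \<Rightarrow> 'a::real_inner set"
    and G :: "nat \<Rightarrow> 'a \<Rightarrow> 'a"
    and T :: "nat \<Rightarrow> 'a \<Rightarrow> 'a set"
    and IF IB :: "nat set"
    and I :: "nat \<Rightarrow> nat set"
    and \<beta>lo \<beta>hi \<gamma> \<nu> \<Delta> \<sigma> :: real
    and \<beta> :: "nat \<Rightarrow> real"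
    and \<rho> :: "nat \<Rightarrow> nat \<Rightarrow> real"
    and d :: "nat \<Rightarrow> nat \<Rightarrow> nat"
    and M D :: nat
    and e x y w :: "nat \<Rightarrow> nat \<Rightarrow> 'a"
    and z :: "nat \<Rightarrow> 'a"
  assumes n: "1 \<le> n"
    and partition: "IF \<union> IB = {1..n}" "IF \<inter> IB = {}"
    and operators: "\<forall>i\<in>{1..n}. set_operator (H i) (T i)"
    and G_n: "\<forall>\<xi>\<in>H 0. G n \<xi> = \<xi>"
    \<comment> \<open>standing assumptions on the problem\<close>
    and P1: "\<forall>i\<in>{0..n}. hilbert_space (H i)" "H n = H 0"
    and P2: "\<forall>i\<in>{1..n}. monotone_operator (H i) (T i)"
    and P3: "\<forall>i\<in>IF. finite_dimensional (H i) \<and> single_valued_continuous (H i) (T i)"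
    and P4: "\<forall>i\<in>IB. maximal_monotone (H i) (T i)"
    and P5: "\<forall>i\<in>{1..<n}. bounded_linear_between (H 0) (H i) (G i)"
    and P6: "extended_solution_set n H G T \<noteq> {}"
    \<comment> \<open>parameters\<close>
    and beta: "0 < \<beta>lo" "\<beta>lo \<le> \<beta>hi" "\<beta>hi < 2" "\<forall>k\<ge>1. \<beta> k \<in> {\<beta>lo..\<beta>hi}"
    and gamma: "0 < \<gamma>"
    and linesearch: "0 < \<nu>" "\<nu> < 1" "0 < \<Delta>"
    and blocks: "\<forall>k\<ge>1. I k \<subseteq> {1..n}"
    and rho: "\<forall>i\<in>{1..n}. \<forall>k\<ge>1. 0 < \<rho> i k"
    and delay: "\<forall>i\<in>{1..n}. \<forall>k\<ge>1. d i k \<in> {1..k}"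
    and errors: "\<forall>i\<in>IB. \<forall>k\<ge>1. e i k \<in> H i"
    and A1: "1 \<le> M" "\<forall>j\<ge>1. (\<Union>k\<in>{j..j + M - 1}. I k) = {1..n}"
    and A2: "\<forall>k\<ge>1. \<forall>i\<in>I k. k - d i k \<le> D"
    and E_bounded: "\<forall>i\<in>IB. bdd_above ((\<lambda>k. norm (e i k)) ` {1..})"
    and E_sigma: "0 \<le> \<sigma>" "\<sigma> < 1"
    and E: "\<forall>i\<in>IB. \<forall>k\<ge>1. last_update I i k \<ge> 1 \<and> (\<forall>j\<in>{1..k}. \<not> returns_at n H G \<gamma> I x y j) \<longrightarrow>
        (let s = last_update I i k; l = last_delayed I d i k in
           (G i (z l) - x i k) \<bullet> e i s \<ge> - \<sigma> * (norm (G i (z l) - x i k))\<^sup>2 \<and>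
           e i s \<bullet> (y i k - w i l) \<le> \<rho> i l * \<sigma> * (norm (y i k - w i l))\<^sup>2)"
    and R: "0 < (MIN i\<in>{1..n}. INF k\<in>{1..}. ereal (\<rho> i k))"
           "(MAX i\<in>{1..n}. SUP k\<in>{1..}. ereal (\<rho> i k)) < \<infinity>"
    \<comment> \<open>the algorithm\<close>
    and start: "z 1 \<in> H 0" "\<forall>i\<in>{1..<n}. w i 1 \<in> H i"
               "\<forall>i\<in>{1..n}. x i 0 \<in> H i \<and> y i 0 \<in> H i"
    and w_n: "\<forall>k. executed n H G \<gamma> I x y k \<longrightarrow>
        w n k = - (\<Sum>i\<in>{1..<n}. adjoint_on (H 0) (G i) (w i k))"
    and backward: "\<forall>k. executed n H G \<gamma> I x y k \<longrightarrow> (\<forall>i \<in> I k \<inter> IB.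
        backward_step (H i) (T i) (\<rho> i (d i k)) (G i (z (d i k))) (w i (d i k)) (e i k) (x i k) (y i k))"
    and forward: "\<forall>k. executed n H G \<gamma> I x y k \<longrightarrow> (\<forall>i \<in> I k \<inter> IF.
        forward_step \<nu> \<Delta> (T i) (\<rho> i (d i k)) (G i (z (d i k))) (w i (d i k)) (x i k) (y i k))"
    and idle: "\<forall>k. executed n H G \<gamma> I x y k \<longrightarrow> (\<forall>i \<in> {1..n} - I k.
        x i k = x i (k - 1) \<and> y i k = y i (k - 1))"
    and return: "\<forall>k. executed n H G \<gamma> I x y k \<and> returns_at n H G \<gamma> I x y k \<longrightarrow>
        z (k + 1) = x n k \<and> (\<forall>i\<in>{1..<n}. w i (k + 1) = y i k)"
    and update: "\<forall>k. executed n H G \<gamma> I x y k \<and> \<not> returns_at n H G \<gamma> I x y k \<longrightarrow>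
        (let \<alpha> = step_length n H G \<gamma> \<beta> x y z w k in
           z (k + 1) = z k - (inverse \<gamma> * \<alpha>) *\<^sub>R coupling_v n H G y k \<and>
           (\<forall>i\<in>{1..<n}. w i (k + 1) = w i k - \<alpha> *\<^sub>R coupling_u n G x i k))"
  shows "(\<forall>k. executed n H G \<gamma> I x y k \<and> returns_at n H G \<gamma> I x y k \<longrightarrow>
            (z (k + 1), \<lambda>i\<in>{1..<n}. w i (k + 1)) \<in> extended_solution_set n H G T)
       \<and> ((\<forall>k\<ge>1. \<not> returns_at n H G \<gamma> I x y k) \<longrightarrow>
            (\<exists>zbar wbar. (zbar, wbar) \<in> extended_solution_set n H G T \<and>
               weakly_converges (product_space n H) (product_inner n)
                 (\<lambda>k. (z k, \<lambda>i\<in>{1..<n}. w i k)) (zbar, wbar) \<and>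
               (\<forall>i\<in>{1..<n}. weakly_converges (H i) (\<bullet>) (\<lambda>k. x i k) (G i zbar) \<and>
                             weakly_converges (H i) (\<bullet>) (\<lambda>k. y i k) (wbar i)) \<and>
               weakly_converges (H 0) (\<bullet>) (\<lambda>k. x n k) zbar \<and>
               weakly_converges (H 0) (\<bullet>) (\<lambda>k. y n k)
                 (- (\<Sum>i\<in>{1..<n}. adjoint_on (H 0) (G i) (wbar i)))))"
proof -
  have "1 \<in> {1..n}" using n by simp
  then obtain \<rho>lo \<rho>hi where rho': "0 < \<rho>lo"
    "\<And>i k. i \<in> {1..n} \<Longrightarrow> 1 \<le> k \<Longrightarrow> \<rho>lo \<le> \<rho> i k \<and> \<rho> i k \<le> \<rho>hi"
    using stepsize_bounds[OF _ _ R] by blast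
  interpret splitting_problem n H G T IF IB
    using n partition G_n P1 P2 P3 P4 P5 by unfold_locales auto
  interpret projective_splitting n H G T IF IB I \<beta>lo \<beta>hi \<gamma> \<nu> \<Delta> \<sigma> \<rho>lo \<rho>hi \<beta> \<rho> d M D e x y w z
  proof unfold_locales
    fix i k
    assume asm: "i \<in> IB" "1 \<le> k" "1 \<le> last_update I i k" "\<forall>j\<in>{1..k}. \<not> returns_at n H G \<gamma> I x y j"
    show "- \<sigma> * (norm (G i (z (last_delayed I d i k)) - x i k))\<^sup>2
          \<le> (G i (z (last_delayed I d i k)) - x i k) \<bullet> e i (last_update I i k) \<and>
        e i (last_update I i k) \<bullet> (y i k - w i (last_delayed I d i k))
          \<le> \<rho> i (last_delayed I d i k) * \<sigma> * (norm (y i k - w i (last_delayed I d i k)))\<^sup>2"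
      using E asm by (auto simp: Let_def)
  next
    fix k assume "executed n H G \<gamma> I x y k"
    then show "w n k = dual (\<lambda>i. w i k)" using w_n by (simp add: dual_def)
  next
    fix k assume "executed n H G \<gamma> I x y k" "\<not> returns_at n H G \<gamma> I x y k"
    then show "z (k + 1) = z k - (inverse \<gamma> * step_length n H G \<gamma> \<beta> x y z w k) *\<^sub>R coupling_v n H G y k \<and>
        (\<forall>i\<in>{1..<n}. w i (k + 1) = w i k - step_length n H G \<gamma> \<beta> x y z w k *\<^sub>R coupling_u n G x i k)"
      using update unfolding Let_def by blast
  next
    show "(\<Union>k\<in>{j..j + M - 1}. I k) = {1..n}" if "1 \<le> j" for j
      using A1(2) that by blast
  qed (use P6 beta gamma linesearch blocks rho' delay A1(1) A2 E_bounded E_sigma start backward forward idle return in auto)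
  show ?thesis
  proof (intro conjI impI allI)
    fix k assume "executed n H G \<gamma> I x y k \<and> returns_at n H G \<gamma> I x y k"
    then show "(z (k + 1), \<lambda>i\<in>{1..<n}. w i (k + 1)) \<in> extended_solution_set n H G T"
      using termination_solves by blast
  next
    assume "\<forall>k\<ge>1. \<not> returns_at n H G \<gamma> I x y k"
    then interpret nonterminating_projective_splitting n H G T IF IB I \<beta>lo \<beta>hi \<gamma> \<nu> \<Delta> \<sigma> \<rho>lo \<rho>hi \<beta> \<rho> d M D e x y w z
      by unfold_locales blast
    show "\<exists>zbar wbar. (zbar, wbar) \<in> extended_solution_set n H G T \<and>
               weakly_converges (product_space n H) (product_inner n)
                 (\<lambda>k. (z k, \<lambda>i\<in>{1..<n}. w i k)) (zbar, wbar) \<and>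
               (\<forall>i\<in>{1..<n}. weakly_converges (H i) (\<bullet>) (\<lambda>k. x i k) (G i zbar) \<and>
                             weakly_converges (H i) (\<bullet>) (\<lambda>k. y i k) (wbar i)) \<and>
               weakly_converges (H 0) (\<bullet>) (\<lambda>k. x n k) zbar \<and>
               weakly_converges (H 0) (\<bullet>) (\<lambda>k. y n k)
                 (- (\<Sum>i\<in>{1..<n}. adjoint_on (H 0) (G i) (wbar i)))"
      using converges unfolding dual_def .
  qed
qed

end
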